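(* Assume (Pur) and (Erg) hold. Then, for every $0<\alpha\le 1$, there exist two subspaces $\mathcal F$ (independent of $\alpha$) and $\mathcal G_\alpha$ of $C^\alpha(\mathrm P(\mathbb C^k),\mathbb C)$ such that (1) $C^\alpha(\mathrm P(\mathbb C^k),\mathbb C)=\mathcal F\oplus\mathcal G_\alpha$; (2) $\Pi\mathcal F\subset\mathcal F$ and $\Pi\mathcal G_\alpha\subset\mathcal G_\alpha$; (3) $\rho_\alpha(\Pi|_{\mathcal G_\alpha})<\rho_\alpha(\Pi)=1$; (4) $\mathcal F$ is finite dimensional and the spectrum of $\Pi|_{\mathcal F}$ is a finite subgroup of $U(1)=\{z\in\mathbb C:|z|=1\}$, i.e. for some $p\in\mathbb N$, $\sigma(\Pi|_{\mathcal F})=\{e^{i\frac{l}{p}2\pi}: l=0,\dots,p-1\}$. In addition, all these eigenvalues are simple.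
   Context: Let $k\in\mathbb N=\{1,2,\dots\}$ be fixed; $\mathbb C^k$ carries its canonical inner product and norm $\|\cdot\|$. $\mathrm P(\mathbb C^k)$ is the projective space with its Borel $\sigma$-algebra; $\hat x$ is the class of a nonzero vector $x$, and given $\hat x$, $x$ denotes a unit-norm representative. The metric is $d(\hat x,\hat y)=\sqrt{1-|\langle x,y\rangle|^2}$. For $v\in\mathrm M_k(\mathbb C)$ with $vx\ne0$, $v\cdot\hat x$ is the class of $vx$. For $0<\alpha\le1$, $C^\alpha(\mathrm P(\mathbb C^k),\mathbb C)$ is the Banach space of $\alpha$-Hölder functions with norm $\|f\|_\alpha=\|f\|_\infty+m_\alpha(f)$, $m_\alpha(f)=\sup_{\hat x\ne\hat y}|f(\hat x)-f(\hat y)|/d(\hat x,\hat y)^\alpha$; $\rho_\alpha$ denotes the spectral radius of bounded operators for this norm. $\mu$ is a (not necessarily finite) Borel measure on $\mathrm M_k(\mathbb C)$ with $\int\|v\|^2d\mu(v)<\infty$ and $\int v^*v\,d\mu(v)=\mathrm{Id}_{\mathbb C^k}$. The Markov operator is $\Pi f(\hat x)=\int_{\mathrm M_k(\mathbb C)}f(v\cdot\hat x)\|vx\|^2d\mu(v)$, with the integrand set to $0$ when $vx=0$. (Pur): any nonzero orthogonal projector $\pi$ on $\mathbb C^k$ such that, for every $n\in\mathbb N$, $\pi v_1^*\cdots v_n^*v_n\cdots v_1\pi\propto\pi$ (proportionality constant $0$ allowed) for $\mu^{\otimes n}$-almost every $(v_1,\dots,v_n)$, is of rank one. (Erg): there exists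 a unique minimal subspace $E\ne\{0\}$ of $\mathbb C^k$ such that $vE\subset E$ for $\mu$-almost every $v$. *)

theory Defs
  imports "HOL-Analysis.Analysis" "HOL-Library.Function_Algebras"
begin

section \<open>Complex vectors and matrices\<close>

text \<open>The library's \<^const>\<open>inner\<close> on \<open>complex ^ 'n\<close> is the real part of the Hermitian product
  below; its \<^const>\<open>norm\<close> is the Hermitian norm on vectors, and the Frobenius norm on matrices.\<close>

definition cinner :: "complex ^ 'n::finite \<Rightarrow> complex ^ 'n \<Rightarrow> complex" where
  "cinner x y = (\<Sum>i\<in>UNIV. cnj (x $ i) * y $ i)"

definition adj :: "complex ^ 'n ^ 'n \<Rightarrow> complex ^ 'n ^ 'n" where
  "adj A = (\<chi> i j. cnj (A $ j $ i))"

definition orthogonal_projector :: "complex ^ 'n::finite ^ 'n \<Rightarrow> bool" where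
  "orthogonal_projector P \<longleftrightarrow> P ** P = P \<and> adj P = P"

section \<open>Projective space\<close>

definition proj_rel :: "complex ^ 'n::finite \<Rightarrow> complex ^ 'n \<Rightarrow> bool" where
  "proj_rel x y \<longleftrightarrow> x \<noteq> 0 \<and> y \<noteq> 0 \<and> (\<exists>c. y = c *s x)"

lemma part_equivp_proj_rel: "part_equivp (proj_rel :: complex ^ 'n::finite \<Rightarrow> _)"
proof (rule part_equivpI)
  have "(axis undefined 1 :: complex ^ 'n) \<noteq> 0"
    by (simp add: axis_eq_0_iff)
  then have "proj_rel (axis undefined 1 :: complex ^ 'n) (axis undefined 1)"
    unfolding proj_rel_def by (metis vector_smult_lid)
  then show "\<exists>x. proj_rel (x :: complex ^ 'n) x" ..
  show "symp (proj_rel :: complex ^ 'n \<Rightarrow> _)"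
  proof (rule sympI)
    fix x y :: "complex ^ 'n"
    assume "proj_rel x y"
    then obtain c where c: "x \<noteq> 0" "y \<noteq> 0" "y = c *s x"
      unfolding proj_rel_def by auto
    then have "c \<noteq> 0" by auto
    then have "x = inverse c *s y"
      using c by (simp add: vector_smult_assoc)
    then show "proj_rel y x"
      using c unfolding proj_rel_def by blast
  qed
  show "transp (proj_rel :: complex ^ 'n \<Rightarrow> _)"
    by (rule transpI) (auto simp: proj_rel_def vector_smult_assoc)
qed

quotient_type 'n cproj = "complex ^ 'n::finite" / partial: proj_rel
  morphisms rep_cproj proj_class
  by (rule part_equivp_proj_rel)

text \<open>\<open>proj_class x\<close> is the class of \<open>x\<close>; it is meaningful only for \<open>x \<noteq> 0\<close>.\<close>

lemma proj_class_eq_iff: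
  assumes "x \<noteq> 0" "y \<noteq> 0"
  shows "proj_class x = proj_class y \<longleftrightarrow> (\<exists>c. y = c *s x)"
proof -
  have refl: "proj_rel z z" if "z \<noteq> 0" for z :: "complex ^ 'n"
    using that unfolding proj_rel_def by (metis vector_smult_lid)
  have "proj_class x = proj_class y \<longleftrightarrow> proj_rel x y"
    using Quotient_rel[OF Quotient_cproj, of x y] refl assms by auto
  then show ?thesis
    using assms by (simp add: proj_rel_def)
qed

lemma norm_cvector_smult: "norm (c *s (x :: complex ^ 'n::finite)) = cmod c * norm x"
  by (simp add: norm_vec_def norm_mult L2_set_right_distrib)

lemma ex_unit_rep: "\<exists>x. norm x = 1 \<and> proj_class x = p"
proof -
  have "proj_rel (rep_cproj p) (rep_cproj p)"
    by (rule Quotient_rep_reflp[OF Quotient_cproj])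
  then have nz: "rep_cproj p \<noteq> 0"
    by (simp add: proj_rel_def)
  define c where "c = complex_of_real (inverse (norm (rep_cproj p)))"
  have 1: "norm (c *s rep_cproj p) = 1"
    using nz by (simp add: norm_cvector_smult c_def norm_inverse)
  then have "c *s rep_cproj p \<noteq> 0" by auto
  then have "proj_class (rep_cproj p) = proj_class (c *s rep_cproj p)"
    using nz by (subst proj_class_eq_iff) auto
  moreover have "proj_class (rep_cproj p) = p"
    by (rule Quotient_abs_rep[OF Quotient_cproj])
  ultimately show ?thesis
    using 1 by metis
qed

definition unit_rep :: "'n::finite cproj \<Rightarrow> complex ^ 'n" where
  "unit_rep p = (SOME x. norm x = 1 \<and> proj_class x = p)"

lemma norm_unit_rep [simp]: "norm (unit_rep p) = 1"
  and proj_class_unit_rep [simp]: "proj_class (unit_rep p) = p"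
  using someI_ex[OF ex_unit_rep[of p]] by (simp_all add: unit_rep_def)

lemma unit_rep_proj_class:
  assumes "norm x = 1"
  obtains c where "cmod c = 1" "unit_rep (proj_class x) = c *s x"
proof -
  have "x \<noteq> 0" "unit_rep (proj_class x) \<noteq> 0"
    using assms norm_unit_rep[of "proj_class x"] by force+
  then obtain c where c: "unit_rep (proj_class x) = c *s x"
    using proj_class_eq_iff[of x "unit_rep (proj_class x)"] by auto
  then have "cmod c = 1"
    using assms norm_unit_rep[of "proj_class x"] by (simp add: norm_cvector_smult)
  with c show ?thesis using that by blast
qed

definition rank_one :: "complex ^ 'n::finite \<Rightarrow> complex ^ 'n ^ 'n" where
  "rank_one x = (\<chi> i j. x $ i * cnj (x $ j))"

lemma sum_cmod_power2: "(\<Sum>i\<in>UNIV. (cmod (x $ i))\<^sup>2) = (norm (x :: complex ^ 'n::finite))\<^sup>2"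
  by (simp add: norm_vec_def L2_set_def sum_nonneg)

lemma cmod_cinner_power2:
  "(cmod (cinner x y))\<^sup>2 =
    (\<Sum>i\<in>UNIV. \<Sum>j\<in>UNIV. Re (x $ i * cnj (x $ j) * cnj (y $ i * cnj (y $ j))))"
proof -
  have "(\<Sum>i\<in>UNIV. \<Sum>j\<in>UNIV. x $ i * cnj (x $ j) * cnj (y $ i * cnj (y $ j)))
      = (\<Sum>i\<in>UNIV. \<Sum>j\<in>UNIV. (x $ i * cnj (y $ i)) * (cnj (x $ j) * y $ j))"
    by (simp add: mult_ac)
  also have "\<dots> = cnj (cinner x y) * cinner x y"
    by (simp add: cinner_def sum_product)
  also have "\<dots> = complex_of_real ((cmod (cinner x y))\<^sup>2)"
    by (simp only: complex_norm_square mult.commute)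
  finally show ?thesis
    by (metis (no_types, lifting) Re_complex_of_real Re_sum sum.cong)
qed

lemma norm_rank_one_diff:
  assumes "norm x = 1" "norm y = 1"
  shows "(norm (rank_one x - rank_one y))\<^sup>2 = 2 * (1 - (cmod (cinner x y))\<^sup>2)"
proof -
  have *: "(cmod (a - b))\<^sup>2 = (cmod a)\<^sup>2 + (cmod b)\<^sup>2 - 2 * Re (a * cnj b)" for a b
    by (simp only: cmod_power2) (simp add: power2_eq_square algebra_simps)
  have one: "(\<Sum>i\<in>UNIV. \<Sum>j\<in>UNIV. (cmod (z $ i * cnj (z $ j)))\<^sup>2) = 1" if "norm z = 1"
    for z :: "complex ^ 'n"
  proof -
    have "(\<Sum>i\<in>UNIV. \<Sum>j\<in>UNIV. (cmod (z $ i * cnj (z $ j)))\<^sup>2)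
        = (\<Sum>i\<in>UNIV. (cmod (z $ i))\<^sup>2) * (\<Sum>j\<in>UNIV. (cmod (z $ j))\<^sup>2)"
      by (simp add: sum_product norm_mult power_mult_distrib)
    then show ?thesis using that by (simp add: sum_cmod_power2)
  qed
  have "(norm (rank_one x - rank_one y))\<^sup>2
      = (\<Sum>i\<in>UNIV. (norm ((rank_one x - rank_one y) $ i))\<^sup>2)"
    by (simp add: norm_vec_def L2_set_def sum_nonneg)
  also have "\<dots> = (\<Sum>i\<in>UNIV. \<Sum>j\<in>UNIV. (cmod (x $ i * cnj (x $ j) - y $ i * cnj (y $ j)))\<^sup>2)"
    by (simp add: sum_cmod_power2[symmetric] rank_one_def)
  also have "\<dots> = 1 + 1 - 2 * (cmod (cinner x y))\<^sup>2"
    unfolding * sum.distrib sum_subtractf one[OF assms(1)] one[OF assms(2)] cmod_cinner_power2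
    by (simp add: sum_distrib_left)
  finally show ?thesis by simp
qed

instantiation cproj :: (finite) metric_space
begin

definition dist_cproj :: "'a cproj \<Rightarrow> 'a cproj \<Rightarrow> real" where
  "dist p q = sqrt (1 - (cmod (cinner (unit_rep p) (unit_rep q)))\<^sup>2)"

definition uniformity_cproj :: "('a cproj \<times> 'a cproj) filter" where
  "uniformity_cproj = (INF e\<in>{0<..}. principal {(x, y). dist x y < e})"

definition open_cproj :: "'a cproj set \<Rightarrow> bool" where
  "open_cproj U = (\<forall>x\<in>U. eventually (\<lambda>(x', y). x' = x \<longrightarrow> y \<in> U) uniformity)"

instance
proof
  have d: "dist p q = norm (rank_one (unit_rep p) - rank_one (unit_rep q)) / sqrt 2"
    for p q :: "'a cproj"
  proof -
    have "norm (rank_one (unit_rep p) - rank_one (unit_rep q))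
        = sqrt (2 * (1 - (cmod (cinner (unit_rep p) (unit_rep q)))\<^sup>2))"
      by (metis norm_ge_zero norm_rank_one_diff norm_unit_rep real_sqrt_unique)
    then show ?thesis
      by (simp only: dist_cproj_def real_sqrt_mult) simp
  qed
  fix x y z :: "'a cproj"
  show "dist x y \<le> dist x z + dist y z"
    unfolding d add_divide_distrib[symmetric]
    by (intro divide_right_mono) (simp_all add: norm_triangle_le_diff
        norm_diff_triangle_le[OF order_refl] norm_minus_commute[of "rank_one (unit_rep y)"])
  show "dist x y = 0 \<longleftrightarrow> x = y"
  proof
    assume "x = y"
    then show "dist x y = 0" by (simp add: d)
  next
    assume "dist x y = 0"
    then have eq: "rank_one (unit_rep x) = rank_one (unit_rep y)"
      by (simp add: d)
    let ?x = "unit_rep x" and ?y = "unit_rep y"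
    have "?x $ i = cinner ?y ?x * ?y $ i" for i
    proof -
      have "(\<Sum>j\<in>UNIV. rank_one ?x $ i $ j * ?x $ j)
          = ?x $ i * complex_of_real (\<Sum>j\<in>UNIV. (cmod (?x $ j))\<^sup>2)"
        by (simp add: rank_one_def sum_distrib_left complex_norm_square mult_ac del: of_real_power)
      moreover have "(\<Sum>j\<in>UNIV. rank_one ?y $ i $ j * ?x $ j) = cinner ?y ?x * ?y $ i"
        by (simp add: rank_one_def cinner_def sum_distrib_left mult_ac)
      ultimately show ?thesis
        by (simp add: eq sum_cmod_power2)
    qed
    then have "?x = cinner ?y ?x *s ?y"
      by (simp add: vec_eq_iff)
    moreover have "?x \<noteq> 0" "?y \<noteq> 0"
      by (metis norm_unit_rep norm_zero zero_neq_one)+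
    ultimately have "proj_class ?y = proj_class ?x"
      by (subst proj_class_eq_iff) auto
    then show "x = y" by simp
  qed
qed (simp_all only: uniformity_cproj_def open_cproj_def)

end

lemma dist_proj_class:
  assumes "norm x = 1" "norm y = 1"
  shows "dist (proj_class x) (proj_class y) = sqrt (1 - (cmod (cinner x y))\<^sup>2)"
proof -
  obtain c where c: "cmod c = 1" "unit_rep (proj_class x) = c *s x"
    using unit_rep_proj_class[OF assms(1)] .
  obtain e where e: "cmod e = 1" "unit_rep (proj_class y) = e *s y"
    using unit_rep_proj_class[OF assms(2)] .
  have "cinner (c *s x) (e *s y) = cnj c * e * cinner x y"
    by (simp add: cinner_def sum_distrib_left mult_ac)
  then show ?thesis
    using c e by (simp add: dist_cproj_def norm_mult)
qed

definition proj_act :: "complex ^ 'n::finite ^ 'n \<Rightarrow> 'n cproj \<Rightarrow> 'n cproj" where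
  "proj_act v p = proj_class (v *v unit_rep p)"

section \<open>Complex-valued functions as a vector space\<close>

global_interpretation cfun: vector_space "\<lambda>(c :: complex) (f :: 'a \<Rightarrow> complex) x. c * f x"
  by unfold_locales (auto simp: algebra_simps)

section \<open>Hoelder functions\<close>

definition holder :: "real \<Rightarrow> ('n::finite cproj \<Rightarrow> complex) set" where
  "holder \<alpha> = {f. \<exists>C. \<forall>x y. cmod (f x - f y) \<le> C * dist x y powr \<alpha>}"

text \<open>The inserted \<open>0\<close> only matters when the projective space is a single point.\<close>

definition holder_seminorm :: "real \<Rightarrow> ('n::finite cproj \<Rightarrow> complex) \<Rightarrow> real" where
  "holder_seminorm \<alpha> f =
    Sup (insert 0 {cmod (f x - f y) / dist x y powr \<alpha> | x y. x \<noteq> y})"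

definition holder_norm :: "real \<Rightarrow> ('n::finite cproj \<Rightarrow> complex) \<Rightarrow> real" where
  "holder_norm \<alpha> f = (SUP x. cmod (f x)) + holder_seminorm \<alpha> f"

definition holder_closed :: "real \<Rightarrow> ('n::finite cproj \<Rightarrow> complex) set \<Rightarrow> bool" where
  "holder_closed \<alpha> V \<longleftrightarrow>
    (\<forall>f\<in>holder \<alpha>. (\<forall>\<epsilon>>0. \<exists>g\<in>V. holder_norm \<alpha> (f - g) < \<epsilon>) \<longrightarrow> f \<in> V)"

text \<open>In the next two definitions \<open>V\<close> is meant to be a closed \<open>T\<close>-invariant subspace of \<open>holder \<alpha>\<close>,
  and \<open>T\<close> is restricted to it. The bound by \<open>K\<close> says that \<open>(T - z)\<inverse>\<close> is bounded on \<open>V\<close>.\<close>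

definition spectrum_on ::
  "real \<Rightarrow> ('n::finite cproj \<Rightarrow> complex) set \<Rightarrow>
    (('n cproj \<Rightarrow> complex) \<Rightarrow> ('n cproj \<Rightarrow> complex)) \<Rightarrow> complex set" where
  "spectrum_on \<alpha> V T =
    {z. \<not> (bij_betw (\<lambda>f x. T f x - z * f x) V V \<and>
         (\<exists>K. \<forall>f\<in>V. holder_norm \<alpha> f \<le> K * holder_norm \<alpha> (\<lambda>x. T f x - z * f x)))}"

text \<open>Taking the supremum in \<^typ>\<open>ennreal\<close> gives the zero space spectral radius \<open>0\<close>.\<close>

definition spectral_radius_on ::
  "real \<Rightarrow> ('n::finite cproj \<Rightarrow> complex) set \<Rightarrow>
    (('n cproj \<Rightarrow> complex) \<Rightarrow> ('n cproj \<Rightarrow> complex)) \<Rightarrow> ennreal" where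
  "spectral_radius_on \<alpha> V T = (SUP z\<in>spectrum_on \<alpha> V T. ennreal (cmod z))"

definition alg_mult_on ::
  "('a \<Rightarrow> complex) set \<Rightarrow> (('a \<Rightarrow> complex) \<Rightarrow> ('a \<Rightarrow> complex)) \<Rightarrow> complex \<Rightarrow> nat" where
  "alg_mult_on V T z = cfun.dim {f \<in> V. \<exists>m. ((\<lambda>g x. T g x - z * g x) ^^ m) f = 0}"

section \<open>The Markov operator and the assumptions on the measure\<close>

definition markov_op ::
  "(complex ^ 'n::finite ^ 'n) measure \<Rightarrow> ('n cproj \<Rightarrow> complex) \<Rightarrow> 'n cproj \<Rightarrow> complex" where
  "markov_op \<mu> f p =
    (\<integral>v. (if v *v unit_rep p = 0 then 0
         else f (proj_act v p) * complex_of_real ((norm (v *v unit_rep p))\<^sup>2)) \<partial>\<mu>)"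

text \<open>\<open>word_prod v n = v\<^sub>n \<cdots> v\<^sub>1\<close>\<close>

fun word_prod :: "(nat \<Rightarrow> complex ^ 'n::finite ^ 'n) \<Rightarrow> nat \<Rightarrow> complex ^ 'n ^ 'n" where
  "word_prod v 0 = mat 1"
| "word_prod v (Suc n) = v (Suc n) ** word_prod v n"

text \<open>The measure \<open>\<mu>\<close> may fail to be \<open>\<sigma>\<close>-finite, but under the integrability assumption
  \<open>\<integral>\<parallel>v\<parallel>\<^sup>2 d\<mu> < \<infinity>\<close> only because of an infinite atom at \<open>0\<close>. Words containing the letter \<open>0\<close>
  satisfy the proportionality trivially, and on the remaining words the product measure
  is determined by its values on rectangles.\<close>

definition Pur :: "(complex ^ 'n::finite ^ 'n) measure \<Rightarrow> bool" where
  "Pur \<mu> \<longleftrightarrow>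
    (\<forall>P. orthogonal_projector P \<and> P \<noteq> 0 \<and>
       (\<forall>n\<ge>1. AE v in PiM {1..n} (\<lambda>_. \<mu>).
          \<exists>c. P ** adj (word_prod v n) ** word_prod v n ** P = mat c ** P)
     \<longrightarrow> rank P = 1)"

definition invariant_subspace ::
  "(complex ^ 'n::finite ^ 'n) measure \<Rightarrow> (complex ^ 'n) set \<Rightarrow> bool" where
  "invariant_subspace \<mu> E \<longleftrightarrow>
    vec.subspace E \<and> E \<noteq> {0} \<and> (AE v in \<mu>. (\<lambda>x. v *v x) ` E \<subseteq> E)"

definition Erg :: "(complex ^ 'n::finite ^ 'n) measure \<Rightarrow> bool" where
  "Erg \<mu> \<longleftrightarrow>
    (\<exists>!E. invariant_subspace \<mu> E \<and> (\<forall>E'. invariant_subspace \<mu> E' \<and> E' \<subseteq> E \<longrightarrow> E' = E))"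

end

theory Submission
  imports Defs "HOL-Complex_Analysis.Great_Picard"
begin

text \<open>
  On the lift \<open>F x = f(x) |x|\<^sup>2\<close> of \<open>f\<close> to the vector space, the Markov operator \<open>T\<close> is
  \<open>F \<mapsto> (x \<mapsto> \<integral> F (v x) d\<mu>(v))\<close>. Iterating one step at a time avoids all product measures, and after
  passing to the support of \<open>\<mu>\<close> the assumptions become statements about a semigroup of matrices.

  \<^emph>\<open>Lasota-Yorke.\<close> By the arithmetic-geometric mean inequality the mean area \<open>\<integral> |v x \<and> v y| d\<mu>\<close> is at
  most \<open>|x \<and> y|\<close>. The decreasing limit of the iterated means is homogeneous and invariant; at an
  orthonormal pair where it is maximal, a positive value would force every word to act conformally on
  a plane, against (Pur). So the mean area distortion tends to \<open>0\<close>, uniformly by compactness, and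
  \<open>|T\<^sup>n f x - T\<^sup>n f y| \<le> \<epsilon> m\<^sub>\<alpha>(f) d(x,y)\<^sup>\<alpha> + C |f|\<^sub>\<infinity> d(x,y)\<close> for large \<open>n\<close>.

  \<^emph>\<open>Periodicity.\<close> The same decay yields words which are nearly of rank one, and (Erg) makes their limits
  nonzero on orbits; hence some word of some length \<open>q\<close> contracts a ball to a fixed point \<open>p0\<close>, and every
  point enters this ball. By the equality case of the triangle inequality, where \<open>|T\<^sup>n f|\<close> attains the
  norm of \<open>f\<close> the values of \<open>f\<close> at the endpoints of all words of length \<open>n\<close> agree. Following the fixed
  point backwards, the limit points of \<open>T\<^sup>q\<^sup>i f\<close> are \<open>q\<close>-periodic; and eigenfunctions of modulus-one
  eigenvalues attain their norm at \<open>p0\<close>, so they are determined by their value there. Products of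
  eigenfunctions then show that the eigenvalues form a group.

  \<^emph>\<open>Decay.\<close> On the functions with \<open>T\<^sup>n f \<rightarrow> 0\<close>, convergence is uniform on the Hoelder unit ball by compactness,
  so Lasota-Yorke turns a power of \<open>T\<close> into a contraction.
\<close>

section \<open>Hermitian vectors and matrices\<close>

text \<open>Three obstacles shape the details. The Hoelder quantity d^\<alpha> is not linear in the
  area; its majorants t^(\<alpha>-1) d + t^\<alpha>, with t left free until the end, keep every
  estimate linear, so that it survives averaging one letter at a time. A rank-one limit of words may
  be nilpotent and then has no attracting fixed direction; a word supplied by (Erg) is applied
  before it to repair this. The length \<open>q\<close> of the contracting word comes out of a
  compactness argument and is in general only a multiple of the true period: that period appears
  later as the number of eigenvalues, which form a subgroup of the q-th roots of unity.

  The finite-dimensional space does not depend on \<alpha> because letting \<epsilon> tend to 0 in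
  the Lasota-Yorke inequality leaves a Lipschitz bound for limit points, so exponent 1 can be used
  in its definition. No abstract quasi-compactness theorem enters: the complement is explicit, and
  all statements on spectra reduce to a Neumann series or to the factorisation of T^N - z^N by T -
  z.\<close>

lemma cinner_self: "cinner x x = complex_of_real ((norm x)\<^sup>2)"
  unfolding cinner_def sum_cmod_power2[symmetric] of_real_sum
  by (intro sum.cong refl) (simp only: complex_norm_square mult.commute)

lemma cinner_add_right: "cinner x (y + z) = cinner x y + cinner x z"
  by (simp add: cinner_def sum.distrib algebra_simps)

lemma cinner_diff_right: "cinner x (y - z) = cinner x y - cinner x z"
  by (simp add: cinner_def sum_subtractf algebra_simps)

lemma cinner_smult_right: "cinner x (c *s y) = c * cinner x y"
  by (simp add: cinner_def sum_distrib_left mult_ac)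

lemma cinner_smult_left: "cinner (c *s x) y = cnj c * cinner x y"
  by (simp add: cinner_def sum_distrib_left mult_ac)

lemma cinner_commute: "cinner x y = cnj (cinner y x)"
  by (simp add: cinner_def mult_ac)

lemma normalize_cvector:
  assumes "x \<noteq> (0 :: complex ^ 'n::finite)"
  obtains u where "norm u = 1" "x = complex_of_real (norm x) *s u"
proof
  let ?u = "complex_of_real (inverse (norm x)) *s x"
  show "norm ?u = 1"
    using assms by (simp add: norm_cvector_smult norm_inverse)
  have "complex_of_real (norm x) * complex_of_real (inverse (norm x)) = 1"
    using assms by simp
  then show "x = complex_of_real (norm x) *s ?u"
    by (simp only: vector_smult_assoc vector_smult_lid)
qed

lemma norm_add_power2:
  "(norm (x + y :: complex ^ 'n::finite))\<^sup>2 = (norm x)\<^sup>2 + (norm y)\<^sup>2 + 2 * Re (cinner x y)"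
proof -
  have "(cmod (a + b))\<^sup>2 = (cmod a)\<^sup>2 + (cmod b)\<^sup>2 + 2 * Re (cnj a * b)" for a b
    by (simp only: cmod_power2) (simp add: power2_eq_square algebra_simps)
  then show ?thesis
    by (simp add: sum_cmod_power2[symmetric] cinner_def sum.distrib sum_distrib_left)
qed

lemma norm_matrix_power2:
  "(norm (A :: complex ^ 'n::finite ^ 'n))\<^sup>2 = (\<Sum>i\<in>UNIV. \<Sum>j\<in>UNIV. (cmod (A $ i $ j))\<^sup>2)"
proof -
  have "(norm A)\<^sup>2 = (\<Sum>i\<in>UNIV. (norm (A $ i))\<^sup>2)"
    by (simp add: norm_vec_def L2_set_def sum_nonneg)
  then show ?thesis
    by (simp add: sum_cmod_power2)
qed

text \<open>The column form turns |v A|^2 into a finite sum of terms |v x|^2, each of which is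
  preserved on average by the measure.\<close>

lemma norm_matrix_columns:
  "(norm (A :: complex ^ 'n::finite ^ 'n))\<^sup>2 = (\<Sum>j\<in>UNIV. (norm (A *v axis j 1))\<^sup>2)"
  unfolding norm_matrix_power2 sum_cmod_power2[symmetric]
  by (subst sum.swap) (simp add: matrix_vector_mult_def axis_def if_distrib[of "(*) _"] cong: if_cong)

lemma norm_matrix_vector_le:
  "norm ((A :: complex ^ 'n::finite ^ 'n) *v x) \<le> norm A * norm x"
proof -
  have row: "cmod ((A *v x) $ i) \<le> norm (A $ i) * norm x" for i
  proof -
    have "cmod ((A *v x) $ i) \<le> (\<Sum>j\<in>UNIV. \<bar>cmod (A $ i $ j)\<bar> * \<bar>cmod (x $ j)\<bar>)"
      unfolding matrix_vector_mult_def by (simp add: norm_mult sum_norm_le)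
    also have "\<dots> \<le> L2_set (\<lambda>j. cmod (A $ i $ j)) UNIV * L2_set (\<lambda>j. cmod (x $ j)) UNIV"
      by (rule L2_set_mult_ineq)
    finally show ?thesis by (simp add: norm_vec_def)
  qed
  have "norm (A *v x) \<le> L2_set (\<lambda>i. norm (A $ i) * norm x) UNIV"
    unfolding norm_vec_def[of "A *v x"] using row by (intro L2_set_mono) auto
  also have "\<dots> = norm A * norm x"
    by (simp add: norm_vec_def[of A] L2_set_left_distrib)
  finally show ?thesis .
qed

lemma bounded_bilinear_matrix_vector:
  "bounded_bilinear ((*v) :: complex ^ 'n::finite ^ 'n \<Rightarrow> complex ^ 'n \<Rightarrow> complex ^ 'n)"
proof
  show "\<exists>K. \<forall>(a :: complex ^ 'n ^ 'n) b. norm (a *v b) \<le> norm a * norm b * K"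
    by (intro exI[of _ 1]) (simp add: norm_matrix_vector_le)
qed (auto simp: vec_eq_iff matrix_vector_mult_def algebra_simps sum.distrib scaleR_sum_right)

lemmas continuous_on_matrix_vector [continuous_intros] =
  bounded_bilinear.continuous_on[OF bounded_bilinear_matrix_vector]

lemmas tendsto_matrix_vector [tendsto_intros] =
  bounded_bilinear.tendsto[OF bounded_bilinear_matrix_vector]

lemma norm_matrix_mult_le:
  "norm ((A :: complex ^ 'n::finite ^ 'n) ** (B :: complex ^ 'n ^ 'n)) \<le> norm A * norm B"
proof -
  have "(norm (A ** B))\<^sup>2 = (\<Sum>j\<in>UNIV. (norm (A *v (B *v axis j 1)))\<^sup>2)"
    by (simp add: norm_matrix_columns[of "A ** B"] matrix_vector_mul_assoc)
  also have "\<dots> \<le> (\<Sum>j\<in>UNIV. (norm A * norm (B *v axis j 1))\<^sup>2)"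
    by (intro sum_mono power_mono norm_matrix_vector_le) auto
  also have "\<dots> = (norm A * norm B)\<^sup>2"
    by (simp add: power_mult_distrib norm_matrix_columns[of B] sum_distrib_left)
  finally show ?thesis
    by (rule power2_le_imp_le) simp
qed

lemma bounded_bilinear_matrix_mult:
  "bounded_bilinear ((**) :: complex ^ 'n::finite ^ 'n \<Rightarrow> complex ^ 'n ^ 'n \<Rightarrow> complex ^ 'n ^ 'n)"
proof
  show "\<exists>K. \<forall>(a :: complex ^ 'n ^ 'n) (b :: complex ^ 'n ^ 'n). norm (a ** b) \<le> norm a * norm b * K"
    by (intro exI[of _ 1]) (simp add: norm_matrix_mult_le)
qed (auto simp: vec_eq_iff matrix_matrix_mult_def algebra_simps sum.distrib scaleR_sum_right)

lemma norm_adj [simp]: "norm (adj A) = norm (A :: complex ^ 'n::finite ^ 'n)"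
proof -
  have "(norm (adj A))\<^sup>2 = (norm A)\<^sup>2"
    unfolding norm_matrix_power2 by (subst sum.swap) (simp add: adj_def)
  then show ?thesis by (simp add: power2_eq_iff_nonneg)
qed

lemma cinner_adj: "cinner x (adj A *v y) = cinner (A *v x) y"
proof -
  have "cinner x (adj A *v y) = (\<Sum>i\<in>UNIV. \<Sum>j\<in>UNIV. cnj (x $ i) * (cnj (A $ j $ i) * y $ j))"
    by (simp add: cinner_def adj_def matrix_vector_mult_def sum_distrib_left)
  also have "\<dots> = (\<Sum>j\<in>UNIV. \<Sum>i\<in>UNIV. cnj (x $ i) * (cnj (A $ j $ i) * y $ j))"
    by (rule sum.swap)
  also have "\<dots> = cinner (A *v x) y"
    by (simp add: cinner_def matrix_vector_mult_def sum_distrib_left sum_distrib_right mult_ac)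
  finally show ?thesis .
qed

lemma matrix_vector_smult: "(A :: complex ^ 'n::finite ^ 'n) *v (c *s x) = c *s (A *v x)"
  by (simp add: vec.scale)

lemma norm_matrix_vector_power2:
  "(norm (A *v x))\<^sup>2 = Re (cinner x ((adj A ** A) *v x))"
  by (simp add: matrix_vector_mul_assoc[symmetric] cinner_adj cinner_self)

section \<open>Area of parallelograms\<close>

text \<open>The entries are the Pluecker coordinates of the bivector of x and y. Each unordered pair
  of indices occurs twice, whence the factor \<open>sqrt 2\<close> in \<open>area\<close>.\<close>

definition wedge :: "complex ^ 'n::finite \<Rightarrow> complex ^ 'n \<Rightarrow> complex ^ 'n ^ 'n" where
  "wedge x y = (\<chi> i j. x $ i * y $ j - x $ j * y $ i)"

definition area :: "complex ^ 'n::finite \<Rightarrow> complex ^ 'n \<Rightarrow> real" where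
  "area x y = norm (wedge x y) / sqrt 2"

lemma area_nonneg [simp]: "0 \<le> area x y"
  by (simp add: area_def)

text \<open>Lagrange's identity: the right-hand side is the Gram determinant. Its nonnegativity
  serves as the Cauchy-Schwarz inequality below.\<close>

lemma area_power2: "(area x y)\<^sup>2 = (norm x)\<^sup>2 * (norm y)\<^sup>2 - (cmod (cinner x y))\<^sup>2"
proof -
  have *: "(cmod (a * b - c * d))\<^sup>2 = (cmod a)\<^sup>2 * (cmod b)\<^sup>2 + (cmod c)\<^sup>2 * (cmod d)\<^sup>2
      - 2 * Re (a * cnj c * cnj (d * cnj b))" for a b c d
    by (simp only: cmod_power2) (simp add: power2_eq_square algebra_simps)
  have 1: "(\<Sum>i\<in>UNIV. \<Sum>j\<in>UNIV. (cmod (x $ i))\<^sup>2 * (cmod (y $ j))\<^sup>2) = (norm x)\<^sup>2 * (norm y)\<^sup>2"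
    by (simp add: sum_cmod_power2[symmetric] sum_product)
  have 2: "(\<Sum>i\<in>UNIV. \<Sum>j\<in>UNIV. (cmod (x $ j))\<^sup>2 * (cmod (y $ i))\<^sup>2) = (norm x)\<^sup>2 * (norm y)\<^sup>2"
    by (subst sum.swap) (rule 1)
  have "(norm (wedge x y))\<^sup>2 = 2 * ((norm x)\<^sup>2 * (norm y)\<^sup>2) - 2 * (cmod (cinner x y))\<^sup>2"
    unfolding norm_matrix_power2 wedge_def vec_lambda_beta * sum.distrib sum_subtractf 1 2
      cmod_cinner_power2 sum_distrib_left by simp
  then show ?thesis
    by (simp add: area_def power_divide)
qed

lemma area_le: "area x y \<le> norm x * norm y"
  by (rule power2_le_imp_le) (simp_all add: area_power2 power_mult_distrib)

lemma area_smult: "area (a *s x) (b *s y) = cmod a * cmod b * area x y"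
proof -
  have "(area (a *s x) (b *s y))\<^sup>2 = (cmod a * cmod b * area x y)\<^sup>2"
    by (simp add: area_power2 power_mult_distrib norm_cvector_smult cinner_smult_left
        cinner_smult_right norm_mult algebra_simps)
  then show ?thesis by (simp add: power2_eq_iff_nonneg)
qed

lemma area_shear: "area x (b *s x + y) = area x y"
  by (simp add: area_def wedge_def algebra_simps)

lemma area_triangle_left: "area (x + x') y \<le> area x y + area x' y"
proof -
  have "wedge (x + x') y = wedge x y + wedge x' y"
    by (simp add: wedge_def vec_eq_iff algebra_simps)
  then show ?thesis
    by (simp add: area_def add_divide_distrib[symmetric] divide_right_mono norm_triangle_ineq)
qed

lemma area_commute: "area x y = area y x"
proof -
  have "wedge x y = - wedge y x"
    by (simp add: wedge_def vec_eq_iff)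
  then show ?thesis by (simp add: area_def)
qed

lemma area_triangle_right: "area x (y + y') \<le> area x y + area x y'"
  using area_triangle_left[of y y' x] by (simp add: area_commute)

lemma area_zero [simp]: "area 0 y = 0" "area x 0 = 0"
  by (simp_all add: area_def wedge_def vec_eq_iff)

lemma area_eq_0_imp:
  assumes "area x y = 0" "x \<noteq> 0"
  shows "\<exists>c. y = c *s x"
proof -
  have "wedge x y = 0" using assms(1) by (simp add: area_def)
  then have e: "x $ i * y $ j = x $ j * y $ i" for i j
    by (simp add: wedge_def vec_eq_iff)
  obtain i where i: "x $ i \<noteq> 0"
    using assms(2) by (auto simp: vec_eq_iff)
  have "y = (y $ i / x $ i) *s x"
    unfolding vec_eq_iff using i e[of i] by (simp add: field_simps)
  then show ?thesis ..
qed

text \<open>Subtracting from \<open>y\<close> its fourier_component along \<open>x\<close> changes neither side.\<close>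

lemma alternating_le_area:
  fixes \<Omega> :: "complex ^ 'n::finite \<Rightarrow> complex ^ 'n \<Rightarrow> real"
  assumes shear: "\<And>x y b. \<Omega> x (b *s x + y) = \<Omega> x y"
    and smult: "\<And>x y a b. \<Omega> (a *s x) (b *s y) = cmod a * cmod b * \<Omega> x y"
    and unit: "\<And>x y. norm x = 1 \<Longrightarrow> norm y = 1 \<Longrightarrow> cinner x y = 0 \<Longrightarrow> \<Omega> x y \<le> K"
  shows "\<Omega> x y \<le> K * area x y"
proof (cases "x = 0")
  case True
  then show ?thesis using smult[of 0 x 1 y] by simp
next
  case False
  define b where "b = cinner x y / cinner x x"
  define z where "z = y - b *s x"
  have y: "y = b *s x + z" by (simp add: z_def)
  have "cinner x x \<noteq> 0" using False by (simp add: cinner_self)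
  then have xz: "cinner x z = 0"
    by (simp add: z_def cinner_diff_right cinner_smult_right b_def)
  have "\<Omega> x z \<le> K * area x z"
  proof (cases "z = 0")
    case True
    then show ?thesis using smult[of 1 x 0 z] by simp
  next
    case z: False
    obtain x' where x': "norm x' = 1" "x = complex_of_real (norm x) *s x'"
      using normalize_cvector[OF False] .
    obtain z' where z': "norm z' = 1" "z = complex_of_real (norm z) *s z'"
      using normalize_cvector[OF z] .
    have "\<Omega> x z = norm x * norm z * \<Omega> x' z'"
      by (subst x'(2), subst z'(2)) (simp add: smult)
    moreover have "cinner x' z' = 0"
      using xz False z by (subst (asm) x'(2), subst (asm) z'(2))
        (simp add: cinner_smult_left cinner_smult_right)
    with x'(1) z'(1) have "norm x * norm z * \<Omega> x' z' \<le> norm x * norm z * K"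
      by (intro mult_left_mono unit) simp_all
    moreover have "norm x * norm z = area x z"
      by (rule power2_eq_imp_eq) (simp_all add: area_power2 xz power_mult_distrib)
    ultimately show ?thesis by (simp add: mult.commute)
  qed
  then show ?thesis by (simp only: y shear area_shear)
qed

section \<open>The projective space\<close>

lemma unit_rep_nonzero [simp]: "unit_rep p \<noteq> 0"
  by (metis norm_unit_rep norm_zero zero_neq_one)

lemma proj_class_smult:
  assumes "x \<noteq> 0" "c \<noteq> 0"
  shows "proj_class (c *s x) = proj_class x"
  using assms proj_class_eq_iff[of x "c *s x"] by auto

lemma unit_rep_proj_class_nonzero:
  assumes "x \<noteq> 0"
  obtains c where "cmod c = norm x" "x = c *s unit_rep (proj_class x)"
proof -
  obtain c where c: "x = c *s unit_rep (proj_class x)"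
    using proj_class_eq_iff[of "unit_rep (proj_class x)" x] assms by auto
  then have "norm x = cmod c"
    by (metis norm_cvector_smult norm_unit_rep mult.right_neutral)
  with c that show ?thesis by auto
qed

lemma dist_cproj_area: "dist p q = area (unit_rep p) (unit_rep q)"
  unfolding dist_cproj_def by (rule real_sqrt_unique) (simp_all add: area_power2)

text \<open>The projective distance is the scale-free area, so contraction of distances is proved by
  bounding areas from above and norms from below.\<close>

lemma area_eq_dist:
  assumes "x \<noteq> 0" "y \<noteq> 0"
  shows "area x y = norm x * norm y * dist (proj_class x) (proj_class y)"
proof -
  obtain a where a: "cmod a = norm x" "x = a *s unit_rep (proj_class x)"
    using unit_rep_proj_class_nonzero[OF assms(1)] .
  obtain b where b: "cmod b = norm y" "y = b *s unit_rep (proj_class y)"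
    using unit_rep_proj_class_nonzero[OF assms(2)] .
  have "area x y = cmod a * cmod b * area (unit_rep (proj_class x)) (unit_rep (proj_class y))"
    by (subst a(2), subst b(2), rule area_smult)
  then show ?thesis
    by (simp add: a(1) b(1) dist_cproj_area)
qed

lemma dist_cproj_le_1: "dist p (q :: 'n::finite cproj) \<le> 1"
  using area_le[of "unit_rep p" "unit_rep q"] by (simp add: dist_cproj_area)

text \<open>Lifts are compared at vectors while the distance only sees lines. With the phase that
  makes the inner product equal to |s|, the squared difference is 2 - 2|s|, and |s| \<le> 1 bounds
  this by 2 (1 - |s|^2).\<close>

lemma optimal_phase:
  assumes "norm x = 1" "norm (y :: complex ^ 'n::finite) = 1"
  obtains c where "cmod c = 1" "norm (x - c *s y) \<le> sqrt 2 * dist (proj_class x) (proj_class y)"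
proof -
  define s where "s = cinner x y"
  define c where "c = (if s = 0 then 1 else cnj s / complex_of_real (cmod s))"
  have c: "cmod c = 1" by (simp add: c_def norm_divide)
  have "cnj s * s = complex_of_real ((cmod s)\<^sup>2)"
    by (simp only: complex_norm_square mult.commute)
  then have cs: "c * s = complex_of_real (cmod s)"
    by (simp add: c_def power2_eq_square)
  have s1: "cmod s \<le> 1"
  proof -
    have "(cmod s)\<^sup>2 \<le> 1\<^sup>2"
      using zero_le_power2[of "area x y"] unfolding area_power2 s_def by (simp add: assms)
    then show ?thesis by (rule power2_le_imp_le) simp
  qed
  have "x - c *s y = x + (- c) *s y"
    by (simp add: vec_eq_iff)
  then have "(norm (x - c *s y))\<^sup>2 = 2 - 2 * cmod s"
    using assms c cs by (simp only: norm_add_power2 norm_cvector_smult cinner_smult_right)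
      (simp add: s_def[symmetric])
  also have "\<dots> \<le> 2 * (1 - (cmod s)\<^sup>2)"
    using s1 mult_left_le_one_le[of "cmod s" "cmod s"] by (simp add: power2_eq_square)
  also have "\<dots> = (sqrt 2 * dist (proj_class x) (proj_class y))\<^sup>2"
    using assms s1 by (simp add: dist_proj_class power_mult_distrib s_def abs_square_le_1)
  finally have "norm (x - c *s y) \<le> sqrt 2 * dist (proj_class x) (proj_class y)"
    by (rule power2_le_imp_le) simp
  with c that show ?thesis by blast
qed

lemma continuous_on_proj_class: "continuous_on (- {0}) (proj_class :: complex ^ 'n::finite \<Rightarrow> _)"
  unfolding continuous_on_sequentially comp_def
proof (intro allI ballI impI, elim conjE)
  fix X :: "nat \<Rightarrow> complex ^ 'n" and x
  assume X: "X \<longlonglongrightarrow> x" "\<forall>n. X n \<in> - {0}" and x: "x \<in> - {0}"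
  have "(\<lambda>n. area (X n) x / (norm (X n) * norm x)) \<longlonglongrightarrow> area x x / (norm x * norm x)"
    using x X(1) unfolding area_def wedge_def
    by (intro tendsto_intros tendsto_vec_lambda) auto
  moreover have "area x x = 0"
    using area_power2[of x x] by (simp add: cinner_self norm_power)
  moreover have "area (X n) x / (norm (X n) * norm x) = dist (proj_class (X n)) (proj_class x)" for n
    using X(2) x by (simp add: area_eq_dist)
  ultimately show "(\<lambda>n. proj_class (X n)) \<longlonglongrightarrow> proj_class x"
    by (subst tendsto_dist_iff) simp
qed

lemma range_proj_class_sphere: "proj_class ` sphere 0 1 = (UNIV :: 'n::finite cproj set)"
proof -
  have "p \<in> proj_class ` sphere 0 1" for p :: "'n cproj"
    by (rule image_eqI[of _ _ "unit_rep p"]) auto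
  then show ?thesis by auto
qed

lemma compact_UNIV_cproj: "compact (UNIV :: 'n::finite cproj set)"
proof -
  have "continuous_on (sphere 0 1) (proj_class :: complex ^ 'n \<Rightarrow> _)"
    by (rule continuous_on_subset[OF continuous_on_proj_class]) auto
  from compact_continuous_image[OF this] show ?thesis
    by (simp add: range_proj_class_sphere)
qed

text \<open>Every function on the projective space is encoded by its \<open>|c|\<^sup>2\<close>-homogeneous lift to the vector
  space, on which the Markov operator acts without normalisation.\<close>

definition lift :: "('n::finite cproj \<Rightarrow> complex) \<Rightarrow> complex ^ 'n \<Rightarrow> complex" where
  "lift f x = (if x = 0 then 0 else f (proj_class x) * complex_of_real ((norm x)\<^sup>2))"

lemma lift_zero [simp]: "lift f 0 = 0"
  by (simp add: lift_def)

lemma lift_smult: "lift f (c *s x) = complex_of_real ((cmod c)\<^sup>2) * lift f x"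
  by (cases "c = 0 \<or> x = 0")
    (auto simp: lift_def proj_class_smult norm_cvector_smult power_mult_distrib)

lemma lift_unit_rep [simp]: "lift f (unit_rep p) = f p"
  by (simp add: lift_def)

lemma norm_lift_le:
  assumes "\<And>p. cmod (f p) \<le> s"
  shows "cmod (lift f x) \<le> s * (norm x)\<^sup>2"
proof -
  have "0 \<le> s" using assms[of undefined] norm_ge_zero order_trans by blast
  then show ?thesis
    using assms by (auto simp: lift_def norm_mult norm_power intro!: mult_right_mono)
qed

lemma bounded_cproj:
  fixes f :: "'n::finite cproj \<Rightarrow> complex"
  assumes "continuous_on UNIV f"
  obtains s where "\<And>p. cmod (f p) \<le> s"
proof -
  have "compact (f ` UNIV)"
    by (intro compact_continuous_image assms compact_UNIV_cproj)
  then have "bounded (f ` UNIV)" by (rule compact_imp_bounded)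
  then show ?thesis using that by (auto simp: bounded_iff)
qed

text \<open>Away from 0 this is a composition of continuous maps. At 0, where the class of x has no
  limit, the factor |x|^2 takes over, with \<open>f\<close> bounded by compactness.\<close>

lemma continuous_on_lift:
  assumes "continuous_on UNIV f"
  shows "continuous_on UNIV (lift f)"
proof -
  obtain s where s: "\<And>p. cmod (f p) \<le> s"
    using bounded_cproj[OF assms] by blast
  have "continuous (at x) (lift f)" for x
  proof (cases "x = 0")
    case True
    have "((\<lambda>x :: complex ^ 'a. s * (norm x)\<^sup>2) \<longlongrightarrow> s * (norm (0 :: complex ^ 'a))\<^sup>2) (at 0)"
      by (intro tendsto_intros)
    then have "((\<lambda>x :: complex ^ 'a. s * (norm x)\<^sup>2) \<longlongrightarrow> 0) (at 0)"
      by simp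
    moreover have "\<forall>\<^sub>F x in at 0. norm (lift f x) \<le> s * (norm x)\<^sup>2"
      by (intro always_eventually allI norm_lift_le s)
    ultimately have "(lift f \<longlongrightarrow> 0) (at 0)"
      by (rule Lim_null_comparison[rotated])
    then show ?thesis using True by (simp add: continuous_at)
  next
    case False
    have "continuous_on (- {0}) (\<lambda>x. f (proj_class x) * complex_of_real ((norm x)\<^sup>2))"
      by (intro continuous_intros continuous_on_compose2[OF assms] continuous_on_proj_class) auto
    then have "continuous_on (- {0}) (lift f)"
      by (rule continuous_on_eq) (simp add: lift_def)
    then show ?thesis
      using False by (simp add: continuous_on_eq_continuous_at open_Compl)
  qed
  then show ?thesis by (simp add: continuous_on_eq_continuous_at)
qed

section \<open>Null sets of product measures and supports\<close>

text \<open>\<open>extend_measure\<close> chooses some measure with the prescribed values, and falls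
  back to the zero measure if there is none or if all values are 0. In both cases a generator with
  prescribed value 0 is null.\<close>

lemma emeasure_extend_measure_eq_0:
  assumes sub: "G ` I \<subseteq> Pow \<Omega>" and i: "i \<in> I" "\<mu> i = 0"
  shows "emeasure (extend_measure \<Omega> I G \<mu>) (G i) = 0"
proof -
  define P where "P \<mu>' \<longleftrightarrow> (\<forall>i\<in>I. \<mu>' (G i) = \<mu> i) \<and> measure_space \<Omega> (sigma_sets \<Omega> (G ` I)) \<mu>'" for \<mu>'
  define M where "M = extend_measure \<Omega> I G \<mu>"
  have sets_M: "sets M = sigma_sets \<Omega> (G ` I)"
    using sub by (simp add: M_def sets_extend_measure)
  have Gi: "G i \<in> sets M" using i by (auto simp: sets_M)
  show ?thesis
  proof (cases "(\<exists>\<mu>'. P \<mu>') \<and> \<not> (\<forall>i\<in>I. \<mu> i = 0)")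
    case True
    then have M_eq: "M = measure_of \<Omega> (G ` I) (Eps P)"
      by (simp add: M_def extend_measure_def P_def[symmetric])
    have P: "P (Eps P)" using True someI_ex[of P] by blast
    have "emeasure M (G i) = Eps P (G i)"
      using P by (intro emeasure_measure_of[OF M_eq sub _ _ Gi])
        (auto simp: P_def measure_space_def sets_M)
    then show ?thesis using P i by (simp add: P_def M_def)
  next
    case False
    then have M_eq: "M = measure_of \<Omega> (G ` I) (\<lambda>_. 0)"
      unfolding M_def extend_measure_def P_def[symmetric] by (rule if_not_P)
    have "emeasure M (G i) = 0"
      by (intro emeasure_measure_of[OF M_eq sub _ _ Gi])
        (auto simp: positive_def countably_additive_def)
    then show ?thesis by (simp add: M_def)
  qed
qed

text \<open>No \<open>\<sigma>\<close>-finiteness: whatever measure \<^const>\<open>PiM\<close> selects, rectangles with a null side are null.\<close>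

lemma AE_PiM_coordinate:
  assumes "finite I" "i \<in> I" "AE x in M i. Q x"
  shows "AE v in PiM I M. Q (v i)"
proof -
  obtain A where A: "{x \<in> space (M i). \<not> Q x} \<subseteq> A" "A \<in> sets (M i)" "emeasure (M i) A = 0"
    using assms(3) by (auto elim: AE_E)
  let ?R = "prod_emb I M {i} (\<Pi>\<^sub>E j\<in>{i}. A)"
  let ?I = "{(J, X). (J \<noteq> {} \<or> I = {}) \<and> finite J \<and> J \<subseteq> I \<and> X \<in> (\<Pi> j\<in>J. sets (M j))}"
  have R: "?R \<in> sets (PiM I M)"
    using assms(2) A(2) by (intro sets_PiM_I) auto
  have "emeasure (PiM I M) ((\<lambda>(J, X). prod_emb I M J (\<Pi>\<^sub>E j\<in>J. X j)) ({i}, \<lambda>_. A)) = 0"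
    unfolding PiM_def
  proof (rule emeasure_extend_measure_eq_0)
    show "(\<lambda>(J, X). prod_emb I M J (\<Pi>\<^sub>E j\<in>J. X j)) ` ?I \<subseteq> Pow (\<Pi>\<^sub>E i\<in>I. space (M i))"
      by (auto simp: prod_emb_def)
    show "({i}, \<lambda>_. A) \<in> ?I"
      using assms A by auto
    \<comment> \<open>The finite product contains the factor of index \<open>i\<close>, which is 0;
      infinite factors do no harm because 0 times \<infinity> is 0 in
      \<open>ennreal\<close>.\<close>
    show "(case ({i}, \<lambda>_. A) of (J, X) \<Rightarrow> \<Prod>j\<in>J \<union> {i\<in>I. emeasure (M i) (space (M i)) \<noteq> 1}.
        if j \<in> J then emeasure (M j) (X j) else emeasure (M j) (space (M j))) = 0"
      using assms A by (auto intro!: prod_zero bexI[of _ i])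
  qed
  then have "?R \<in> null_sets (PiM I M)" using R by auto
  moreover have "{v \<in> space (PiM I M). \<not> Q (v i)} \<subseteq> ?R"
    using A(1) assms(2) by (auto simp: prod_emb_iff space_PiM PiE_iff)
  ultimately show ?thesis by (rule AE_I')
qed

section \<open>Topological support of a measure\<close>

definition support :: "'a::topological_space measure \<Rightarrow> 'a set" where
  "support \<mu> = {v. \<forall>U. open U \<and> v \<in> U \<longrightarrow> emeasure \<mu> U \<noteq> 0}"

text \<open>The complement of the support is the union of all null open sets; by Lindeloef countably
  many of them suffice. No finiteness of the measure enters.\<close>

lemma AE_in_support:
  fixes \<mu> :: "'a::second_countable_topology measure"
  assumes "sets \<mu> = sets borel"
  shows "AE v in \<mu>. v \<in> support \<mu>"
proof -
  let ?F = "{U. open U \<and> emeasure \<mu> U = 0}"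
  obtain F where F: "F \<subseteq> ?F" "countable F" "\<Union>F = \<Union>?F"
    by (rule Lindelof[of ?F]) auto
  have "(\<Union>U\<in>F. U) \<in> null_sets \<mu>"
    using F assms by (intro null_sets_UN' F(2)) (auto intro!: null_setsI)
  moreover have "{v \<in> space \<mu>. v \<notin> support \<mu>} \<subseteq> (\<Union>U\<in>F. U)"
    using F(3) by (auto simp: support_def)
  ultimately show ?thesis by (rule AE_I')
qed

text \<open>The complement of \<open>C\<close> is open and null, so it contains no point of the
  support.\<close>

lemma closed_AE_imp_support:
  assumes "closed C" "AE v in \<mu>. v \<in> C" "sets \<mu> = sets borel" "v \<in> support \<mu>"
  shows "v \<in> C"
proof (rule ccontr)
  assume "v \<notin> C"
  then have "emeasure \<mu> (- C) \<noteq> 0"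
    using assms(1,4) by (auto simp: support_def)
  moreover have "emeasure \<mu> (- C) = 0"
    using assms sets_eq_imp_space_eq[OF assms(3)] by (subst (asm) AE_iff_measurable[of "- C"]) auto
  ultimately show False by simp
qed

section \<open>Integration along the measure\<close>

locale markov_measure =
  fixes \<mu> :: "(complex ^ 'n::finite ^ 'n) measure"
  assumes sets_mu: "sets \<mu> = sets borel"
    and integrable_power2_norm: "integrable \<mu> (\<lambda>v. (norm v)\<^sup>2)"
    and integral_adj: "(\<integral>v. adj v ** v \<partial>\<mu>) = mat 1"
begin

abbreviation "T \<equiv> markov_op \<mu>"
abbreviation "S \<equiv> support \<mu>"

lemma measurable_cont: "continuous_on UNIV \<phi> \<Longrightarrow> \<phi> \<in> borel_measurable \<mu>"
  for \<phi> :: "complex ^ 'n ^ 'n \<Rightarrow> 'b::topological_space"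
  using borel_measurable_continuous_onI measurable_cong_sets[OF sets_mu refl] by blast

lemma integrable_cont:
  fixes \<phi> :: "complex ^ 'n ^ 'n \<Rightarrow> 'b::{banach, second_countable_topology}"
  assumes "continuous_on UNIV \<phi>" "\<And>v. norm (\<phi> v) \<le> K * (norm v)\<^sup>2"
  shows "integrable \<mu> \<phi>"
proof (rule Bochner_Integration.integrable_bound)
  show "integrable \<mu> (\<lambda>v. K * (norm v)\<^sup>2)"
    by (intro integrable_mult_right integrable_power2_norm)
  show "AE v in \<mu>. norm (\<phi> v) \<le> norm (K * (norm v)\<^sup>2)"
    by (intro always_eventually allI order_trans[OF assms(2)]) simp
qed (rule measurable_cont[OF assms(1)])

lemma integrable_adj: "integrable \<mu> (\<lambda>v. adj v ** v)"
proof (rule integrable_cont)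
  show "continuous_on UNIV (\<lambda>v. adj v ** v :: complex ^ 'n ^ 'n)"
    unfolding adj_def matrix_matrix_mult_def by (auto intro!: continuous_intros)
  show "norm (adj v ** v) \<le> 1 * (norm v)\<^sup>2" for v :: "complex ^ 'n ^ 'n"
    using norm_matrix_mult_le[of "adj v" v] by (simp add: power2_eq_square)
qed

lemma integrable_norm_apply: "integrable \<mu> (\<lambda>v. (norm (v *v x))\<^sup>2)"
proof (rule integrable_cont)
  show "continuous_on UNIV (\<lambda>v :: complex ^ 'n ^ 'n. (norm (v *v x))\<^sup>2)"
    by (intro continuous_intros)
  show "norm ((norm (v *v x))\<^sup>2) \<le> (norm x)\<^sup>2 * (norm v)\<^sup>2" for v :: "complex ^ 'n ^ 'n"
    using power_mono[OF norm_matrix_vector_le[of v x], of 2] by (simp add: power_mult_distrib mult.commute)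
qed

text \<open>The integrand is a real-linear function of \<open>adj v ** v\<close>, so the
  normalisation of the measure can be inserted after exchanging this function with the
  integral.\<close>

lemma integral_norm_apply: "(\<integral>v. (norm (v *v x))\<^sup>2 \<partial>\<mu>) = (norm x)\<^sup>2"
proof -
  have bl: "bounded_linear (\<lambda>A :: complex ^ 'n ^ 'n. Re (cinner x (A *v x)))"
  proof
    show "\<exists>K. \<forall>A :: complex ^ 'n ^ 'n. norm (Re (cinner x (A *v x))) \<le> norm A * K"
    proof (intro exI[of _ "norm x * norm x"] allI)
      fix A :: "complex ^ 'n ^ 'n"
      have "(cmod (cinner x (A *v x)))\<^sup>2 \<le> (norm x * norm (A *v x))\<^sup>2"
        using area_power2[of x "A *v x"] zero_le_power2[of "area x (A *v x)"]
        by (simp add: power_mult_distrib)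
      then have "cmod (cinner x (A *v x)) \<le> norm x * norm (A *v x)"
        by (rule power2_le_imp_le) simp
      also have "\<dots> \<le> norm x * (norm A * norm x)"
        by (intro mult_left_mono norm_matrix_vector_le) simp
      finally show "norm (Re (cinner x (A *v x))) \<le> norm A * (norm x * norm x)"
        using abs_Re_le_cmod[of "cinner x (A *v x)"] by (simp add: mult_ac)
    qed
    show "Re (cinner x ((r *\<^sub>R A) *v x)) = r *\<^sub>R Re (cinner x (A *v x))" for r and A :: "complex ^ 'n ^ 'n"
    proof -
      have "(r *\<^sub>R A) $ i $ j = complex_of_real r * A $ i $ j" for i j
        unfolding vector_scaleR_component by (rule scaleR_conv_of_real)
      then have "(r *\<^sub>R A) *v x = complex_of_real r *s (A *v x)"
        by (simp only: vec_eq_iff matrix_vector_mult_def vec_lambda_beta vector_smult_component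
            sum_distrib_left mult.assoc simp_thms)
      then show ?thesis by (simp add: cinner_smult_right)
    qed
  qed (simp add: matrix_vector_mult_add_rdistrib cinner_add_right)
  show ?thesis
    using integral_bounded_linear[OF bl integrable_adj]
    by (simp add: norm_matrix_vector_power2 integral_adj cinner_self)
qed

lemma integrable_norm_mult: "integrable \<mu> (\<lambda>v. norm (v *v x) * norm (v *v y))"
proof (rule integrable_cont)
  show "continuous_on UNIV (\<lambda>v :: complex ^ 'n ^ 'n. norm (v *v x) * norm (v *v y))"
    by (intro continuous_intros)
  show "norm (norm (v *v x) * norm (v *v y)) \<le> (norm x * norm y) * (norm v)\<^sup>2" for v :: "complex ^ 'n ^ 'n"
    using mult_mono[OF norm_matrix_vector_le[of v x] norm_matrix_vector_le[of v y]]
    by (simp add: power2_eq_square mult_ac)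
qed

lemma integral_norm_mult_le: "(\<integral>v. norm (v *v x) * norm (v *v y) \<partial>\<mu>) \<le> norm x * norm y"
proof (cases "x = 0 \<or> y = 0")
  case False
  \<comment> \<open>The weight that balances the arithmetic-geometric mean inequality: after
    integration both terms equal |x| |y| / 2.\<close>
  define t where "t = norm y / norm x"
  have t: "t > 0" using False by (simp add: t_def)
  have "norm (v *v x) * norm (v *v y) \<le> t / 2 * (norm (v *v x))\<^sup>2 + 1 / (2 * t) * (norm (v *v y))\<^sup>2" for v
  proof -
    have "0 \<le> (t * norm (v *v x) - norm (v *v y))\<^sup>2" by simp
    then show ?thesis using t by (simp add: field_simps power2_eq_square)
  qed
  then have "(\<integral>v. norm (v *v x) * norm (v *v y) \<partial>\<mu>)
      \<le> (\<integral>v. t / 2 * (norm (v *v x))\<^sup>2 + 1 / (2 * t) * (norm (v *v y))\<^sup>2 \<partial>\<mu>)"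
    by (intro integral_mono Bochner_Integration.integrable_add integrable_mult_right integrable_norm_apply
        integrable_norm_mult)
  also have "\<dots> = t / 2 * (norm x)\<^sup>2 + 1 / (2 * t) * (norm y)\<^sup>2"
    by (subst Bochner_Integration.integral_add)
      (simp_all add: integrable_norm_apply integral_norm_apply)
  also have "\<dots> = norm x * norm y"
    using False by (simp add: t_def field_simps power2_eq_square)
  finally show ?thesis .
qed auto

lemma AE_S: "AE v in \<mu>. v \<in> S"
  by (rule AE_in_support[OF sets_mu])

text \<open>The difference is nonnegative with integral 0, hence zero almost everywhere; the set of
  equality is closed by continuity, so it contains the whole support. Both equality cases of the
  proof, for areas and for the triangle inequality, go through this lemma.\<close>

lemma integral_eq_imp_eq_on_support:
  fixes \<phi> \<psi> :: "complex ^ 'n ^ 'n \<Rightarrow> real"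
  assumes cont: "continuous_on UNIV \<phi>" "continuous_on UNIV \<psi>"
    and int: "integrable \<mu> \<phi>" "integrable \<mu> \<psi>"
    and le: "\<And>v. \<phi> v \<le> \<psi> v" and eq: "(\<integral>v. \<phi> v \<partial>\<mu>) = (\<integral>v. \<psi> v \<partial>\<mu>)"
    and v: "v \<in> S"
  shows "\<phi> v = \<psi> v"
proof -
  have "(\<integral>v. \<psi> v - \<phi> v \<partial>\<mu>) = 0"
    using int eq by simp
  then have "AE v in \<mu>. \<psi> v - \<phi> v = 0"
    using int le by (subst (asm) integral_nonneg_eq_0_iff_AE) auto
  then have "AE v in \<mu>. v \<in> {v. \<phi> v = \<psi> v}"
    by eventually_elim simp
  moreover have "closed {v. \<phi> v = \<psi> v}"
    using cont by (intro closed_Collect_eq)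
  ultimately show ?thesis
    using closed_AE_imp_support[OF _ _ sets_mu v] by blast
qed

lemma markov_op_eq_lift: "T f p = (\<integral>v. lift f (v *v unit_rep p) \<partial>\<mu>)"
  unfolding markov_op_def by (intro Bochner_Integration.integral_cong) (auto simp: lift_def proj_act_def)

lemma lift_markov_op: "lift (T f) x = (\<integral>v. lift f (v *v x) \<partial>\<mu>)"
proof (cases "x = 0")
  case False
  obtain c where c: "cmod c = norm x" "x = c *s unit_rep (proj_class x)"
    using unit_rep_proj_class_nonzero[OF False] .
  have "(\<integral>v. lift f (v *v x) \<partial>\<mu>) = (\<integral>v. complex_of_real ((cmod c)\<^sup>2) * lift f (v *v unit_rep (proj_class x)) \<partial>\<mu>)"
    by (subst c(2)) (simp only: matrix_vector_smult lift_smult)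
  also have "\<dots> = complex_of_real ((cmod c)\<^sup>2) * T f (proj_class x)"
    by (simp add: markov_op_eq_lift)
  finally show ?thesis
    using False c(1) by (simp add: lift_def mult.commute)
qed simp

lemma integrable_lift:
  assumes "continuous_on UNIV f"
  shows "integrable \<mu> (\<lambda>v. lift f (v *v x))"
proof -
  obtain s where s: "\<And>p. cmod (f p) \<le> s"
    using bounded_cproj[OF assms] by blast
  have s0: "0 \<le> s" using s[of undefined] norm_ge_zero order_trans by blast
  show ?thesis
  proof (rule integrable_cont)
    show "continuous_on UNIV (\<lambda>v. lift f (v *v x))"
      by (intro continuous_on_compose2[OF continuous_on_lift[OF assms]] continuous_intros) auto
    show "cmod (lift f (v *v x)) \<le> (s * (norm x)\<^sup>2) * (norm v)\<^sup>2" for v :: "complex ^ 'n ^ 'n"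
    proof -
      have "cmod (lift f (v *v x)) \<le> s * (norm (v *v x))\<^sup>2"
        by (rule norm_lift_le[OF s])
      also have "\<dots> \<le> s * (norm v * norm x)\<^sup>2"
        using s0 by (intro mult_left_mono power_mono norm_matrix_vector_le) auto
      finally show ?thesis by (simp add: power_mult_distrib mult_ac)
    qed
  qed
qed

end

section \<open>Mean area distortion\<close>

text \<open>The properties of \<open>area\<close> that survive averaging over matrices and passing
  to limits. Alternating bilinearity is lost; subadditivity, invariance under shears and homogeneity
  in the moduli of the scalars remain.\<close>

definition area_form :: "(complex ^ 'n::finite \<Rightarrow> complex ^ 'n \<Rightarrow> real) \<Rightarrow> bool" where
  "area_form \<Omega> \<longleftrightarrow>
    (\<forall>x y. 0 \<le> \<Omega> x y \<and> \<Omega> x y \<le> norm x * norm y) \<and>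
    (\<forall>x x' y. \<Omega> (x + x') y \<le> \<Omega> x y + \<Omega> x' y) \<and>
    (\<forall>x y. \<Omega> x y = \<Omega> y x) \<and>
    (\<forall>x y b. \<Omega> x (b *s x + y) = \<Omega> x y) \<and>
    (\<forall>x y a b. \<Omega> (a *s x) (b *s y) = cmod a * cmod b * \<Omega> x y)"

lemma area_formD:
  assumes "area_form \<Omega>"
  shows "0 \<le> \<Omega> x y" "\<Omega> x y \<le> norm x * norm y" "\<Omega> (x + x') y \<le> \<Omega> x y + \<Omega> x' y"
    "\<Omega> x y = \<Omega> y x" "\<Omega> x (b *s x + y) = \<Omega> x y" "\<Omega> (a *s x) (b *s y) = cmod a * cmod b * \<Omega> x y"
  using assms unfolding area_form_def by blast+

lemma area_form_area: "area_form area"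
  using area_triangle_left area_commute
  by (auto simp: area_form_def area_le area_shear area_smult)

text \<open>Subadditivity together with the bound by |x| |y| already yields continuity, so averaged
  and limiting forms need no separate argument.\<close>

lemma area_form_Lipschitz:
  assumes "area_form \<Omega>"
  shows "\<bar>\<Omega> x y - \<Omega> x' y'\<bar> \<le> norm (x - x') * norm y + norm x' * norm (y - y')"
proof -
  note D = area_formD[OF assms]
  have left: "\<Omega> x y - \<Omega> x' y \<le> norm (x - x') * norm y" for x x' y
    using D(3)[of "x - x'" x' y] D(2)[of "x - x'" y] by simp
  have right: "\<Omega> x y - \<Omega> x y' \<le> norm x * norm (y - y')" for x y y'
    using left[of y x y'] unfolding D(4)[of y x] D(4)[of y' x] by (simp add: mult.commute)
  have "\<bar>\<Omega> x y - \<Omega> x' y\<bar> \<le> norm (x - x') * norm y"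
    using left[of x y x'] left[of x' y x] by (simp add: norm_minus_commute)
  moreover have "\<bar>\<Omega> x' y - \<Omega> x' y'\<bar> \<le> norm x' * norm (y - y')"
    using right[of x' y y'] right[of x' y' y] by (simp add: norm_minus_commute)
  ultimately show ?thesis by linarith
qed

lemma tendsto_area_form:
  assumes "area_form \<Omega>" "(f \<longlongrightarrow> x) F" "(g \<longlongrightarrow> y) F"
  shows "((\<lambda>z. \<Omega> (f z) (g z)) \<longlongrightarrow> \<Omega> x y) F"
proof (rule Lim_transform)
  show "((\<lambda>z. \<Omega> x y) \<longlongrightarrow> \<Omega> x y) F" by simp
  have "((\<lambda>z. norm (f z - x) * norm (g z) + norm x * norm (g z - y)) \<longlongrightarrow>
      norm (x - x) * norm y + norm x * norm (y - y)) F"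
    by (intro tendsto_intros assms)
  then have "((\<lambda>z. norm (f z - x) * norm (g z) + norm x * norm (g z - y)) \<longlongrightarrow> 0) F"
    by simp
  then show "((\<lambda>z. \<Omega> (f z) (g z) - \<Omega> x y) \<longlongrightarrow> 0) F"
    by (rule Lim_null_comparison[rotated])
      (simp add: area_form_Lipschitz[OF assms(1)])
qed

lemma continuous_on_area_form:
  assumes "area_form \<Omega>" "continuous_on A f" "continuous_on A g"
  shows "continuous_on A (\<lambda>z. \<Omega> (f z) (g z))"
  using assms(2,3) unfolding continuous_on_def by (blast intro: tendsto_area_form[OF assms(1)])

lemma area_form_le_area:
  assumes "area_form \<Omega>" "\<And>x y. norm x = 1 \<Longrightarrow> norm y = 1 \<Longrightarrow> cinner x y = 0 \<Longrightarrow> \<Omega> x y \<le> K"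
  shows "\<Omega> x y \<le> K * area x y"
  by (rule alternating_le_area[OF area_formD(5,6)[OF assms(1)] assms(2)])

context markov_measure
begin

lemma area_form_integrable:
  assumes "area_form \<Omega>"
  shows "continuous_on UNIV (\<lambda>v :: complex ^ 'n ^ 'n. \<Omega> (v *v x) (v *v y))"
    and "integrable \<mu> (\<lambda>v. \<Omega> (v *v x) (v *v y))"
proof -
  show cont: "continuous_on UNIV (\<lambda>v :: complex ^ 'n ^ 'n. \<Omega> (v *v x) (v *v y))"
    by (intro continuous_on_area_form assms continuous_intros)
  have "norm (\<Omega> (v *v x) (v *v y)) \<le> norm x * norm y * (norm v)\<^sup>2" for v
  proof -
    have "norm (\<Omega> (v *v x) (v *v y)) \<le> norm (v *v x) * norm (v *v y)"
      using area_formD(1,2)[OF assms] by simp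
    also have "\<dots> \<le> (norm v * norm x) * (norm v * norm y)"
      by (intro mult_mono norm_matrix_vector_le) auto
    finally show ?thesis by (simp add: power2_eq_square mult_ac)
  qed
  then show "integrable \<mu> (\<lambda>v. \<Omega> (v *v x) (v *v y))"
    by (rule integrable_cont[OF cont])
qed

definition mean_form :: "(complex ^ 'n \<Rightarrow> complex ^ 'n \<Rightarrow> real) \<Rightarrow> complex ^ 'n \<Rightarrow> complex ^ 'n \<Rightarrow> real" where
  "mean_form \<Omega> x y = (\<integral>v. \<Omega> (v *v x) (v *v y) \<partial>\<mu>)"

lemma area_form_mean_form:
  assumes "area_form \<Omega>"
  shows "area_form (mean_form \<Omega>)"
proof -
  note D = area_formD[OF assms] and int = area_form_integrable(2)[OF assms]
  have 1: "0 \<le> mean_form \<Omega> x y" for x y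
    unfolding mean_form_def by (intro integral_nonneg_AE always_eventually allI D(1))
  have 2: "mean_form \<Omega> x y \<le> norm x * norm y" for x y
  proof -
    have "mean_form \<Omega> x y \<le> (\<integral>v. norm (v *v x) * norm (v *v y) \<partial>\<mu>)"
      unfolding mean_form_def by (intro integral_mono int integrable_norm_mult D(2))
    then show ?thesis using integral_norm_mult_le[of x y] by simp
  qed
  have 3: "mean_form \<Omega> (x + x') y \<le> mean_form \<Omega> x y + mean_form \<Omega> x' y" for x x' y
  proof -
    have "mean_form \<Omega> (x + x') y \<le> (\<integral>v. \<Omega> (v *v x) (v *v y) + \<Omega> (v *v x') (v *v y) \<partial>\<mu>)"
      unfolding mean_form_def matrix_vector_right_distrib
      by (intro integral_mono Bochner_Integration.integrable_add int D(3))
        (simp add: int flip: matrix_vector_right_distrib)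
    then show ?thesis by (simp add: mean_form_def int)
  qed
  have 4: "mean_form \<Omega> x y = mean_form \<Omega> y x" for x y
    unfolding mean_form_def by (subst D(4)) (rule refl)
  have 5: "mean_form \<Omega> x (b *s x + y) = mean_form \<Omega> x y" for x y b
    unfolding mean_form_def by (simp add: matrix_vector_right_distrib matrix_vector_smult D(5))
  have 6: "mean_form \<Omega> (a *s x) (b *s y) = cmod a * cmod b * mean_form \<Omega> x y" for x y a b
    unfolding mean_form_def by (simp add: matrix_vector_smult D(6))
  show ?thesis
    unfolding area_form_def using 1 2 3 4 5 6 by blast
qed

primrec mean_area :: "nat \<Rightarrow> complex ^ 'n \<Rightarrow> complex ^ 'n \<Rightarrow> real" where
  "mean_area 0 = area"
| "mean_area (Suc n) = mean_form (mean_area n)"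

lemma area_form_mean_area: "area_form (mean_area n)"
  by (induction n) (auto simp: area_form_area area_form_mean_form)

text \<open>On an orthonormal pair the mean area is at most |x| |y| = 1, which is the area itself;
  shears and scaling extend this to all pairs. Averaging is monotone, which gives the induction
  step.\<close>

lemma mean_area_le_area: "mean_area (Suc n) x y \<le> mean_area n x y"
proof (induction n arbitrary: x y)
  case 0
  have "mean_form area x y \<le> 1 * area x y"
  proof (rule area_form_le_area[OF area_form_mean_form[OF area_form_area]])
    fix x y :: "complex ^ 'n"
    assume "norm x = 1" "norm y = 1"
    then show "mean_form area x y \<le> 1"
      using area_formD(2)[OF area_form_mean_form[OF area_form_area], of x y] by simp
  qed
  then show ?case by simp
next
  case (Suc n)
  have "(\<integral>v. mean_form (mean_area n) (v *v x) (v *v y) \<partial>\<mu>) \<le> (\<integral>v. mean_area n (v *v x) (v *v y) \<partial>\<mu>)"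
    by (intro integral_mono area_form_integrable area_form_mean_form area_form_mean_area)
      (use Suc in simp)
  then show ?case
    unfolding mean_area.simps mean_form_def[of _ x y] .
qed

lemma mean_area_antimono: "m \<le> n \<Longrightarrow> mean_area n x y \<le> mean_area m x y"
  using lift_Suc_antimono_le[of "\<lambda>n. mean_area n x y"] mean_area_le_area by blast

section \<open>The decreasing limit of the mean areas\<close>

definition limit_area :: "complex ^ 'n \<Rightarrow> complex ^ 'n \<Rightarrow> real" where
  "limit_area x y = lim (\<lambda>n. mean_area n x y)"

lemma mean_area_tendsto: "(\<lambda>n. mean_area n x y) \<longlonglongrightarrow> limit_area x y"
proof -
  have "convergent (\<lambda>n. mean_area n x y)"
  proof -
    have "decseq (\<lambda>n. mean_area n x y)"
      using mean_area_antimono by (auto simp: decseq_def)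
    moreover have "0 \<le> mean_area i x y" for i by (rule area_formD(1)[OF area_form_mean_area])
    ultimately show ?thesis
      using decseq_convergent[of "\<lambda>n. mean_area n x y" 0] by (metis convergentI)
  qed
  then show ?thesis by (simp add: limit_area_def convergent_LIMSEQ_iff)
qed

lemma area_form_limit_area: "area_form limit_area"
proof -
  note D = area_formD[OF area_form_mean_area] and L = mean_area_tendsto
  have 1: "0 \<le> limit_area x y" for x y
    by (rule LIMSEQ_le_const[OF L]) (use D(1) in blast)
  have 2: "limit_area x y \<le> norm x * norm y" for x y
    by (rule LIMSEQ_le_const2[OF L]) (use D(2) in blast)
  have 3: "limit_area (x + x') y \<le> limit_area x y + limit_area x' y" for x x' y
    by (rule LIMSEQ_le[OF L tendsto_add[OF L L]]) (use D(3) in blast)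
  have 4: "limit_area x y = limit_area y x" for x y
    unfolding limit_area_def by (subst D(4)) (rule refl)
  have 5: "limit_area x (b *s x + y) = limit_area x y" for x y b
    unfolding limit_area_def D(5) by (rule refl)
  have 6: "limit_area (a *s x) (b *s y) = cmod a * cmod b * limit_area x y" for x y a b
    by (rule LIMSEQ_unique[OF L]) (unfold D(6), intro tendsto_intros L)
  show ?thesis
    unfolding area_form_def using 1 2 3 4 5 6 by blast
qed

text \<open>Dominated convergence with the majorant |v x| |v y|, compared with the shifted sequence,
  which has the same limit.\<close>

lemma mean_form_limit_area: "mean_form limit_area x y = limit_area x y"
proof (rule LIMSEQ_unique)
  show "(\<lambda>n. mean_area (Suc n) x y) \<longlonglongrightarrow> limit_area x y"
    by (rule LIMSEQ_Suc[OF mean_area_tendsto])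
  have "(\<lambda>n. \<integral>v. mean_area n (v *v x) (v *v y) \<partial>\<mu>) \<longlonglongrightarrow> (\<integral>v. limit_area (v *v x) (v *v y) \<partial>\<mu>)"
  proof (rule integral_dominated_convergence)
    show "integrable \<mu> (\<lambda>v. norm (v *v x) * norm (v *v y))"
      by (rule integrable_norm_mult)
    show "AE v in \<mu>. (\<lambda>n. mean_area n (v *v x) (v *v y)) \<longlonglongrightarrow> limit_area (v *v x) (v *v y)"
      by (intro always_eventually allI mean_area_tendsto)
    show "AE v in \<mu>. norm (mean_area n (v *v x) (v *v y)) \<le> norm (v *v x) * norm (v *v y)" for n
      using area_formD(1,2)[OF area_form_mean_area] by (intro always_eventually allI) simp
  qed (auto intro!: borel_measurable_integrable area_form_integrable area_form_limit_area area_form_mean_area)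
  then show "(\<lambda>n. mean_area (Suc n) x y) \<longlonglongrightarrow> mean_form limit_area x y"
    by (simp add: mean_form_def)
qed

text \<open>The pair (0, 0) is included: it corresponds to words that kill the plane, for which the
  constant 0 is allowed in (Pur).\<close>

definition conformal_pair :: "complex ^ 'n \<Rightarrow> complex ^ 'n \<Rightarrow> bool" where
  "conformal_pair x y \<longleftrightarrow> norm x = norm y \<and> cinner x y = 0"

text \<open>If the maximal value \<open>c\<close> of \<^const>\<open>limit_area\<close> on unit pairs is positive, all the inequalities
  \<open>limit_area \<le> c area \<le> c |x| |y| \<le> c (|x|\<^sup>2 + |y|\<^sup>2) / 2\<close> are equalities along the orbit of a maximiser.\<close>

lemma conformal_pair_step:
  assumes bound: "\<And>x y. limit_area x y \<le> c * area x y" and c: "c > 0"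
    and xy: "conformal_pair x y" "limit_area x y = c * (norm x)\<^sup>2" and v: "v \<in> S"
  shows "conformal_pair (v *v x) (v *v y)" "limit_area (v *v x) (v *v y) = c * (norm (v *v x))\<^sup>2"
proof -
  let ?\<psi> = "\<lambda>v :: complex ^ 'n ^ 'n. c * (((norm (v *v x))\<^sup>2 + (norm (v *v y))\<^sup>2) / 2)"
  have amgm: "norm (v *v x) * norm (v *v y) = ((norm (v *v x))\<^sup>2 + (norm (v *v y))\<^sup>2) / 2
      - (norm (v *v x) - norm (v *v y))\<^sup>2 / 2" for v
    by (simp add: power2_eq_square field_simps)
  have chain: "limit_area (v *v x) (v *v y) \<le> c * area (v *v x) (v *v y)"
      "c * area (v *v x) (v *v y) \<le> c * (norm (v *v x) * norm (v *v y))"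
      "c * (norm (v *v x) * norm (v *v y)) \<le> ?\<psi> v" for v
  proof -
    show "limit_area (v *v x) (v *v y) \<le> c * area (v *v x) (v *v y)" by (rule bound)
    show "c * area (v *v x) (v *v y) \<le> c * (norm (v *v x) * norm (v *v y))"
      using c by (intro mult_left_mono area_le) simp
    have "norm (v *v x) * norm (v *v y) \<le> ((norm (v *v x))\<^sup>2 + (norm (v *v y))\<^sup>2) / 2"
      using amgm[of v] zero_le_power2[of "norm (v *v x) - norm (v *v y)"] by linarith
    then show "c * (norm (v *v x) * norm (v *v y)) \<le> ?\<psi> v"
      using c by (intro mult_left_mono) simp_all
  qed
  have "limit_area (v *v x) (v *v y) = ?\<psi> v"
  proof (rule integral_eq_imp_eq_on_support[OF _ _ _ _ _ _ v])
    show "limit_area (v *v x) (v *v y) \<le> ?\<psi> v" for v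
      using chain[of v] by linarith
    show "continuous_on UNIV ?\<psi>"
      by (intro continuous_intros) auto
    show "integrable \<mu> ?\<psi>"
      by (intro integrable_mult_right integrable_divide Bochner_Integration.integrable_add integrable_norm_apply)
    \<comment> \<open>Both ends of the chain have mean c |x|^2, the left one by invariance of
      \<open>limit_area\<close>, the right one because |x| = |y|; so the chain collapses on the
      support.\<close>
    have "(\<integral>v. limit_area (v *v x) (v *v y) \<partial>\<mu>) = c * (norm x)\<^sup>2"
      using mean_form_limit_area[of x y] xy(2) by (simp add: mean_form_def)
    also have "\<dots> = (\<integral>v. ?\<psi> v \<partial>\<mu>)"
      using xy(1) by (simp add: integrable_norm_apply integral_norm_apply conformal_pair_def)
    finally show "(\<integral>v. limit_area (v *v x) (v *v y) \<partial>\<mu>) = (\<integral>v. ?\<psi> v \<partial>\<mu>)" .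
  qed (intro area_form_integrable area_form_limit_area)+
  with chain[of v] have eq: "c * area (v *v x) (v *v y) = c * (norm (v *v x) * norm (v *v y))"
      "c * (norm (v *v x) * norm (v *v y)) = ?\<psi> v" "limit_area (v *v x) (v *v y) = ?\<psi> v"
    by linarith+
  have n: "norm (v *v x) = norm (v *v y)"
  proof -
    have "norm (v *v x) * norm (v *v y) = ((norm (v *v x))\<^sup>2 + (norm (v *v y))\<^sup>2) / 2"
      using eq(2) c by (subst (asm) mult_cancel_left) auto
    then have "(norm (v *v x) - norm (v *v y))\<^sup>2 = 0"
      using amgm[of v] by linarith
    then show ?thesis by simp
  qed
  have "(area (v *v x) (v *v y))\<^sup>2 = (norm (v *v x) * norm (v *v y))\<^sup>2"
    using eq(1) c by simp
  then have "cinner (v *v x) (v *v y) = 0"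
    by (simp add: area_power2 power_mult_distrib)
  with n show "conformal_pair (v *v x) (v *v y)" by (simp add: conformal_pair_def)
  show "limit_area (v *v x) (v *v y) = c * (norm (v *v x))\<^sup>2"
    using eq(3) n by simp
qed

end

section \<open>Orthogonal projectors onto planes\<close>

lemma rank_one_mult: "rank_one a *v z = cinner a z *s a"
  by (simp add: vec_eq_iff rank_one_def matrix_vector_mult_def cinner_def sum_distrib_left mult_ac)

lemma orthogonal_projector_rank_one_add:
  assumes "norm x = 1" "norm y = 1" "cinner x y = 0"
  shows "orthogonal_projector (rank_one x + rank_one y)"
    and "rank (rank_one x + rank_one y) \<noteq> 1"
    and "rank_one x + rank_one y \<noteq> 0"
proof -
  let ?P = "rank_one x + rank_one y"
  have P: "?P *v z = cinner x z *s x + cinner y z *s y" for z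
    by (simp add: matrix_vector_mult_add_rdistrib rank_one_mult)
  have yx: "cinner y x = 0" using assms(3) cinner_commute[of y x] by simp
  have "?P ** ?P = ?P"
    unfolding matrix_eq
    by (simp add: P cinner_add_right cinner_smult_right cinner_self assms yx
      flip: matrix_vector_mul_assoc)
  moreover have "adj ?P = ?P"
    by (simp add: vec_eq_iff adj_def rank_one_def mult.commute)
  ultimately show "orthogonal_projector ?P"
    by (simp add: orthogonal_projector_def)
  have x: "?P *v x = x" and y: "?P *v y = y"
    by (simp_all add: P cinner_self assms yx)
  have nz: "x \<noteq> 0" "y \<noteq> 0" using assms by auto
  show "?P \<noteq> 0" using x nz by auto
  \<comment> \<open>The rank is computed from the rows, and the rows of this Hermitian matrix
    combine to the conjugates of the vectors it fixes. Two independent vectors in the row space rule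
    out rank one.\<close>
  define bar :: "complex ^ 'a \<Rightarrow> complex ^ 'a" where "bar z = (\<chi> i. cnj (z $ i))" for z
  have row: "bar z \<in> vec.span (rows ?P)" if "?P *v z = z" for z
  proof -
    have "(\<Sum>i\<in>UNIV. cnj (z $ i) *s row i ?P) = bar (?P *v z)"
      by (simp add: vec_eq_iff bar_def row_def matrix_vector_mult_def rank_one_def mult_ac)
    moreover have "(\<Sum>i\<in>UNIV. cnj (z $ i) *s row i ?P) \<in> vec.span (rows ?P)"
      by (intro vec.span_sum vec.span_scale vec.span_base) (auto simp: rows_def)
    ultimately show ?thesis using that by simp
  qed
  have nb: "bar x \<noteq> 0" using nz by (auto simp: vec_eq_iff bar_def)
  have "bar y \<notin> vec.span {bar x}"
  proof
    assume "bar y \<in> vec.span {bar x}"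
    then obtain k where "bar y = k *s bar x" by (auto simp: vec.span_singleton)
    then have "cnj (y $ i) = k * cnj (x $ i)" for i
      by (simp add: bar_def vec_eq_iff)
    then have "y $ i = cnj k * x $ i" for i
      by (metis complex_cnj_cnj complex_cnj_mult)
    then have "y = cnj k *s x"
      by (simp add: vec_eq_iff)
    moreover from this have "cinner x y = cnj k" by (simp add: cinner_smult_right cinner_self assms)
    ultimately show False using nz assms by simp
  qed
  then have ne: "bar x \<noteq> bar y" and "\<not> vec.dependent {bar x, bar y}"
    using nb by (auto simp: vec.independent_insert insert_commute[of "bar x" "bar y"] vec.span_base)
  then have "card {bar x, bar y} \<le> vec.dim (vec.span (rows ?P))"
    using row x y by (intro vec.independent_card_le_dim) auto
  then show "rank ?P \<noteq> 1"
    using ne by (simp add: row_rank_def_gen)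
qed

text \<open>In the orthonormal basis x, y of the plane, the Gram matrix of the images under
  \<open>W\<close> is the scalar |W x|^2.\<close>

lemma conformal_imp_proportional:
  assumes "norm x = 1" "norm y = 1" "cinner x y = 0"
    and W: "norm (W *v x) = norm (W *v y)" "cinner (W *v x) (W *v y) = 0"
  shows "(rank_one x + rank_one y) ** adj W ** W ** (rank_one x + rank_one y)
    = mat (complex_of_real ((norm (W *v x))\<^sup>2)) ** (rank_one x + rank_one y)"
proof -
  let ?P = "rank_one x + rank_one y"
  have P: "?P *v z = cinner x z *s x + cinner y z *s y" for z
    by (simp add: matrix_vector_mult_add_rdistrib rank_one_mult)
  have W': "cinner (W *v y) (W *v x) = 0" using W(2) cinner_commute[of "W *v y"] by simp
  have mat: "mat c *v z = c *s z" for c and z :: "complex ^ 'a"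
    by (simp add: vec_eq_iff mat_def matrix_vector_mult_def if_distrib[of "\<lambda>c. c * _"] cong: if_cong)
  show ?thesis
    unfolding matrix_eq
    by (simp add: P mat cinner_adj cinner_add_right cinner_smult_right W' W cinner_self
        matrix_vector_right_distrib matrix_vector_smult vector_smult_assoc vec.scale_right_distrib mult.commute
      flip: matrix_vector_mul_assoc)
qed

context markov_measure
begin

text \<open>For almost every word all letters lie in the support, so the projector onto the plane of
  x and y satisfies the premise of (Pur) for every length, although its rank is not one.\<close>

lemma Pur_no_conformal_pair:
  assumes "Pur \<mu>" "norm x = 1" "norm y = 1" "cinner x y = 0"
    and step: "\<And>n v. (\<And>i. i \<in> {1..n} \<Longrightarrow> v i \<in> S) \<Longrightarrow> conformal_pair (word_prod v n *v x) (word_prod v n *v y)"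
  shows False
proof -
  let ?P = "rank_one x + rank_one y"
  have "AE v in PiM {1..n} (\<lambda>_. \<mu>). \<exists>c. ?P ** adj (word_prod v n) ** word_prod v n ** ?P = mat c ** ?P" for n
  proof -
    have "AE v in PiM {1..n} (\<lambda>_. \<mu>). \<forall>i\<in>{1..n}. v i \<in> S"
      by (intro AE_ball_countable[THEN iffD2] ballI AE_PiM_coordinate AE_S) auto
    then show ?thesis
    proof eventually_elim
      case (elim v)
      then have "conformal_pair (word_prod v n *v x) (word_prod v n *v y)"
        by (intro step) auto
      then show ?case
        using conformal_imp_proportional[OF assms(2-4)] unfolding conformal_pair_def by blast
    qed
  qed
  then have "rank ?P = 1"
    using assms(1) orthogonal_projector_rank_one_add[OF assms(2-4)] unfolding Pur_def by blast
  then show False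
    using orthogonal_projector_rank_one_add[OF assms(2-4)] by blast
qed

section \<open>Vanishing of the limit area and uniform decay\<close>

lemma compact_unit_pairs: "compact (sphere 0 1 \<times> sphere 0 1 :: ((complex ^ 'n) \<times> (complex ^ 'n)) set)"
  by (intro compact_Times) auto

lemma limit_area_eq_0:
  assumes "Pur \<mu>"
  shows "limit_area x y = 0"
proof -
  let ?K = "sphere 0 1 \<times> sphere 0 1 :: ((complex ^ 'n) \<times> (complex ^ 'n)) set"
  have "continuous_on ?K (\<lambda>(x, y). limit_area x y)"
    unfolding case_prod_beta by (intro continuous_on_area_form area_form_limit_area continuous_intros)
  moreover have "?K \<noteq> {}"
    using norm_unit_rep[of undefined] by (auto simp del: norm_unit_rep intro!: exI)
  ultimately obtain z where z: "z \<in> ?K" "\<And>w. w \<in> ?K \<Longrightarrow> (\<lambda>(x, y). limit_area x y) w \<le> (\<lambda>(x, y). limit_area x y) z"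
    using continuous_attains_sup[OF compact_unit_pairs] by blast
  obtain x0 y0 where xy0: "z = (x0, y0)" by (cases z)
  define c where "c = limit_area x0 y0"
  have u: "norm x0 = 1" "norm y0 = 1" using z(1) xy0 by auto
  have bound: "limit_area x y \<le> c * area x y" for x y
    by (rule area_form_le_area[OF area_form_limit_area]) (use z xy0 c_def in auto)
  have "0 \<le> c" unfolding c_def by (rule area_formD[OF area_form_limit_area])
  moreover have "\<not> c > 0"
  proof
    assume c: "c > 0"
    \<comment> \<open>The bound applied to the maximiser itself forces its area to be at least 1,
      and unit vectors span such an area only if they are orthogonal.\<close>
    have "c \<le> c * area x0 y0" using bound[of x0 y0] by (simp add: c_def)
    then have "1 \<le> area x0 y0" using c by simp
    then have "1 \<le> (area x0 y0)\<^sup>2" by simp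
    then have "cinner x0 y0 = 0" by (simp add: area_power2 u)
    then have 0: "conformal_pair x0 y0" "limit_area x0 y0 = c * (norm x0)\<^sup>2"
      by (simp_all add: conformal_pair_def u c_def)
    have "conformal_pair (word_prod v n *v x0) (word_prod v n *v y0) \<and>
        limit_area (word_prod v n *v x0) (word_prod v n *v y0) = c * (norm (word_prod v n *v x0))\<^sup>2"
      if "\<And>i. i \<in> {1..n} \<Longrightarrow> v i \<in> S" for v n
      using that
    proof (induction n)
      case (Suc n)
      then show ?case
        using conformal_pair_step[OF bound c, of "word_prod v n *v x0" "word_prod v n *v y0" "v (Suc n)"]
        by (simp flip: matrix_vector_mul_assoc)
    qed (use 0 in auto)
    then show False
      using Pur_no_conformal_pair[OF assms u \<open>cinner x0 y0 = 0\<close>] by blast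
  qed
  ultimately have "c = 0" by simp
  with bound[of x y] area_formD(1)[OF area_form_limit_area, of x y] show ?thesis by simp
qed

text \<open>Dini's argument: a decreasing sequence of continuous functions with limit 0 on the
  compact set of unit pairs converges uniformly. Homogeneity and shears then supply the factor
  \<open>area x y\<close> for arbitrary pairs.\<close>

lemma mean_area_uniform:
  assumes "Pur \<mu>" "e > 0"
  shows "\<exists>N. \<forall>n\<ge>N. \<forall>x y. mean_area n x y \<le> e * area x y"
proof -
  let ?K = "sphere 0 1 \<times> sphere 0 1 :: ((complex ^ 'n) \<times> (complex ^ 'n)) set"
  have "\<exists>N. \<forall>z\<in>?K. mean_area N (fst z) (snd z) \<le> e"
  proof (rule ccontr)
    assume "\<not> ?thesis"
    then have "\<forall>n. \<exists>z. z \<in> ?K \<and> e < mean_area n (fst z) (snd z)"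
      unfolding not_ex by (metis linorder_not_le)
    then obtain z where z: "\<And>n. z n \<in> ?K" "\<And>n. e < mean_area n (fst (z n)) (snd (z n))"
      by metis
    obtain l r where l: "l \<in> ?K" "strict_mono (r :: nat \<Rightarrow> nat)" "(z \<circ> r) \<longlonglongrightarrow> l"
      using compact_unit_pairs z(1) unfolding compact_def by metis
    have "e \<le> mean_area m (fst l) (snd l)" for m
    proof (rule LIMSEQ_le_const)
      show "(\<lambda>i. mean_area m (fst ((z \<circ> r) i)) (snd ((z \<circ> r) i))) \<longlonglongrightarrow> mean_area m (fst l) (snd l)"
        by (intro tendsto_area_form[OF area_form_mean_area] tendsto_intros l)
      show "\<exists>N. \<forall>n\<ge>N. e \<le> mean_area m (fst ((z \<circ> r) n)) (snd ((z \<circ> r) n))"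
      proof (intro exI[of _ m] allI impI)
        fix n assume "m \<le> n"
        then have "m \<le> r n" using seq_suble[OF l(2), of n] by simp
        from mean_area_antimono[OF this, of "fst (z (r n))" "snd (z (r n))"] z(2)[of "r n"]
        show "e \<le> mean_area m (fst ((z \<circ> r) n)) (snd ((z \<circ> r) n))" by simp
      qed
    qed
    then have "e \<le> limit_area (fst l) (snd l)"
      by (intro LIMSEQ_le_const[OF mean_area_tendsto]) blast
    then show False using limit_area_eq_0[OF assms(1)] assms(2) by simp
  qed
  then obtain N where N: "\<And>x y. norm x = 1 \<Longrightarrow> norm y = 1 \<Longrightarrow> mean_area N x y \<le> e" by fastforce
  have "mean_area n x y \<le> e * area x y" if "n \<ge> N" for n x y
  proof -
    have "mean_area N x y \<le> e * area x y"
      by (rule area_form_le_area[OF area_form_mean_area]) (rule N)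
    with mean_area_antimono[OF that, of x y] show ?thesis by linarith
  qed
  then show ?thesis by blast
qed

end

section \<open>Hoelder functions\<close>

text \<open>An explicit admissible constant instead of the supremum passes easily through sums and
  limits. The condition \<open>0 \<le> m\<close> is not automatic when the projective space is a
  single point.\<close>

definition holder_const :: "real \<Rightarrow> real \<Rightarrow> ('n::finite cproj \<Rightarrow> complex) \<Rightarrow> bool" where
  "holder_const \<alpha> m f \<longleftrightarrow> 0 \<le> m \<and> (\<forall>p q. cmod (f p - f q) \<le> m * dist p q powr \<alpha>)"

lemma holder_constD: "holder_const \<alpha> m f \<Longrightarrow> cmod (f p - f q) \<le> m * dist p q powr \<alpha>"
  and holder_const_nonneg: "holder_const \<alpha> m f \<Longrightarrow> 0 \<le> m"
  by (auto simp: holder_const_def)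

lemma mem_holder_iff: "f \<in> holder \<alpha> \<longleftrightarrow> (\<exists>m. holder_const \<alpha> m f)"
proof
  assume "f \<in> holder \<alpha>"
  then obtain C where C: "\<And>p q. cmod (f p - f q) \<le> C * dist p q powr \<alpha>"
    by (auto simp: holder_def)
  have "holder_const \<alpha> \<bar>C\<bar> f"
    unfolding holder_const_def
    by (auto intro!: order_trans[OF C] mult_right_mono)
  then show "\<exists>m. holder_const \<alpha> m f" ..
qed (auto simp: holder_def holder_const_def)

lemma holder_const_mono:
  assumes "holder_const \<alpha> m f" "m \<le> m'"
  shows "holder_const \<alpha> m' f"
  unfolding holder_const_def
proof (intro conjI allI)
  show "0 \<le> m'" using assms by (auto simp: holder_const_def)
  fix p q :: "'a cproj"
  have "m * dist p q powr \<alpha> \<le> m' * dist p q powr \<alpha>"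
    using assms(2) by (intro mult_right_mono) auto
  then show "cmod (f p - f q) \<le> m' * dist p q powr \<alpha>"
    using holder_constD[OF assms(1), of p q] by linarith
qed

lemma dist_le_powr: "0 < \<alpha> \<Longrightarrow> \<alpha> \<le> 1 \<Longrightarrow> dist p q \<le> dist p q powr \<alpha>"
  for p q :: "'n::finite cproj"
  using powr_mono'[of \<alpha> 1 "dist p q"] dist_cproj_le_1[of p q] by (cases "p = q") auto

lemma holder_const_1_imp:
  assumes "holder_const 1 m f" "0 < \<alpha>" "\<alpha> \<le> 1"
  shows "holder_const \<alpha> m f"
  unfolding holder_const_def
proof (intro conjI allI)
  show m: "0 \<le> m" using holder_const_nonneg[OF assms(1)] .
  fix p q :: "'a cproj"
  have "cmod (f p - f q) \<le> m * dist p q"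
    using holder_constD[OF assms(1), of p q] by simp
  also have "\<dots> \<le> m * dist p q powr \<alpha>"
    using m dist_le_powr[OF assms(2,3)] by (rule mult_left_mono[rotated])
  finally show "cmod (f p - f q) \<le> m * dist p q powr \<alpha>" .
qed

lemma holder_const_continuous:
  assumes "holder_const \<alpha> m f" "0 < \<alpha>"
  shows "continuous_on UNIV f"
  unfolding continuous_on_def
proof
  fix p :: "'a cproj"
  have "((\<lambda>q. m * dist q p powr \<alpha>) \<longlongrightarrow> m * dist p p powr \<alpha>) (at p within UNIV)"
    using assms(2) by (intro tendsto_intros) auto
  then have "((\<lambda>q. m * dist q p powr \<alpha>) \<longlongrightarrow> 0) (at p within UNIV)"
    using assms(2) by simp
  then have "((\<lambda>q. f q - f p) \<longlongrightarrow> 0) (at p within UNIV)"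
    by (rule Lim_null_comparison[rotated]) (intro always_eventually allI holder_constD assms)
  then show "(f \<longlongrightarrow> f p) (at p within UNIV)"
    by (simp add: Lim_null[symmetric])
qed

lemma holder_const_add:
  assumes "holder_const \<alpha> m f" "holder_const \<alpha> m' g"
  shows "holder_const \<alpha> (m + m') (\<lambda>p. f p + g p)"
  unfolding holder_const_def
proof (intro conjI allI)
  show "0 \<le> m + m'" using assms by (simp add: holder_const_def)
  fix p q
  have "cmod (f p + g p - (f q + g q)) \<le> cmod (f p - f q) + cmod (g p - g q)"
    by norm
  then show "cmod (f p + g p - (f q + g q)) \<le> (m + m') * dist p q powr \<alpha>"
    using holder_constD[OF assms(1), of p q] holder_constD[OF assms(2), of p q]
    by (simp add: algebra_simps)
qed

lemma holder_const_cmult: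
  assumes "holder_const \<alpha> m f"
  shows "holder_const \<alpha> (cmod c * m) (\<lambda>p. c * f p)"
  unfolding holder_const_def
proof (intro conjI allI)
  show "0 \<le> cmod c * m" using assms by (simp add: holder_const_def)
  fix p q
  have "cmod (c * f p - c * f q) = cmod c * cmod (f p - f q)"
    by (simp add: norm_mult flip: right_diff_distrib)
  also have "\<dots> \<le> cmod c * (m * dist p q powr \<alpha>)"
    by (intro mult_left_mono holder_constD[OF assms]) auto
  finally show "cmod (c * f p - c * f q) \<le> cmod c * m * dist p q powr \<alpha>" by simp
qed

lemma holder_const_mult:
  assumes "holder_const \<alpha> m f" "holder_const \<alpha> m' g" "\<And>p. cmod (f p) \<le> s" "\<And>p. cmod (g p) \<le> s'"
  shows "holder_const \<alpha> (s * m' + m * s') (\<lambda>p. f p * g p)"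
  unfolding holder_const_def
proof (intro conjI allI)
  have s: "0 \<le> s" "0 \<le> s'"
    using assms(3)[of undefined] assms(4)[of undefined] norm_ge_zero order_trans by blast+
  show "0 \<le> s * m' + m * s'" using assms(1,2) s by (simp add: holder_const_def)
  fix p q
  have "f p * g p - f q * g q = f p * (g p - g q) + (f p - f q) * g q"
    by (simp add: algebra_simps)
  then have "cmod (f p * g p - f q * g q) \<le> cmod (f p) * cmod (g p - g q) + cmod (f p - f q) * cmod (g q)"
    by (metis norm_mult norm_triangle_ineq)
  also have "\<dots> \<le> s * (m' * dist p q powr \<alpha>) + (m * dist p q powr \<alpha>) * s'"
    using s assms(1) by (intro add_mono mult_mono assms holder_constD) (auto simp: holder_const_def)
  finally show "cmod (f p * g p - f q * g q) \<le> (s * m' + m * s') * dist p q powr \<alpha>"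
    by (simp add: algebra_simps)
qed

lemma holder_add: "f \<in> holder \<alpha> \<Longrightarrow> g \<in> holder \<alpha> \<Longrightarrow> (\<lambda>p. f p + g p) \<in> holder \<alpha>"
  unfolding mem_holder_iff using holder_const_add by blast

lemma holder_cmult: "f \<in> holder \<alpha> \<Longrightarrow> (\<lambda>p. c * f p) \<in> holder \<alpha>"
  unfolding mem_holder_iff using holder_const_cmult by blast

lemma holder_diff: "f \<in> holder \<alpha> \<Longrightarrow> g \<in> holder \<alpha> \<Longrightarrow> (\<lambda>p. f p - g p) \<in> holder \<alpha>"
  using holder_add[of f \<alpha> "\<lambda>p. - 1 * g p"] holder_cmult[of g \<alpha> "- 1"] by simp

lemma holder_zero: "(\<lambda>p. 0) \<in> holder \<alpha>"
  by (auto simp: holder_def intro: exI[of _ 0])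

lemma holder_continuous: "f \<in> holder \<alpha> \<Longrightarrow> 0 < \<alpha> \<Longrightarrow> continuous_on UNIV f"
  unfolding mem_holder_iff using holder_const_continuous by blast

lemma holder_1_subset: "0 < \<alpha> \<Longrightarrow> \<alpha> \<le> 1 \<Longrightarrow> holder 1 \<subseteq> holder \<alpha>"
  unfolding subset_iff mem_holder_iff using holder_const_1_imp by blast

lemma holder_norm_le:
  assumes "holder_const \<alpha> m f" "\<And>p. cmod (f p) \<le> s"
  shows "holder_norm \<alpha> f \<le> s + m"
proof -
  have "(SUP p. cmod (f p)) \<le> s"
    by (rule cSUP_least) (auto intro: assms)
  moreover have "holder_seminorm \<alpha> f \<le> m"
    unfolding holder_seminorm_def
  proof (rule cSup_least)
    fix x assume "x \<in> insert 0 {cmod (f x - f y) / dist x y powr \<alpha> |x y. x \<noteq> y}"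
    then consider "x = 0" | p q where "x = cmod (f p - f q) / dist p q powr \<alpha>" "p \<noteq> q"
      by auto
    then show "x \<le> m"
    proof cases
      case 2
      then show ?thesis
        using holder_constD[OF assms(1), of p q] by (simp add: divide_le_eq)
    qed (use holder_const_nonneg[OF assms(1)] in auto)
  qed auto
  ultimately show ?thesis by (simp add: holder_norm_def)
qed

lemma holder_normE:
  assumes "f \<in> holder \<alpha>" "0 < \<alpha>"
  obtains s m where "holder_norm \<alpha> f = s + m" "holder_const \<alpha> m f" "\<And>p. cmod (f p) \<le> s"
    "0 \<le> s" "0 \<le> m"
proof -
  obtain C where C: "holder_const \<alpha> C f" using assms(1) mem_holder_iff by blast
  obtain b where b: "\<And>p. cmod (f p) \<le> b"
    using bounded_cproj[OF holder_continuous[OF assms]] by blast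
  let ?s = "SUP p. cmod (f p)" and ?m = "holder_seminorm \<alpha> f"
  let ?R = "{cmod (f x - f y) / dist x y powr \<alpha> |x y. x \<noteq> y}"
  have bdd: "bdd_above (insert 0 ?R)"
  proof (rule bdd_aboveI)
    fix x assume "x \<in> insert 0 ?R"
    then show "x \<le> C"
      using holder_constD[OF C] holder_const_nonneg[OF C] by (auto simp: divide_le_eq)
  qed
  have s: "cmod (f p) \<le> ?s" for p
    by (rule cSUP_upper) (auto intro: b bdd_aboveI2)
  have m0: "0 \<le> ?m"
    unfolding holder_seminorm_def by (rule cSup_upper[OF _ bdd]) simp
  have "holder_const \<alpha> ?m f"
    unfolding holder_const_def
  proof (intro conjI allI m0)
    fix p q
    show "cmod (f p - f q) \<le> ?m * dist p q powr \<alpha>"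
    proof (cases "p = q")
      case False
      have "cmod (f p - f q) / dist p q powr \<alpha> \<le> ?m"
        unfolding holder_seminorm_def by (rule cSup_upper[OF _ bdd]) (use False in auto)
      then show ?thesis using False by (simp add: divide_le_eq)
    qed simp
  qed
  moreover have "0 \<le> ?s" using s[of undefined] norm_ge_zero order_trans by blast
  ultimately show ?thesis using that[of ?s ?m] s m0 by (simp add: holder_norm_def)
qed

lemma holder_norm_nonneg: "f \<in> holder \<alpha> \<Longrightarrow> 0 < \<alpha> \<Longrightarrow> 0 \<le> holder_norm \<alpha> f"
  by (metis add_nonneg_nonneg holder_normE)

lemma cmod_le_holder_norm: "f \<in> holder \<alpha> \<Longrightarrow> 0 < \<alpha> \<Longrightarrow> cmod (f p) \<le> holder_norm \<alpha> f"
  by (rule holder_normE) (force intro: order_trans)+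

lemma holder_norm_add_le:
  assumes "f \<in> holder \<alpha>" "g \<in> holder \<alpha>" "0 < \<alpha>"
  shows "holder_norm \<alpha> (\<lambda>p. f p + g p) \<le> holder_norm \<alpha> f + holder_norm \<alpha> g"
proof -
  obtain s m where f: "holder_norm \<alpha> f = s + m" "holder_const \<alpha> m f" "\<And>p. cmod (f p) \<le> s"
    using holder_normE[OF assms(1,3)] by blast
  obtain s' m' where g: "holder_norm \<alpha> g = s' + m'" "holder_const \<alpha> m' g" "\<And>p. cmod (g p) \<le> s'"
    using holder_normE[OF assms(2,3)] by blast
  have "holder_norm \<alpha> (\<lambda>p. f p + g p) \<le> (s + s') + (m + m')"
    by (intro holder_norm_le holder_const_add f g order_trans[OF norm_triangle_ineq] add_mono)
  then show ?thesis by (simp add: f g)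
qed

lemma holder_norm_cmult_le:
  assumes "f \<in> holder \<alpha>" "0 < \<alpha>"
  shows "holder_norm \<alpha> (\<lambda>p. c * f p) \<le> cmod c * holder_norm \<alpha> f"
proof -
  obtain s m where f: "holder_norm \<alpha> f = s + m" "holder_const \<alpha> m f" "\<And>p. cmod (f p) \<le> s"
    using holder_normE[OF assms] by blast
  have "holder_norm \<alpha> (\<lambda>p. c * f p) \<le> cmod c * s + cmod c * m"
    by (intro holder_norm_le holder_const_cmult f) (simp add: norm_mult f mult_left_mono)
  then show ?thesis by (simp add: f algebra_simps)
qed

text \<open>Arzela-Ascoli is applied on the unit sphere to the functions pulled back by
  \<open>proj_class\<close>, where a common Hoelder constant gives equicontinuity. The limit is read
  off at unit representatives and inherits the bounds pointwise.\<close>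

lemma holder_compactness:
  fixes f :: "nat \<Rightarrow> 'n::finite cproj \<Rightarrow> complex"
  assumes "\<And>n. holder_const \<alpha> m (f n)" "\<And>n p. cmod (f n p) \<le> s" "0 < \<alpha>"
  obtains g r where "strict_mono (r :: nat \<Rightarrow> nat)" "uniform_limit UNIV (\<lambda>n. f (r n)) g sequentially"
    "holder_const \<alpha> m g" "\<And>p. cmod (g p) \<le> s"
proof -
  let ?F = "\<lambda>n x. f n (proj_class x)"
  have cont: "continuous_on (sphere 0 1) (proj_class :: complex ^ 'n \<Rightarrow> _)"
    by (rule continuous_on_subset[OF continuous_on_proj_class]) auto
  have "compact (sphere 0 1 :: (complex ^ 'n) set)" by simp
  then obtain g k where g: "strict_mono (k :: nat \<Rightarrow> nat)"
      "\<And>e. 0 < e \<Longrightarrow> \<exists>N. \<forall>n x. N \<le> n \<and> x \<in> sphere 0 1 \<longrightarrow> norm (?F (k n) x - g x) < e"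
  proof (rule Arzela_Ascoli[of _ ?F s])
    show "\<And>n x. x \<in> sphere 0 1 \<Longrightarrow> norm (?F n x) \<le> s" by (rule assms)
    fix x :: "complex ^ 'n" and e :: real
    assume x: "x \<in> sphere 0 1" and e: "0 < e"
    have "((\<lambda>y. m * dist (proj_class x) (proj_class y) powr \<alpha>) \<longlongrightarrow>
        m * dist (proj_class x) (proj_class x) powr \<alpha>) (at x within sphere 0 1)"
      using assms(3) cont x by (intro tendsto_intros) (auto simp: continuous_on_def)
    then have "\<forall>\<^sub>F y in at x within sphere 0 1. m * dist (proj_class x) (proj_class y) powr \<alpha> < e"
      by (rule order_tendstoD) (use assms(3) e in simp)
    then obtain d where d: "d > 0"
        "\<And>y. y \<in> sphere 0 1 \<Longrightarrow> y \<noteq> x \<Longrightarrow> dist y x < d \<Longrightarrow> m * dist (proj_class x) (proj_class y) powr \<alpha> < e"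
      unfolding eventually_at by blast
    show "\<exists>d>0. \<forall>n y. y \<in> sphere 0 1 \<and> norm (x - y) < d \<longrightarrow> norm (?F n x - ?F n y) < e"
    proof (intro exI[of _ d] conjI allI impI d(1))
      fix n y assume y: "y \<in> sphere 0 1 \<and> norm (x - y) < d"
      show "norm (?F n x - ?F n y) < e"
      proof (cases "y = x")
        case False
        then have "m * dist (proj_class x) (proj_class y) powr \<alpha> < e"
          using y by (intro d(2)) (auto simp: dist_norm norm_minus_commute)
        then show ?thesis
          using holder_constD[OF assms(1), of n "proj_class x" "proj_class y"] by linarith
      qed (use e in simp)
    qed
  qed blast
  define h where "h p = g (unit_rep p)" for p :: "'n cproj"
  have ul: "uniform_limit UNIV (\<lambda>n. f (k n)) h sequentially"
    unfolding uniform_limit_iff eventually_sequentially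
  proof (intro allI impI)
    fix e :: real assume "e > 0"
    then obtain N where N: "\<forall>n x. N \<le> n \<and> x \<in> sphere 0 1 \<longrightarrow> norm (?F (k n) x - g x) < e"
      using g(2) by blast
    show "\<exists>N. \<forall>n\<ge>N. \<forall>x\<in>UNIV. dist (f (k n) x) (h x) < e"
      using N by (intro exI[of _ N]) (auto simp: h_def dist_norm dest!: spec[of _ "unit_rep _"])
  qed
  have lim: "(\<lambda>n. f (k n) p) \<longlonglongrightarrow> h p" for p
    by (rule tendsto_uniform_limitI[OF ul]) simp
  have "holder_const \<alpha> m h"
    unfolding holder_const_def
  proof (intro conjI allI)
    show "0 \<le> m" by (rule holder_const_nonneg[OF assms(1)])
    fix p q
    show "cmod (h p - h q) \<le> m * dist p q powr \<alpha>"
      by (rule LIMSEQ_le_const2[OF tendsto_norm[OF tendsto_diff[OF lim lim]]])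
        (use holder_constD[OF assms(1)] in blast)
  qed
  moreover have "cmod (h p) \<le> s" for p
    by (rule LIMSEQ_le_const2[OF tendsto_norm[OF lim]]) (use assms(2) in blast)
  ultimately show ?thesis using that g(1) ul by blast
qed

section \<open>The Lasota-Yorke inequality\<close>

text \<open>A Hoelder bound in a form which is linear in \<open>\<Omega>\<close>, hence stable under integration: for
  \<open>\<Omega> = area\<close>, the optimal \<open>t\<close> is the distance of the two lines.\<close>

definition area_holder ::
  "(complex ^ 'n::finite \<Rightarrow> complex ^ 'n \<Rightarrow> real) \<Rightarrow> real \<Rightarrow> real \<Rightarrow> real \<Rightarrow> ('n cproj \<Rightarrow> complex) \<Rightarrow> bool" where
  "area_holder \<Omega> \<alpha> m s f \<longleftrightarrow> (\<forall>t x y. 0 < t \<longrightarrow>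
    cmod (lift f x - lift f y) \<le> m * t powr (\<alpha> - 1) * \<Omega> x y + m * t powr \<alpha> * (norm x * norm y)
      + s * (norm (x - y) * (norm x + norm y)))"

lemma area_holder_area:
  assumes f: "holder_const \<alpha> m f" "\<And>p. cmod (f p) \<le> s" and \<alpha>: "0 < \<alpha>" "\<alpha> \<le> 1"
  shows "area_holder area \<alpha> m s f"
  unfolding area_holder_def
proof (intro allI impI)
  have s: "0 \<le> s" using f(2)[of undefined] norm_ge_zero order_trans by blast
  note m = holder_const_nonneg[OF f(1)]
  fix t :: real and x y :: "complex ^ 'a"
  assume t: "0 < t"
  let ?R = "\<lambda>x y. m * t powr (\<alpha> - 1) * area x y + m * t powr \<alpha> * (norm x * norm y)"
  let ?L = "\<lambda>x y :: complex ^ 'a. norm (x - y) * (norm x + norm y)"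
  have R: "0 \<le> ?R x y" for x y using m by simp
  have sq: "\<bar>(norm x)\<^sup>2 - (norm y)\<^sup>2\<bar> \<le> ?L x y" for x y :: "complex ^ 'a"
    unfolding power2_eq_square square_diff_square_factored abs_mult
    by (subst mult.commute) (auto intro!: mult_mono norm_triangle_ineq3)
  \<comment> \<open>Ordering the norms gives |x|^2 \<le> |x| |y|, so the difference of the values of
    \<open>f\<close> can be weighted by the smaller square.\<close>
  have le: "cmod (lift f x - lift f y) \<le> ?R x y + s * ?L x y" if xy: "norm x \<le> norm y" for x y
  proof (cases "x = 0")
    case True
    have "cmod (lift f y) \<le> s * (norm y)\<^sup>2" by (rule norm_lift_le[OF f(2)])
    then show ?thesis using True R[of x y] by (simp add: power2_eq_square)
  next
    case x: False
    then have y: "y \<noteq> 0" using xy by auto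
    let ?p = "proj_class x" and ?q = "proj_class y"
    have "lift f x - lift f y = (f ?p - f ?q) * complex_of_real ((norm x)\<^sup>2)
        + f ?q * complex_of_real ((norm x)\<^sup>2 - (norm y)\<^sup>2)"
      using x y by (simp add: lift_def algebra_simps)
    then have "cmod (lift f x - lift f y) \<le> cmod ((f ?p - f ?q) * complex_of_real ((norm x)\<^sup>2))
        + cmod (f ?q * complex_of_real ((norm x)\<^sup>2 - (norm y)\<^sup>2))"
      by (simp only: norm_triangle_ineq)
    also have "\<dots> = cmod (f ?p - f ?q) * (norm x)\<^sup>2 + cmod (f ?q) * \<bar>(norm x)\<^sup>2 - (norm y)\<^sup>2\<bar>"
      by (simp only: norm_mult norm_of_real) simp
    also have "\<dots> \<le> ?R x y + s * ?L x y"
    proof (rule add_mono)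
      show "cmod (f ?q) * \<bar>(norm x)\<^sup>2 - (norm y)\<^sup>2\<bar> \<le> s * ?L x y"
        using s by (intro mult_mono f sq) auto
      let ?d = "dist ?p ?q" and ?N = "norm x * norm y"
      \<comment> \<open>For d \<le> t the last term suffices. For d > t the exponent \<alpha> - 1
        \<le> 0 gives d^(\<alpha>-1) \<le> t^(\<alpha>-1), and a factor d is split off.\<close>
      have powr: "?d powr \<alpha> \<le> t powr (\<alpha> - 1) * ?d + t powr \<alpha>"
      proof (cases "?d \<le> t")
        case True
        then have "?d powr \<alpha> \<le> t powr \<alpha>" using \<alpha> by (intro powr_mono2) auto
        then show ?thesis using t by (simp add: add_increasing)
      next
        case False
        then have d: "?d > 0" using t by linarith
        have "?d powr (\<alpha> - 1) \<le> t powr (\<alpha> - 1)"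
          using False t \<alpha> by (intro powr_mono2') auto
        then have "?d powr (\<alpha> - 1) * ?d \<le> t powr (\<alpha> - 1) * ?d"
          by (rule mult_right_mono) simp
        moreover have "?d powr (\<alpha> - 1) * ?d = ?d powr \<alpha>"
          using d by (simp add: powr_diff)
        ultimately have "?d powr \<alpha> \<le> t powr (\<alpha> - 1) * ?d" by simp
        then show ?thesis by (rule add_increasing2[rotated]) simp
      qed
      have "cmod (f ?p - f ?q) * (norm x)\<^sup>2 \<le> m * ?d powr \<alpha> * ?N"
        using xy m by (intro mult_mono holder_constD f) (auto simp: power2_eq_square intro: mult_left_mono)
      also have "\<dots> \<le> m * (t powr (\<alpha> - 1) * ?d + t powr \<alpha>) * ?N"
        using m powr by (intro mult_right_mono mult_left_mono) auto
      also have "\<dots> = ?R x y"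
        using area_eq_dist[OF x y] by (simp add: algebra_simps)
      finally show "cmod (f ?p - f ?q) * (norm x)\<^sup>2 \<le> ?R x y" .
    qed
    finally show ?thesis .
  qed
  show "cmod (lift f x - lift f y) \<le> ?R x y + s * ?L x y"
  proof (cases "norm x \<le> norm y")
    case False
    then show ?thesis
      using le[of y x] by (simp add: norm_minus_commute area_commute[of y x] mult.commute[of "norm y"] add.commute)
  qed (rule le)
qed

text \<open>The inequality is read at unit representatives of optimal relative phase, with t =
  \<tau> d. The first two terms then become multiples of d^\<alpha>, while the term carrying
  \<open>s\<close> stays linear in d.\<close>

lemma area_holder_imp_holder:
  assumes f: "area_holder \<Omega> \<alpha> m s f" "0 \<le> m" "0 \<le> s"
    and \<Omega>: "\<And>x y. \<Omega> x y \<le> e * area x y" and \<tau>: "0 < \<tau>"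
  shows "cmod (f p - f q) \<le> m * (\<tau> powr (\<alpha> - 1) * e + \<tau> powr \<alpha>) * dist p q powr \<alpha> + s * (2 * sqrt 2 * dist p q)"
proof (cases "p = q")
  case False
  define d where "d = dist p q"
  have d: "d > 0" using False by (simp add: d_def)
  obtain c where c: "cmod c = 1" "norm (unit_rep p - c *s unit_rep q) \<le> sqrt 2 * d"
    using optimal_phase[of "unit_rep p" "unit_rep q"] by (auto simp: d_def)
  let ?x = "unit_rep p" and ?y = "c *s unit_rep q"
  have y: "norm ?y = 1" using c by (simp add: norm_cvector_smult)
  have "area ?x ?y = d"
    using area_smult[of 1 ?x c "unit_rep q"] c by (simp add: d_def dist_cproj_area)
  then have le: "\<Omega> ?x ?y \<le> e * d" using \<Omega>[of ?x ?y] by simp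
  have lift: "lift f ?x = f p" "lift f ?y = f q"
    using c by (simp_all add: lift_smult)
  have "cmod (f p - f q) \<le> m * (\<tau> * d) powr (\<alpha> - 1) * \<Omega> ?x ?y + m * (\<tau> * d) powr \<alpha> * (norm ?x * norm ?y)
      + s * (norm (?x - ?y) * (norm ?x + norm ?y))"
    using f(1)[unfolded area_holder_def, rule_format, of "\<tau> * d" ?x ?y] \<tau> d by (simp only: lift mult_pos_pos)
  also have "\<dots> \<le> m * (\<tau> * d) powr (\<alpha> - 1) * (e * d) + m * (\<tau> * d) powr \<alpha> * (norm ?x * norm ?y)
      + s * (sqrt 2 * d * (norm ?x + norm ?y))"
    using f(2,3) le c(2) by (intro add_mono mult_left_mono mult_right_mono order_refl) auto
  also have "\<dots> = m * (\<tau> powr (\<alpha> - 1) * e + \<tau> powr \<alpha>) * d powr \<alpha> + s * (2 * sqrt 2 * d)"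
  proof -
    have "d powr (\<alpha> - 1) * d = d powr \<alpha>" using d by (simp add: powr_diff)
    moreover have "(\<tau> * d) powr (\<alpha> - 1) = \<tau> powr (\<alpha> - 1) * d powr (\<alpha> - 1)" "(\<tau> * d) powr \<alpha> = \<tau> powr \<alpha> * d powr \<alpha>"
      using d \<tau> by (simp_all add: powr_mult)
    ultimately show ?thesis
      using y by (simp add: algebra_simps)
  qed
  finally show ?thesis by (simp add: d_def)
qed simp

text \<open>The case \<tau> = e = 1: without decay of the areas one still gets a constant that does
  not deteriorate under iteration.\<close>

lemma area_holder_imp_holder_const:
  assumes f: "area_holder \<Omega> \<alpha> m s f" "0 \<le> m" "0 \<le> s" and \<Omega>: "\<And>x y. \<Omega> x y \<le> area x y"
    and \<alpha>: "0 < \<alpha>" "\<alpha> \<le> 1"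
  shows "holder_const \<alpha> (2 * m + s * (2 * sqrt 2)) f"
  unfolding holder_const_def
proof (intro conjI allI)
  show "0 \<le> 2 * m + s * (2 * sqrt 2)" using f by simp
  fix p q
  have "cmod (f p - f q) \<le> m * (1 powr (\<alpha> - 1) * 1 + 1 powr \<alpha>) * dist p q powr \<alpha> + s * (2 * sqrt 2 * dist p q)"
    by (rule area_holder_imp_holder[OF f]) (simp_all add: \<Omega>)
  also have "\<dots> \<le> m * (1 powr (\<alpha> - 1) * 1 + 1 powr \<alpha>) * dist p q powr \<alpha> + s * (2 * sqrt 2 * dist p q powr \<alpha>)"
    using f(3) dist_le_powr[OF \<alpha>, of p q] by (intro add_left_mono mult_left_mono) auto
  finally show "cmod (f p - f q) \<le> (2 * m + s * (2 * sqrt 2)) * dist p q powr \<alpha>"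
    by (simp add: algebra_simps)
qed

section \<open>Iterates of the Markov operator on Hoelder functions\<close>

context markov_measure
begin

lemma cmod_markov_le:
  assumes "continuous_on UNIV f" "\<And>p. cmod (f p) \<le> s"
  shows "cmod (T f p) \<le> s"
proof -
  have "cmod (T f p) \<le> (\<integral>v. cmod (lift f (v *v unit_rep p)) \<partial>\<mu>)"
    unfolding markov_op_eq_lift by (rule integral_norm_bound)
  also have "\<dots> \<le> (\<integral>v. s * (norm (v *v unit_rep p))\<^sup>2 \<partial>\<mu>)"
    by (intro integral_mono integrable_norm integrable_lift integrable_mult_right
        integrable_norm_apply norm_lift_le assms)
  also have "\<dots> = s" by (simp add: integral_norm_apply)
  finally show ?thesis .
qed

text \<open>Every term on the right is \<Omega> or a product of two norms, once |x - y| (|x| + |y|)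
  is expanded, and such products do not grow on average. So only \<Omega> changes, and the constants
  \<open>m\<close> and \<open>s\<close> are kept.\<close>

lemma area_holder_markov:
  assumes cont: "continuous_on UNIV f" and \<Omega>: "area_form \<Omega>"
    and f: "area_holder \<Omega> \<alpha> m s f" "0 \<le> m" "0 \<le> s"
  shows "area_holder (mean_form \<Omega>) \<alpha> m s (T f)"
  unfolding area_holder_def
proof (intro allI impI)
  fix t :: real and x y :: "complex ^ 'n"
  assume t: "0 < t"
  let ?N = "\<lambda>x y v. norm (v *v x) * norm (v *v y)"
  let ?R = "\<lambda>v. m * t powr (\<alpha> - 1) * \<Omega> (v *v x) (v *v y) + m * t powr \<alpha> * ?N x y v
    + (s * ?N (x - y) x v + s * ?N (x - y) y v)"
  have "lift (T f) x - lift (T f) y = (\<integral>v. lift f (v *v x) - lift f (v *v y) \<partial>\<mu>)"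
    by (simp add: lift_markov_op integrable_lift[OF cont])
  then have "cmod (lift (T f) x - lift (T f) y) \<le> (\<integral>v. cmod (lift f (v *v x) - lift f (v *v y)) \<partial>\<mu>)"
    by (simp only: integral_norm_bound)
  also have "\<dots> \<le> (\<integral>v. ?R v \<partial>\<mu>)"
  proof (rule integral_mono)
    show "integrable \<mu> (\<lambda>v. cmod (lift f (v *v x) - lift f (v *v y)))"
      by (intro integrable_norm Bochner_Integration.integrable_diff integrable_lift cont)
    show "integrable \<mu> ?R"
      by (intro Bochner_Integration.integrable_add integrable_mult_right integrable_norm_mult
          area_form_integrable \<Omega>)
    show "cmod (lift f (v *v x) - lift f (v *v y)) \<le> ?R v" for v
      using f(1)[unfolded area_holder_def, rule_format, OF t, of "v *v x" "v *v y"]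
      by (simp add: matrix_vector_mult_diff_distrib algebra_simps)
  qed
  also have "\<dots> = m * t powr (\<alpha> - 1) * mean_form \<Omega> x y + m * t powr \<alpha> * (\<integral>v. ?N x y v \<partial>\<mu>)
      + (s * (\<integral>v. ?N (x - y) x v \<partial>\<mu>) + s * (\<integral>v. ?N (x - y) y v \<partial>\<mu>))"
    by (simp add: integrable_norm_mult area_form_integrable[OF \<Omega>] mean_form_def)
  also have "\<dots> \<le> m * t powr (\<alpha> - 1) * mean_form \<Omega> x y + m * t powr \<alpha> * (norm x * norm y)
      + (s * (norm (x - y) * norm x) + s * (norm (x - y) * norm y))"
    using f(2,3) by (intro add_mono mult_left_mono integral_norm_mult_le) auto
  finally show "cmod (lift (T f) x - lift (T f) y) \<le> m * t powr (\<alpha> - 1) * mean_form \<Omega> x y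
      + m * t powr \<alpha> * (norm x * norm y) + s * (norm (x - y) * (norm x + norm y))"
    by (simp add: algebra_simps)
qed

text \<open>The three bounds are proved together because the next step needs continuity of the
  current iterate, which comes from its Hoelder bound.\<close>

lemma markov_power_bounds:
  assumes f: "holder_const \<alpha> m f" "\<And>p. cmod (f p) \<le> s" and \<alpha>: "0 < \<alpha>" "\<alpha> \<le> 1"
  shows "area_holder (mean_area n) \<alpha> m s ((T ^^ n) f) \<and>
    holder_const \<alpha> (2 * m + s * (2 * sqrt 2)) ((T ^^ n) f) \<and> (\<forall>p. cmod ((T ^^ n) f p) \<le> s)"
proof -
  have s: "0 \<le> s" using f(2)[of undefined] norm_ge_zero order_trans by blast
  note m = holder_const_nonneg[OF f(1)]
  have "mean_area n x y \<le> area x y" for n x y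
    using mean_area_antimono[of 0 n x y] by simp
  then have hc: "holder_const \<alpha> (2 * m + s * (2 * sqrt 2)) g"
    if "area_holder (mean_area n) \<alpha> m s g" for n g
    using area_holder_imp_holder_const[OF that m s _ \<alpha>] by blast
  show ?thesis
  proof (induction n)
    case 0
    show ?case using area_holder_area[OF f \<alpha>] hc[of 0 f] f by simp
  next
    case (Suc n)
    then have cont: "continuous_on UNIV ((T ^^ n) f)"
      using holder_const_continuous \<alpha>(1) by blast
    have "area_holder (mean_area (Suc n)) \<alpha> m s ((T ^^ Suc n) f)"
      using Suc area_holder_markov[OF cont area_form_mean_area _ m s, of n \<alpha>] by simp
    then show ?case
      using hc[of "Suc n"] Suc cmod_markov_le[OF cont, of s] by simp
  qed
qed

lemma cmod_markov_power_le:
  assumes "f \<in> holder \<alpha>" "0 < \<alpha>" "\<alpha> \<le> 1" "\<And>p. cmod (f p) \<le> s"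
  shows "cmod ((T ^^ n) f p) \<le> s"
  using assms markov_power_bounds unfolding mem_holder_iff by blast

lemma markov_power_holder_const:
  assumes "holder_const \<alpha> m f" "\<And>p. cmod (f p) \<le> s" "0 < \<alpha>" "\<alpha> \<le> 1"
  shows "holder_const \<alpha> (2 * m + s * (2 * sqrt 2)) ((T ^^ n) f)"
  using markov_power_bounds[OF assms] by blast

lemma Lasota_Yorke:
  assumes "Pur \<mu>" and \<alpha>: "0 < \<alpha>" "\<alpha> \<le> 1" and "0 < \<epsilon>"
  shows "\<exists>N. \<forall>n\<ge>N. \<forall>f m s. holder_const \<alpha> m f \<and> (\<forall>p. cmod (f p) \<le> s) \<longrightarrow>
    (\<forall>p q. cmod ((T ^^ n) f p - (T ^^ n) f q) \<le> \<epsilon> * m * dist p q powr \<alpha> + s * (2 * sqrt 2 * dist p q))"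
proof -
  \<comment> \<open>First \<tau> is chosen so that the term without area contributes \<epsilon>/2;
    only then is the area decay \<open>e\<close> chosen small enough to compensate
    \<tau>^(\<alpha>-1).\<close>
  define \<tau> where "\<tau> = (\<epsilon> / 2) powr (1 / \<alpha>)"
  have \<tau>: "\<tau> > 0" "\<tau> powr \<alpha> = \<epsilon> / 2"
    using assms(4) \<alpha> by (simp_all add: \<tau>_def powr_powr)
  define e where "e = \<epsilon> / (2 * \<tau> powr (\<alpha> - 1))"
  have e: "e > 0" "\<tau> powr (\<alpha> - 1) * e = \<epsilon> / 2"
    using assms(4) \<tau> by (simp_all add: e_def)
  obtain N where N: "\<And>n x y. n \<ge> N \<Longrightarrow> mean_area n x y \<le> e * area x y"
    using mean_area_uniform[OF assms(1) e(1)] by blast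
  have "cmod ((T ^^ n) f p - (T ^^ n) f q) \<le> \<epsilon> * m * dist p q powr \<alpha> + s * (2 * sqrt 2 * dist p q)"
    if "n \<ge> N" and f: "holder_const \<alpha> m f" "\<forall>p. cmod (f p) \<le> s" for n f m s p q
  proof -
    have s: "0 \<le> s" using f(2) norm_ge_zero order_trans by blast
    have "cmod ((T ^^ n) f p - (T ^^ n) f q)
        \<le> m * (\<tau> powr (\<alpha> - 1) * e + \<tau> powr \<alpha>) * dist p q powr \<alpha> + s * (2 * sqrt 2 * dist p q)"
      using markov_power_bounds[OF f(1) _ \<alpha>] f(2)
      by (intro area_holder_imp_holder[OF _ holder_const_nonneg[OF f(1)] s N[OF that(1)] \<tau>(1)]) auto
    then show ?thesis unfolding e(2) \<tau>(2) by (simp add: mult.commute)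
  qed
  then show ?thesis by blast
qed

lemma markov_power_holder: "f \<in> holder \<alpha> \<Longrightarrow> 0 < \<alpha> \<Longrightarrow> \<alpha> \<le> 1 \<Longrightarrow> (T ^^ n) f \<in> holder \<alpha>"
  by (metis holder_normE markov_power_holder_const mem_holder_iff)

lemma markov_holder: "f \<in> holder \<alpha> \<Longrightarrow> 0 < \<alpha> \<Longrightarrow> \<alpha> \<le> 1 \<Longrightarrow> T f \<in> holder \<alpha>"
  using markov_power_holder[of f \<alpha> 1] by simp

lemma holder_norm_markov_power_le:
  assumes "f \<in> holder \<alpha>" "0 < \<alpha>" "\<alpha> \<le> 1"
  shows "holder_norm \<alpha> ((T ^^ n) f) \<le> 5 * holder_norm \<alpha> f"
proof -
  obtain s m where f: "holder_norm \<alpha> f = s + m" "holder_const \<alpha> m f" "\<And>p. cmod (f p) \<le> s" "0 \<le> s" "0 \<le> m"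
    using holder_normE[OF assms(1,2)] by blast
  have "holder_norm \<alpha> ((T ^^ n) f) \<le> s + (2 * m + s * (2 * sqrt 2))"
    by (intro holder_norm_le markov_power_holder_const cmod_markov_power_le[OF assms] f assms)
  \<comment> \<open>Origin of the constant 5: the total is s + 2 m + 2 sqrt 2 s, and 2 sqrt 2 \<le>
    4. It does not depend on the power.\<close>
  moreover have "sqrt 2 \<le> 2" by (rule real_le_lsqrt) auto
  then have "s * (2 * sqrt 2) \<le> s * 4" using f by (intro mult_left_mono) auto
  ultimately show ?thesis using f by linarith
qed

lemma markov_linear:
  assumes "continuous_on UNIV f" "continuous_on UNIV g"
  shows "T (\<lambda>p. a * f p + b * g p) = (\<lambda>p. a * T f p + b * T g p)"
proof
  fix p
  have "lift (\<lambda>p. a * f p + b * g p) x = a * lift f x + b * lift g x" for x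
    by (simp add: lift_def algebra_simps)
  then show "T (\<lambda>p. a * f p + b * g p) p = a * T f p + b * T g p"
    by (simp add: markov_op_eq_lift integrable_lift assms)
qed

lemma markov_cmult: "T (\<lambda>p. a * f p) = (\<lambda>p. a * T f p)"
proof
  fix p
  have "lift (\<lambda>p. a * f p) x = a * lift f x" for x
    by (simp add: lift_def)
  then show "T (\<lambda>p. a * f p) p = a * T f p"
    by (simp add: markov_op_eq_lift)
qed

lemma markov_one: "T (\<lambda>p. 1) = (\<lambda>p. 1)"
proof
  fix p
  have "lift (\<lambda>p. 1) x = complex_of_real ((norm x)\<^sup>2)" for x :: "complex ^ 'n"
    by (simp add: lift_def)
  then show "T (\<lambda>p. 1) p = 1"
    by (simp only: markov_op_eq_lift integral_complex_of_real integral_norm_apply) simp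
qed

lemma markov_power_linear:
  assumes "f \<in> holder \<alpha>" "g \<in> holder \<alpha>" "0 < \<alpha>" "\<alpha> \<le> 1"
  shows "(T ^^ n) (\<lambda>p. a * f p + b * g p) = (\<lambda>p. a * (T ^^ n) f p + b * (T ^^ n) g p)"
proof (induction n)
  case (Suc n)
  have "continuous_on UNIV ((T ^^ n) f)" "continuous_on UNIV ((T ^^ n) g)"
    using assms by (auto intro: holder_continuous markov_power_holder)
  then show ?case by (simp add: Suc markov_linear)
qed simp

lemma markov_power_cmult: "(T ^^ n) (\<lambda>p. a * f p) = (\<lambda>p. a * (T ^^ n) f p)"
  by (induction n) (simp_all add: markov_cmult)

lemma markov_power_diff:
  assumes "f \<in> holder \<alpha>" "g \<in> holder \<alpha>" "0 < \<alpha>" "\<alpha> \<le> 1"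
  shows "(T ^^ n) (\<lambda>p. f p - g p) = (\<lambda>p. (T ^^ n) f p - (T ^^ n) g p)"
  using markov_power_linear[OF assms, of n 1 "-1"] by simp

lemma markov_power_sum:
  assumes "finite I" "\<And>i. i \<in> I \<Longrightarrow> f i \<in> holder \<alpha>" "0 < \<alpha>" "\<alpha> \<le> 1"
  shows "(\<lambda>p. \<Sum>i\<in>I. c i * f i p) \<in> holder \<alpha> \<and>
    (T ^^ n) (\<lambda>p. \<Sum>i\<in>I. c i * f i p) = (\<lambda>p. \<Sum>i\<in>I. c i * (T ^^ n) (f i) p)"
  using assms(1,2)
proof (induction I)
  case empty
  show ?case using holder_zero markov_power_cmult[of n 0 "\<lambda>p. 0"] by simp
next
  case (insert i I)
  then have IH: "(\<lambda>p. \<Sum>i\<in>I. c i * f i p) \<in> holder \<alpha>"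
    "(T ^^ n) (\<lambda>p. \<Sum>i\<in>I. c i * f i p) = (\<lambda>p. \<Sum>i\<in>I. c i * (T ^^ n) (f i) p)" by auto
  have fi: "f i \<in> holder \<alpha>" using insert by auto
  have "(\<lambda>p. \<Sum>j\<in>insert i I. c j * f j p) = (\<lambda>p. c i * f i p + 1 * (\<Sum>j\<in>I. c j * f j p))"
    using insert by simp
  then show ?case
    using holder_add[OF holder_cmult[OF fi] IH(1)] insert
    by (simp only: markov_power_linear[OF fi IH(1) assms(3,4)] IH(2)) simp
qed

end

section \<open>Words in the support\<close>

lemma unit_rep_proj_class_smult:
  assumes "x \<noteq> 0"
  obtains c where "c \<noteq> 0" "unit_rep (proj_class x) = c *s x"
proof -
  obtain c where c: "unit_rep (proj_class x) = c *s x"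
    using proj_class_eq_iff[of x "unit_rep (proj_class x)"] assms by auto
  moreover have "c \<noteq> 0" using c unit_rep_nonzero[of "proj_class x"] by auto
  ultimately show ?thesis using that by blast
qed

lemma matrix_vector_unit_rep_proj_class:
  assumes "x \<noteq> 0"
  shows "W *v unit_rep (proj_class x) = 0 \<longleftrightarrow> W *v x = 0"
    and "proj_act W (proj_class x) = proj_class (W *v x)"
proof -
  obtain c where c: "c \<noteq> 0" "unit_rep (proj_class x) = c *s x"
    using unit_rep_proj_class_smult[OF assms] .
  then show *: "W *v unit_rep (proj_class x) = 0 \<longleftrightarrow> W *v x = 0"
    by (simp add: matrix_vector_smult)
  show "proj_act W (proj_class x) = proj_class (W *v x)"
  proof (cases "W *v x = 0")
    case True
    then show ?thesis using * by (simp add: proj_act_def)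
  next
    case False
    then show ?thesis using c by (simp add: proj_act_def matrix_vector_smult proj_class_smult)
  qed
qed

lemma proj_act_mult:
  assumes "V *v unit_rep p \<noteq> 0"
  shows "(W ** V) *v unit_rep p = 0 \<longleftrightarrow> W *v unit_rep (proj_act V p) = 0"
    and "proj_act (W ** V) p = proj_act W (proj_act V p)"
  unfolding proj_act_def[of V p] matrix_vector_unit_rep_proj_class[OF assms]
  by (simp_all add: proj_act_def matrix_vector_mul_assoc)

context markov_measure
begin

text \<open>New letters are multiplied on the right, so they act first; this matches the recursion
  of T^n f, whose outermost average is over the first letter.\<close>

primrec words :: "nat \<Rightarrow> (complex ^ 'n ^ 'n) set" where
  "words 0 = {mat 1}"
| "words (Suc n) = {W ** v | W v. W \<in> words n \<and> v \<in> S}"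

lemma words_1: "v \<in> S \<Longrightarrow> v \<in> words 1"
  by auto

lemma words_mult: "W \<in> words n \<Longrightarrow> V \<in> words m \<Longrightarrow> W ** V \<in> words (n + m)"
proof (induction m arbitrary: V)
  case (Suc m)
  then obtain V' v where V: "V = V' ** v" "V' \<in> words m" "v \<in> S" by auto
  then have "W ** V' \<in> words (n + m)" using Suc by blast
  then show ?case using V by (auto simp: matrix_mul_assoc)
qed simp

text \<open>With z = T f p, the real part of conj(z) times the lift is at most c^2 |v x|^2 and has
  the same mean, so both agree on the support. A value of modulus at most c whose product with
  conj(z) has real part c^2 = |z|^2 must be z.\<close>

lemma deterministic_step:
  assumes f: "continuous_on UNIV f" "\<And>p. cmod (f p) \<le> c" and p: "cmod (T f p) = c"
    and v: "v \<in> S" "v *v unit_rep p \<noteq> 0"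
  shows "f (proj_act v p) = T f p"
proof -
  let ?x = "unit_rep p" and ?z = "T f p"
  let ?\<phi> = "\<lambda>v. Re (cnj ?z * lift f (v *v ?x))" and ?\<psi> = "\<lambda>v :: complex ^ 'n ^ 'n. c\<^sup>2 * (norm (v *v ?x))\<^sup>2"
  have c: "0 \<le> c" using p norm_ge_zero by metis
  have z: "cnj ?z * ?z = complex_of_real (c\<^sup>2)"
    using complex_norm_square[of ?z] p by (simp add: mult.commute)
  have "?\<phi> v = ?\<psi> v"
  proof (rule integral_eq_imp_eq_on_support[OF _ _ _ _ _ _ v(1)])
    show "continuous_on UNIV ?\<phi>"
      by (intro continuous_intros continuous_on_compose2[OF continuous_on_lift[OF f(1)]]) auto
    show "continuous_on UNIV ?\<psi>"
      by (intro continuous_intros)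
    show "integrable \<mu> ?\<psi>"
      by (intro integrable_mult_right integrable_norm_apply)
    have int: "integrable \<mu> (\<lambda>v. cnj ?z * lift f (v *v ?x))"
      by (intro integrable_mult_right integrable_lift f)
    then show "integrable \<mu> ?\<phi>" by (rule integrable_Re)
    show "?\<phi> v \<le> ?\<psi> v" for v
    proof -
      have "?\<phi> v \<le> c * cmod (lift f (v *v ?x))"
        using complex_Re_le_cmod[of "cnj ?z * lift f (v *v ?x)"] by (simp add: norm_mult p)
      also have "\<dots> \<le> c * (c * (norm (v *v ?x))\<^sup>2)"
        by (intro mult_left_mono norm_lift_le f c)
      finally show ?thesis by (simp add: power2_eq_square mult.assoc)
    qed
    have "(\<integral>v. ?\<phi> v \<partial>\<mu>) = Re (\<integral>v. cnj ?z * lift f (v *v ?x) \<partial>\<mu>)"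
      by (rule integral_Re[OF int])
    also have "(\<integral>v. cnj ?z * lift f (v *v ?x) \<partial>\<mu>) = cnj ?z * ?z"
      by (simp add: markov_op_eq_lift)
    finally show "(\<integral>v. ?\<phi> v \<partial>\<mu>) = (\<integral>v. ?\<psi> v \<partial>\<mu>)"
      unfolding z by (simp add: integral_norm_apply)
  qed
  then have "Re (cnj ?z * f (proj_act v p)) * (norm (v *v ?x))\<^sup>2 = c\<^sup>2 * (norm (v *v ?x))\<^sup>2"
    using v(2) by (simp add: lift_def proj_act_def algebra_simps)
  then have re: "Re (cnj ?z * f (proj_act v p)) = c\<^sup>2"
    using v(2) by simp
  let ?w = "f (proj_act v p)"
  have "(cmod (?w - ?z))\<^sup>2 = (cmod ?w)\<^sup>2 + (cmod ?z)\<^sup>2 - 2 * Re (cnj ?z * ?w)"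
    by (simp only: cmod_power2) (simp add: power2_eq_square algebra_simps)
  also have "\<dots> = (cmod ?w)\<^sup>2 - c\<^sup>2" by (simp only: re p)
  also have "\<dots> \<le> 0" using f(2)[of "proj_act v p"] by (simp add: power_mono)
  finally show ?thesis by simp
qed

text \<open>Where \<open>|T\<^sup>n f|\<close> attains an upper bound of \<open>|f|\<close>, the average defining \<open>T\<^sup>n f\<close> is constant.\<close>

lemma deterministic_word:
  assumes f: "f \<in> holder \<alpha>" "0 < \<alpha>" "\<alpha> \<le> 1" "\<And>p. cmod (f p) \<le> c"
    and "cmod ((T ^^ n) f p) = c" "W \<in> words n" "W *v unit_rep p \<noteq> 0"
  shows "f (proj_act W p) = (T ^^ n) f p"
  using assms(5-7)
proof (induction n arbitrary: W p)
  case 0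
  then show ?case by (simp add: proj_act_def)
next
  case (Suc n)
  then obtain W' v where W: "W = W' ** v" "W' \<in> words n" "v \<in> S" by auto
  have v: "v *v unit_rep p \<noteq> 0"
    using Suc.prems(3) W(1) by (auto simp flip: matrix_vector_mul_assoc)
  have step: "(T ^^ n) f (proj_act v p) = (T ^^ Suc n) f p"
    using deterministic_step[of "(T ^^ n) f" c p v] Suc.prems(1) W(3) v f
    by (simp add: holder_continuous[OF markov_power_holder] cmod_markov_power_le[OF f(1-3)])
  moreover have "W' *v unit_rep (proj_act v p) \<noteq> 0"
    using Suc.prems(3) proj_act_mult(1)[OF v] W(1) by simp
  ultimately have "f (proj_act W' (proj_act v p)) = (T ^^ n) f (proj_act v p)"
    using Suc.IH[of "proj_act v p" W'] W(2) Suc.prems(1) by simp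
  then show ?case
    using step W(1) proj_act_mult(2)[OF v] by simp
qed

section \<open>A proximal word\<close>

text \<open>In finite dimension every invariant subspace contains one of least dimension, hence a
  minimal one. Uniqueness then places the same minimal subspace inside all of them, and
  \<open>e\<close> is any of its unit vectors.\<close>

lemma Erg_common_vector:
  assumes "Erg \<mu>"
  obtains e where "norm e = 1"
    "\<And>E'. vec.subspace E' \<Longrightarrow> E' \<noteq> {0} \<Longrightarrow> (\<And>v x. v \<in> S \<Longrightarrow> x \<in> E' \<Longrightarrow> v *v x \<in> E') \<Longrightarrow> e \<in> E'"
proof -
  obtain E where E: "invariant_subspace \<mu> E" and unique: "\<And>E0. invariant_subspace \<mu> E0 \<and>
      (\<forall>E'. invariant_subspace \<mu> E' \<and> E' \<subseteq> E0 \<longrightarrow> E' = E0) \<Longrightarrow> E0 = E"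
    using assms[unfolded Erg_def, THEN ex1_implies_ex] ex1E[OF assms[unfolded Erg_def]] by metis
  have sub: "vec.subspace E" "E \<noteq> {0}"
    using E by (auto simp: invariant_subspace_def)
  then obtain x where x: "x \<in> E" "x \<noteq> 0"
    using vec.subspace_0 by blast
  obtain e where e: "norm e = 1" "x = complex_of_real (norm x) *s e"
    using normalize_cvector[OF x(2)] .
  have "complex_of_real (inverse (norm x)) *s x = e"
  proof -
    have "complex_of_real (inverse (norm x)) * complex_of_real (norm x) = 1" using x by simp
    then show ?thesis by (subst e(2)) (simp only: vector_smult_assoc vector_smult_lid)
  qed
  then have eE: "e \<in> E" using vec.subspace_scale[OF sub(1) x(1)] by metis
  have "E \<subseteq> E'" if E': "vec.subspace E'" "E' \<noteq> {0}" "\<And>v x. v \<in> S \<Longrightarrow> x \<in> E' \<Longrightarrow> v *v x \<in> E'" for E'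
  proof -
    have inv: "invariant_subspace \<mu> E'"
      unfolding invariant_subspace_def using E' AE_S by (auto elim: eventually_mono)
    obtain E0 where E0: "invariant_subspace \<mu> E0" "E0 \<subseteq> E'"
      "\<And>F. invariant_subspace \<mu> F \<and> F \<subseteq> E' \<Longrightarrow> vec.dim E0 \<le> vec.dim F"
      using ex_has_least_nat[of "\<lambda>F. invariant_subspace \<mu> F \<and> F \<subseteq> E'" E' vec.dim] inv by blast
    have "E0 = E"
    proof (rule unique, intro conjI allI impI E0(1), elim conjE)
      fix F assume F: "invariant_subspace \<mu> F" "F \<subseteq> E0"
      then have "vec.dim E0 \<le> vec.dim F" using E0 by blast
      then show "F = E0"
        using F E0(1) by (intro vec.subspace_dim_equal) (auto simp: invariant_subspace_def)
    qed
    then show ?thesis using E0(2) by simp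
  qed
  with eE show ?thesis by (intro that[OF e(1)]) (auto dest!: subsetD)
qed

text \<open>The span of the orbit of x is invariant and nonzero, as the empty word puts x in it. So
  it contains \<open>e\<close> and cannot lie in the kernel of \<theta>.\<close>

lemma word_off_hyperplane:
  assumes e: "\<And>E'. vec.subspace E' \<Longrightarrow> E' \<noteq> {0} \<Longrightarrow> (\<And>v x. v \<in> S \<Longrightarrow> x \<in> E' \<Longrightarrow> v *v x \<in> E') \<Longrightarrow> e \<in> E'"
    and \<theta>: "\<And>x y. \<theta> (x + y) = \<theta> x + \<theta> y" "\<And>c x. \<theta> (c *s x) = c * \<theta> x" "\<theta> e \<noteq> (0 :: complex)"
    and x: "x \<noteq> 0"
  shows "\<exists>n. \<exists>V\<in>words n. \<theta> (V *v x) \<noteq> 0"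
proof (rule ccontr)
  assume *: "\<not> ?thesis"
  define Orb where "Orb = {V *v x | V n. V \<in> words n}"
  define E where "E = vec.span Orb"
  have "x \<in> Orb" unfolding Orb_def mem_Collect_eq
    by (intro exI[of _ "mat 1"] exI[of _ 0]) simp
  then have "E \<noteq> {0}" using x vec.span_base[of x Orb] by (auto simp: E_def)
  moreover have "v *v y \<in> E" if "v \<in> S" "y \<in> E" for v y
  proof -
    have "E \<subseteq> {y. v *v y \<in> E}"
      unfolding E_def
    proof (rule vec.span_minimal)
      show "Orb \<subseteq> {y. v *v y \<in> vec.span Orb}"
      proof
        fix y assume "y \<in> Orb"
        then obtain V n where V: "y = V *v x" "V \<in> words n" by (auto simp: Orb_def)
        have "v ** V \<in> words (1 + n)" using words_mult[OF words_1[OF that(1)] V(2)] .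
        then have "v *v y \<in> Orb" unfolding Orb_def V(1) matrix_vector_mul_assoc by blast
        then show "y \<in> {y. v *v y \<in> vec.span Orb}" by (simp add: vec.span_base)
      qed
      show "vec.subspace {y. v *v y \<in> vec.span Orb}"
        by (auto simp: vec.subspace_def matrix_vector_right_distrib matrix_vector_smult
            vec.span_add vec.span_scale vec.span_zero)
    qed
    then show ?thesis using that by auto
  qed
  ultimately have "e \<in> E" using e[of E] by (auto simp: E_def)
  moreover have "E \<subseteq> {y. \<theta> y = 0}"
    unfolding E_def
  proof (rule vec.span_minimal)
    show "Orb \<subseteq> {y. \<theta> y = 0}" using * by (auto simp: Orb_def)
    have "\<theta> 0 = 0" using \<theta>(2)[of 0 0] by simp
    then show "vec.subspace {y. \<theta> y = 0}" by (auto simp: vec.subspace_def \<theta>)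
  qed
  ultimately show False using \<theta>(3) by auto
qed

text \<open>A first-moment argument, one letter at a time: |v A|^2 and |v A e|^2 have means |A|^2
  and |A e|^2, and the mean of \<open>mean_area n\<close> is \<open>mean_area (Suc n)\<close>. If
  the averaged difference is negative, some letter of the support makes it negative.\<close>

lemma mean_bound_imp_word:
  fixes A :: "complex ^ 'n ^ 'n"
  assumes "m * (\<Sum>i\<in>UNIV. \<Sum>j\<in>UNIV. mean_area n (A *v axis i 1) (A *v axis j 1))
      + \<delta> * (norm A)\<^sup>2 < (norm (A *v e))\<^sup>2"
  shows "\<exists>W\<in>words n. m * (\<Sum>i\<in>UNIV. \<Sum>j\<in>UNIV. area ((W ** A) *v axis i 1) ((W ** A) *v axis j 1))
      + \<delta> * (norm (W ** A))\<^sup>2 < (norm ((W ** A) *v e))\<^sup>2"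
  using assms
proof (induction n arbitrary: A)
  case (Suc n)
  let ?\<Phi> = "\<lambda>n A. m * (\<Sum>i\<in>UNIV. \<Sum>j\<in>UNIV. mean_area n (A *v axis i 1) (A *v axis j 1))
      + \<delta> * (norm A)\<^sup>2 - (norm (A *v e))\<^sup>2"
  note int = area_form_integrable(2)[OF area_form_mean_area]
  have "\<exists>v\<in>S. ?\<Phi> n (v ** A) < 0"
  proof (rule ccontr)
    assume "\<not> ?thesis"
    then have nn: "v \<in> S \<Longrightarrow> 0 \<le> ?\<Phi> n (v ** A)" for v by force
    let ?F = "\<lambda>v. m * (\<Sum>i\<in>UNIV. \<Sum>j\<in>UNIV. mean_area n (v *v (A *v axis i 1)) (v *v (A *v axis j 1)))
      + \<delta> * (\<Sum>j\<in>UNIV. (norm (v *v (A *v axis j 1)))\<^sup>2) - (norm (v *v (A *v e)))\<^sup>2"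
    have F: "?F v = ?\<Phi> n (v ** A)" for v
      by (simp add: norm_matrix_columns[of "v ** A"] flip: matrix_vector_mul_assoc)
    have "0 \<le> (\<integral>v. ?F v \<partial>\<mu>)"
      by (intro integral_nonneg_AE eventually_mono[OF AE_S]) (subst F, erule nn)
    also have "(\<integral>v. ?F v \<partial>\<mu>) = m * (\<Sum>i\<in>UNIV. \<Sum>j\<in>UNIV. mean_area (Suc n) (A *v axis i 1) (A *v axis j 1))
      + \<delta> * (\<Sum>j\<in>UNIV. (norm (A *v axis j 1))\<^sup>2) - (norm (A *v e))\<^sup>2"
      by (simp add: int integrable_norm_apply integral_norm_apply mean_form_def)
    finally show False
      using Suc.prems by (simp add: norm_matrix_columns[of A])
  qed
  then obtain v where v: "v \<in> S" "?\<Phi> n (v ** A) < 0" by blast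
  have "m * (\<Sum>i\<in>UNIV. \<Sum>j\<in>UNIV. mean_area n ((v ** A) *v axis i 1) ((v ** A) *v axis j 1))
      + \<delta> * (norm (v ** A))\<^sup>2 < (norm ((v ** A) *v e))\<^sup>2"
    using v(2) by linarith
  from Suc.IH[OF this] obtain W where W: "W \<in> words n"
    "m * (\<Sum>i\<in>UNIV. \<Sum>j\<in>UNIV. area ((W ** (v ** A)) *v axis i 1) ((W ** (v ** A)) *v axis j 1))
      + \<delta> * (norm (W ** (v ** A)))\<^sup>2 < (norm ((W ** (v ** A)) *v e))\<^sup>2" by blast
  have "W ** v \<in> words (Suc n)" using W(1) v(1) by auto
  then show ?case using W(2) by (intro bexI[of _ "W ** v"]) (simp_all add: matrix_mul_assoc)
qed simp

text \<open>The term \<open>\<delta> |W|\<^sup>2\<close> keeps limits of the normalised words from vanishing on \<open>e\<close>.\<close>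

lemma almost_rank_one_word:
  assumes "Pur \<mu>" "norm e = 1"
  shows "\<exists>n\<ge>1. \<exists>W\<in>words n. real m * (\<Sum>i\<in>UNIV. \<Sum>j\<in>UNIV. area (W *v axis i 1) (W *v axis j 1))
      + 1 / (2 * real CARD('n)) * (norm W)\<^sup>2 < (norm (W *v e))\<^sup>2"
proof -
  let ?k = "real CARD('n)"
  have k: "?k > 0" by simp
  \<comment> \<open>At the identity matrix the areas then contribute less than 1/2 and the second
    term exactly 1/2, since |Id|^2 is the dimension; the sum stays below |e|^2 = 1.\<close>
  define \<epsilon> where "\<epsilon> = 1 / (4 * (real m + 1) * (?k * ?k))"
  have \<epsilon>: "\<epsilon> > 0" using k by (simp add: \<epsilon>_def)
  obtain N where N: "\<And>n x y. n \<ge> N \<Longrightarrow> mean_area n x y \<le> \<epsilon> * area x y"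
    using mean_area_uniform[OF assms(1) \<epsilon>] by blast
  \<comment> \<open>The word must be nonempty, because its length enters the later period
    \<open>q\<close>.\<close>
  let ?n = "max N 1"
  have axis: "norm (axis i 1 :: complex ^ 'n) = 1" for i
  proof -
    have "(norm (axis i 1 :: complex ^ 'n))\<^sup>2 = 1"
      unfolding sum_cmod_power2[symmetric] by (simp add: axis_def if_distrib[of cmod] if_distrib[of "\<lambda>x. x\<^sup>2"] cong: if_cong)
    then show ?thesis by (simp add: power2_eq_1_iff)
  qed
  have le: "mean_area ?n (mat 1 *v axis i 1) (mat 1 *v axis j 1) \<le> \<epsilon>" for i j
  proof -
    have "mean_area ?n (axis i 1) (axis j 1) \<le> \<epsilon> * area (axis i 1) (axis j 1)" by (rule N) simp
    also have "\<dots> \<le> \<epsilon> * 1"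
      using area_le[of "axis i 1 :: complex ^ 'n" "axis j 1"] \<epsilon> by (intro mult_left_mono) (auto simp: axis)
    finally show ?thesis by simp
  qed
  have "(\<Sum>i\<in>UNIV. \<Sum>j\<in>UNIV. mean_area ?n (mat 1 *v axis i 1) (mat 1 *v axis j 1)) \<le> (\<Sum>i\<in>(UNIV :: 'n set). \<Sum>j\<in>(UNIV :: 'n set). \<epsilon>)"
    by (intro sum_mono le)
  then have "real m * (\<Sum>i\<in>UNIV. \<Sum>j\<in>UNIV. mean_area ?n (mat 1 *v axis i 1) (mat 1 *v axis j 1)) \<le> real m * (?k * ?k * \<epsilon>)"
    by (intro mult_left_mono) auto
  also have "?k * ?k * \<epsilon> = 1 / (4 * (real m + 1))"
    using k by (simp add: \<epsilon>_def)
  also have "real m * (1 / (4 * (real m + 1))) < 1 / 2"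
    by (simp add: divide_less_eq)
  finally have "real m * (\<Sum>i\<in>UNIV. \<Sum>j\<in>UNIV. mean_area ?n (mat 1 *v axis i 1) (mat 1 *v axis j 1)) < 1 / 2" .
  moreover have "(norm (mat 1 :: complex ^ 'n ^ 'n))\<^sup>2 = ?k"
    by (simp add: norm_matrix_columns axis)
  ultimately have "real m * (\<Sum>i\<in>UNIV. \<Sum>j\<in>UNIV. mean_area ?n (mat 1 *v axis i 1) (mat 1 *v axis j 1))
      + 1 / (2 * ?k) * (norm (mat 1 :: complex ^ 'n ^ 'n))\<^sup>2 < (norm (mat 1 *v e))\<^sup>2"
    using assms(2) k by simp
  from mean_bound_imp_word[OF this] show ?thesis
    by (intro exI[of _ ?n]) auto
qed

end

text \<open>With the other argument fixed, the vectors of zero area form a subspace by subadditivity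
  and nonnegativity; basis vectors therefore suffice in each argument.\<close>

lemma area_images_eq_0:
  fixes R :: "complex ^ 'n::finite ^ 'n"
  assumes "\<And>i j. area (R *v axis i 1) (R *v axis j 1) = 0"
  shows "area (R *v x) (R *v y) = (0 :: real)"
proof -
  have vanish: "area (R *v x) z = 0" if z: "\<And>i. area (R *v axis i 1) z = 0" for x z
  proof -
    have sub: "vec.subspace {x. area (R *v x) z = 0}"
    proof (intro vec.subspaceI)
      fix x y assume "x \<in> {x. area (R *v x) z = 0}" "y \<in> {x. area (R *v x) z = 0}"
      then show "x + y \<in> {x. area (R *v x) z = 0}"
        using area_triangle_left[of "R *v x" "R *v y" z]
        by (simp add: matrix_vector_right_distrib order_antisym)
    next
      fix x c assume "x \<in> {x. area (R *v x) z = 0}"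
      then show "c *s x \<in> {x. area (R *v x) z = 0}"
        using area_smult[of c "R *v x" 1 z] by (simp add: matrix_vector_smult)
    qed simp
    have "(\<Sum>i\<in>UNIV. x $ i *s axis i 1) \<in> {x. area (R *v x) z = 0}"
      by (intro vec.subspace_sum[OF sub] vec.subspace_scale[OF sub]) (simp add: z)
    then show ?thesis by (simp add: basis_expansion)
  qed
  have "area (R *v axis i 1) (R *v y) = 0" for i
    by (subst area_commute) (rule vanish, rule assms)
  then show ?thesis by (rule vanish)
qed

section \<open>Rank-one limits of normalised words\<close>

context markov_measure
begin

text \<open>The matrices \<open>R m\<close> are words divided by their norms \<open>a m\<close>,
  which does not affect the projective action. In the limit all areas vanish, so the image is a line
  spanned by \<open>u\<close>, and the lower bound for |R m e|^2 keeps the linear form \<theta> from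
  vanishing at \<open>e\<close>.\<close>

lemma rank_one_limit:
  assumes "Pur \<mu>" "norm e = 1"
  obtains W R Rl n a u \<theta> where "\<And>m. W m \<in> words (n m)" "\<And>m. 1 \<le> n m" "\<And>m. a m \<noteq> 0"
    "\<And>m x. W m *v x = complex_of_real (a m) *s (R m *v x)" "R \<longlonglongrightarrow> Rl"
    "\<And>x. Rl *v x = \<theta> x *s u" "\<theta> e \<noteq> 0" "norm u = 1"
    "\<And>x y. \<theta> (x + y) = \<theta> x + \<theta> y" "\<And>c x. \<theta> (c *s x) = c * \<theta> x"
proof -
  define \<delta> where "\<delta> = 1 / (2 * real CARD('n))"
  have \<delta>: "\<delta> > 0" by (simp add: \<delta>_def)
  have "\<forall>m. \<exists>W n. W \<in> words n \<and> 1 \<le> n \<and> real m * (\<Sum>i\<in>UNIV. \<Sum>j\<in>UNIV. area (W *v axis i 1) (W *v axis j 1))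
      + \<delta> * (norm W)\<^sup>2 < (norm (W *v e))\<^sup>2"
    using almost_rank_one_word[OF assms] unfolding \<delta>_def by blast
  then obtain W n where W: "\<And>m. W m \<in> words (n m)" "\<And>m. 1 \<le> n m"
    "\<And>m. real m * (\<Sum>i\<in>UNIV. \<Sum>j\<in>UNIV. area (W m *v axis i 1) (W m *v axis j 1))
      + \<delta> * (norm (W m))\<^sup>2 < (norm (W m *v e))\<^sup>2"
    by metis
  have nz: "W m \<noteq> 0" for m using W(3)[of m] by auto
  define R where "R m = inverse (norm (W m)) *\<^sub>R W m" for m
  have scale: "W m *v x = complex_of_real (norm (W m)) *s (R m *v x)" for m x
  proof -
    have "W m = norm (W m) *\<^sub>R R m" using nz by (simp add: R_def)
    then have "W m *v x = norm (W m) *\<^sub>R (R m *v x)"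
      by (metis bounded_bilinear.scaleR_left[OF bounded_bilinear_matrix_vector])
    moreover have "t *\<^sub>R y = complex_of_real t *s y" for t and y :: "complex ^ 'n"
      unfolding vec_eq_iff vector_scaleR_component vector_smult_component
      by (simp only: scaleR_conv_of_real simp_thms)
    ultimately show ?thesis by simp
  qed
  have "R m \<in> sphere 0 1" for m using nz by (simp add: R_def)
  then obtain Rl r where r: "Rl \<in> sphere 0 1" "strict_mono (r :: nat \<Rightarrow> nat)" "(R \<circ> r) \<longlonglongrightarrow> Rl"
    using compact_sphere[of "0 :: complex ^ 'n ^ 'n" 1] unfolding compact_def by metis
  have lim: "(\<lambda>m. R (r m) *v x) \<longlonglongrightarrow> Rl *v x" for x
    using r(3) by (intro tendsto_intros) (simp add: o_def)
  have ineq: "real m * (\<Sum>i\<in>UNIV. \<Sum>j\<in>UNIV. area (R m *v axis i 1) (R m *v axis j 1)) + \<delta> < (norm (R m *v e))\<^sup>2" for m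
  proof -
    have "(norm (W m))\<^sup>2 * (real m * (\<Sum>i\<in>UNIV. \<Sum>j\<in>UNIV. area (R m *v axis i 1) (R m *v axis j 1)) + \<delta>)
       < (norm (W m))\<^sup>2 * (norm (R m *v e))\<^sup>2"
      using W(3)[of m] unfolding scale area_smult norm_cvector_smult
      by (simp add: sum_distrib_left power2_eq_square algebra_simps)
    then show ?thesis using nz[of m] by (simp add: mult_less_cancel_left_pos)
  qed
  have "\<delta> \<le> (norm (Rl *v e))\<^sup>2"
  proof (rule LIMSEQ_le_const[OF tendsto_power[OF tendsto_norm[OF lim]]])
    have "\<delta> \<le> (norm (R m *v e))\<^sup>2" for m
    proof -
      have "0 \<le> real m * (\<Sum>i\<in>UNIV. \<Sum>j\<in>UNIV. area (R m *v axis i 1) (R m *v axis j 1))"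
        by (intro mult_nonneg_nonneg sum_nonneg) auto
      then show ?thesis using ineq[of m] by linarith
    qed
    then show "\<exists>N. \<forall>m\<ge>N. \<delta> \<le> (norm (R (r m) *v e))\<^sup>2" by blast
  qed
  then have u0: "Rl *v e \<noteq> 0" using \<delta> by auto
  have "area (Rl *v axis i 1) (Rl *v axis j 1) = 0" for i j
  proof -
    have "area (R m *v axis i 1) (R m *v axis j 1) \<le> 1 / real m" if "m > 0" for m
    proof -
      have "area (R m *v axis i 1) (R m *v axis j 1) \<le> (\<Sum>j\<in>UNIV. area (R m *v axis i 1) (R m *v axis j 1))"
        by (rule member_le_sum) auto
      also have "\<dots> \<le> (\<Sum>i\<in>UNIV. \<Sum>j\<in>UNIV. area (R m *v axis i 1) (R m *v axis j 1))"
        by (rule member_le_sum) (auto intro!: sum_nonneg)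
      finally have "real m * area (R m *v axis i 1) (R m *v axis j 1)
          \<le> real m * (\<Sum>i\<in>UNIV. \<Sum>j\<in>UNIV. area (R m *v axis i 1) (R m *v axis j 1))"
        by (rule mult_left_mono) simp
      also have "\<dots> \<le> (norm (R m *v e))\<^sup>2" using ineq[of m] \<delta> by linarith
      also have "\<dots> \<le> 1"
        using norm_matrix_vector_le[of "R m" e] nz[of m] assms(2) by (simp add: R_def power_le_one)
      finally show ?thesis using that by (simp add: field_simps)
    qed
    then have "\<forall>\<^sub>F m in sequentially. area (R (r m) *v axis i 1) (R (r m) *v axis j 1) \<le> 1 / real (r m)"
      using seq_suble[OF r(2)] unfolding eventually_sequentially
      by (intro exI[of _ 1]) (metis less_le_trans less_one not_le)
    moreover have "(\<lambda>m. 1 / real (r m)) \<longlonglongrightarrow> 0"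
      using LIMSEQ_subseq_LIMSEQ[OF lim_1_over_n r(2)] by (simp add: o_def)
    ultimately have "area (Rl *v axis i 1) (Rl *v axis j 1) \<le> 0"
      by (intro tendsto_le[OF _ _ tendsto_area_form[OF area_form_area lim lim]]) auto
    then show ?thesis using area_nonneg order_antisym by blast
  qed
  then have area0: "area (Rl *v x) (Rl *v y) = 0" for x y
    by (rule area_images_eq_0)
  obtain u where u: "norm u = 1" "Rl *v e = complex_of_real (norm (Rl *v e)) *s u"
    using normalize_cvector[OF u0] .
  define \<theta> where "\<theta> x = cinner u (Rl *v x)" for x
  have "Rl *v x = \<theta> x *s u" for x
  proof -
    obtain c where "Rl *v x = c *s (Rl *v e)"
      using area_eq_0_imp[OF area0 u0] by blast
    then have c: "Rl *v x = (c * complex_of_real (norm (Rl *v e))) *s u"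
      by (metis u(2) vector_smult_assoc)
    then have "\<theta> x = c * complex_of_real (norm (Rl *v e))"
      by (simp add: \<theta>_def cinner_smult_right cinner_self u(1))
    with c show ?thesis by simp
  qed
  moreover have "\<theta> e \<noteq> 0"
    using calculation[of e] u0 by auto
  ultimately show ?thesis
    using r(3) nz u(1) scale W(1,2)
    by (intro that[where W = "W \<circ> r" and n = "n \<circ> r" and a = "\<lambda>m. norm (W (r m))" and R = "R \<circ> r"
          and Rl = Rl and \<theta> = \<theta> and u = u])
      (auto simp: \<theta>_def matrix_vector_right_distrib cinner_add_right matrix_vector_smult cinner_smult_right)
qed

end

lemma area_self [simp]: "area u u = 0"
  using area_power2[of u u] by (simp add: cinner_self norm_power)

text \<open>A rank-one matrix with u not in its kernel sends all nearby lines to the line of u.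
  Matrices close to it keep the norms of images bounded below near u while making all areas small,
  hence contract distances there.\<close>

lemma attracting_ball:
  fixes A :: "nat \<Rightarrow> complex ^ 'n::finite ^ 'n"
  assumes B: "\<And>x. B *v x = \<eta> x *s u" and u: "norm u = 1" "\<eta> u \<noteq> 0"
    and \<eta>: "\<And>x y. \<eta> (x + y) = \<eta> x + \<eta> y" "\<And>c x. \<eta> (c *s x) = c * \<eta> x"
    and lim: "A \<longlonglongrightarrow> B"
  obtains r M where "r > 0"
    "\<And>m x. m \<ge> M \<Longrightarrow> norm x = 1 \<Longrightarrow> dist (proj_class x) (proj_class u) \<le> r \<Longrightarrow>
      A m *v x \<noteq> 0 \<and> dist (proj_class (A m *v x)) (proj_class u) \<le> r"
    "\<And>m x y. m \<ge> M \<Longrightarrow> norm x = 1 \<Longrightarrow> dist (proj_class x) (proj_class u) \<le> r \<Longrightarrow>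
      norm y = 1 \<Longrightarrow> dist (proj_class y) (proj_class u) \<le> r \<Longrightarrow>
      dist (proj_class (A m *v x)) (proj_class (A m *v y)) \<le> 1 / 2 * dist (proj_class x) (proj_class y)"
proof -
  define \<tau> \<beta> where "\<tau> = cmod (\<eta> u)" and "\<beta> = norm B"
  have \<tau>: "\<tau> > 0" using u by (simp add: \<tau>_def)
  have nB: "norm (B *v x) = cmod (\<eta> x)" for x using u by (simp add: B norm_cvector_smult)
  have \<eta>_le: "cmod (\<eta> x) \<le> \<beta> * norm x" for x
    using norm_matrix_vector_le[of B x] by (simp add: nB \<beta>_def)
  have \<beta>: "\<tau> \<le> \<beta>" using \<eta>_le[of u] u by (simp add: \<tau>_def)
  then have \<beta>0: "\<beta> > 0" using \<tau> by linarith
  \<comment> \<open>Unit vectors of this ball are, up to a phase, within 2 r of \<open>u\<close>, so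
    \<eta> changes by at most 2 \<beta> r = \<tau>/2 and keeps modulus at least \<tau>/2.\<close>
  define r where "r = \<tau> / (4 * \<beta>)"
  have r: "r > 0" using \<tau> \<beta>0 by (simp add: r_def)
  \<comment> \<open>The three bounds ensure, in order, |A m x| \<ge> \<tau>/4, invariance of the
    ball, and the ratio 1/2: with equality in the last one, 3 \<beta> \<epsilon> is half of
    (\<tau>/4)^2.\<close>
  define \<epsilon> where "\<epsilon> = Min {\<tau> / 4, \<tau> * r / 4, \<tau> * \<tau> / (96 * \<beta>)}"
  have \<epsilon>: "\<epsilon> > 0" "\<epsilon> \<le> \<tau> / 4" "\<epsilon> \<le> \<tau> * r / 4" "\<epsilon> \<le> \<tau> * \<tau> / (96 * \<beta>)"
    using \<tau> \<beta>0 r by (simp_all add: \<epsilon>_def)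
  obtain M where M: "\<And>m. m \<ge> M \<Longrightarrow> norm (A m - B) < \<epsilon>"
    using LIMSEQ_D[OF lim \<epsilon>(1)] by blast
  have \<eta>_ge: "\<tau> / 2 \<le> cmod (\<eta> x)" if x: "norm x = 1" "dist (proj_class x) (proj_class u) \<le> r" for x
  proof -
    obtain c where c: "cmod c = 1" "norm (u - c *s x) \<le> sqrt 2 * dist (proj_class u) (proj_class x)"
      using optimal_phase[OF u(1) x(1)] .
    have "sqrt 2 \<le> 2" by (rule real_le_lsqrt) auto
    then have "sqrt 2 * dist (proj_class u) (proj_class x) \<le> 2 * r"
      using x(2) by (intro mult_mono) (auto simp: dist_commute)
    then have "cmod (\<eta> (u - c *s x)) \<le> \<beta> * (2 * r)"
      using c(2) \<beta>0 by (intro order_trans[OF \<eta>_le] mult_left_mono) auto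
    also have "\<dots> = \<tau> / 2" using \<beta>0 by (simp add: r_def)
    finally have "cmod (\<eta> (u - c *s x)) \<le> \<tau> / 2" .
    moreover have "\<eta> u = \<eta> (u - c *s x) + c * \<eta> x"
      using \<eta>(1)[of "u - c *s x" "c *s x"] \<eta>(2)[of c x] by simp
    then have "\<tau> \<le> cmod (\<eta> (u - c *s x)) + cmod (\<eta> x)"
      unfolding \<tau>_def using norm_triangle_ineq[of "\<eta> (u - c *s x)" "c * \<eta> x"] c(1) by (simp add: norm_mult)
    ultimately show ?thesis by linarith
  qed
  have diff: "norm (A m *v x - B *v x) \<le> \<epsilon> * norm x" if "m \<ge> M" for m x
  proof -
    have "norm ((A m - B) *v x) \<le> norm (A m - B) * norm x" by (rule norm_matrix_vector_le)
    also have "\<dots> \<le> \<epsilon> * norm x" using M[OF that] by (intro mult_right_mono) auto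
    finally show ?thesis by (simp add: matrix_vector_mult_diff_rdistrib)
  qed
  have A_ge: "\<tau> / 4 \<le> norm (A m *v x)"
    if "m \<ge> M" "norm x = 1" "dist (proj_class x) (proj_class u) \<le> r" for m x
    using \<eta>_ge[OF that(2,3)] diff[OF that(1), of x] that(2) \<epsilon>(2) nB[of x]
      norm_triangle_ineq2[of "B *v x" "A m *v x"] by (simp add: norm_minus_commute)
  have unz: "u \<noteq> 0" using u by auto
  have area_Bu: "area (B *v x) u = 0" for x
    using area_smult[of "\<eta> x" u 1 u] by (simp add: B)
  have area_BB: "area (B *v x) (B *v y) = 0" for x y
    using area_smult[of "\<eta> x" u "\<eta> y" u] by (simp add: B)
  have Anz: "A m *v x \<noteq> 0" if "m \<ge> M" "norm x = 1" "dist (proj_class x) (proj_class u) \<le> r" for m x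
    using A_ge[OF that] \<tau> by auto
  have inside: "dist (proj_class (A m *v x)) (proj_class u) \<le> r"
    if *: "m \<ge> M" "norm x = 1" "dist (proj_class x) (proj_class u) \<le> r" for m x
  proof -
    have "\<tau> / 4 * dist (proj_class (A m *v x)) (proj_class u) \<le> norm (A m *v x) * dist (proj_class (A m *v x)) (proj_class u)"
      by (intro mult_right_mono A_ge *) simp
    also have "\<dots> = area (A m *v x) u"
      using area_eq_dist[OF Anz[OF *] unz] u by simp
    also have "\<dots> \<le> area (A m *v x - B *v x) u + area (B *v x) u"
      using area_triangle_left[of "A m *v x - B *v x" "B *v x" u] by simp
    also have "\<dots> \<le> \<epsilon>"
      using area_le[of "A m *v x - B *v x" u] diff[OF *(1), of x] *(2) u by (simp add: area_Bu)
    also have "\<dots> \<le> \<tau> / 4 * r" using \<epsilon>(3) by simp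
    finally show ?thesis using \<tau> by (simp add: mult_le_cancel_left_pos)
  qed
  \<comment> \<open>The areas of pairs in the image of \<open>B\<close> vanish, so after splitting
    off \<open>B\<close> in both arguments only terms with a factor \<open>A m - B\<close>
    remain.\<close>
  have contract: "area (A m *v x) (A m *v y) \<le> (3 * \<beta> * \<epsilon>) * area x y" if m: "m \<ge> M" for m x y
  proof (rule alternating_le_area)
    show "area (A m *v x) (A m *v (b *s x + y)) = area (A m *v x) (A m *v y)" for x y b
      by (simp add: matrix_vector_right_distrib matrix_vector_smult area_shear)
    show "area (A m *v (a *s x)) (A m *v (b *s y)) = cmod a * cmod b * area (A m *v x) (A m *v y)" for x y a b
      by (simp add: matrix_vector_smult area_smult)
    fix x y :: "complex ^ 'n"
    assume xy: "norm x = 1" "norm y = 1"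
    have Bz: "norm (B *v z) \<le> \<beta>" if "norm z = 1" for z
      using \<eta>_le[of z] that by (simp add: nB)
    have Ay: "norm (A m *v y) \<le> 2 * \<beta>"
      using norm_triangle_ineq[of "A m *v y - B *v y" "B *v y"] diff[OF m, of y] xy Bz[of y] \<epsilon>(2) \<beta> \<tau> by simp
    have "area (A m *v x) (A m *v y) \<le> area (A m *v x - B *v x) (A m *v y) + area (B *v x) (A m *v y)"
      using area_triangle_left[of "A m *v x - B *v x" "B *v x" "A m *v y"] by simp
    also have "area (B *v x) (A m *v y) \<le> area (B *v x) (A m *v y - B *v y) + area (B *v x) (B *v y)"
      using area_triangle_right[of "B *v x" "A m *v y - B *v y" "B *v y"] by simp
    also have "area (A m *v x - B *v x) (A m *v y) \<le> \<epsilon> * (2 * \<beta>)"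
      using diff[OF m, of x] xy Ay \<epsilon>(1) by (intro order_trans[OF area_le] mult_mono) auto
    also have "area (B *v x) (A m *v y - B *v y) \<le> \<beta> * \<epsilon>"
      using diff[OF m, of y] xy Bz[of x] \<beta>0 by (intro order_trans[OF area_le] mult_mono) auto
    finally show "area (A m *v x) (A m *v y) \<le> 3 * \<beta> * \<epsilon>"
      by (simp add: area_BB algebra_simps)
  qed
  have half: "dist (proj_class (A m *v x)) (proj_class (A m *v y)) \<le> 1 / 2 * dist (proj_class x) (proj_class y)"
    if m: "m \<ge> M" and x: "norm x = 1" "dist (proj_class x) (proj_class u) \<le> r"
      and y: "norm y = 1" "dist (proj_class y) (proj_class u) \<le> r" for m x y
  proof -
    let ?D = "dist (proj_class (A m *v x)) (proj_class (A m *v y))" and ?d = "dist (proj_class x) (proj_class y)"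
    have nz: "x \<noteq> 0" "y \<noteq> 0" using x y by auto
    have "\<tau> / 4 * (\<tau> / 4) * ?D \<le> norm (A m *v x) * norm (A m *v y) * ?D"
      using \<tau> by (intro mult_right_mono mult_mono A_ge m x y) auto
    also have "\<dots> = area (A m *v x) (A m *v y)"
      using area_eq_dist[OF Anz[OF m x] Anz[OF m y]] by simp
    also have "\<dots> \<le> 3 * \<beta> * \<epsilon> * ?d"
      using contract[OF m, of x y] area_eq_dist[OF nz] x y by simp
    also have "\<dots> \<le> 3 * \<beta> * (\<tau> * \<tau> / (96 * \<beta>)) * ?d"
      using \<epsilon>(4) \<beta>0 by (intro mult_right_mono mult_left_mono) auto
    also have "\<dots> = \<tau> / 4 * (\<tau> / 4) * (1 / 2 * ?d)"
      using \<beta>0 by (simp add: field_simps)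
    finally show ?thesis
      using \<tau> mult_le_cancel_left_pos[of "\<tau> / 4 * (\<tau> / 4)" ?D "1 / 2 * ?d"] by simp
  qed
  show ?thesis using r that[of r M] Anz inside half by blast
qed

section \<open>A contracting word and its fixed point\<close>

context markov_measure
begin

text \<open>The contraction comes from a rank-one limit. Every point reaches the ball since some
  word moves it off the kernel of \<theta>, after which the words \<open>W m\<close> bring it near
  \<open>u\<close>.\<close>

lemma proximal_word:
  assumes "Pur \<mu>" "Erg \<mu>"
  obtains q U p0 B L where "1 \<le> q" "U \<in> words q" "p0 \<in> B" "proj_act U p0 = p0"
    "\<And>p. p \<in> B \<Longrightarrow> U *v unit_rep p \<noteq> 0 \<and> proj_act U p \<in> B \<and> dist (proj_act U p) p0 \<le> 1 / 2 * dist p p0"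
    "\<And>p. \<exists>l\<le>L. \<exists>V\<in>words l. V *v unit_rep p \<noteq> 0 \<and> proj_act V p \<in> B"
proof -
  obtain e where e: "norm e = 1"
    "\<And>E'. vec.subspace E' \<Longrightarrow> E' \<noteq> {0} \<Longrightarrow> (\<And>v x. v \<in> S \<Longrightarrow> x \<in> E' \<Longrightarrow> v *v x \<in> E') \<Longrightarrow> e \<in> E'"
    using Erg_common_vector[OF assms(2)] by blast
  obtain W R Rl n a u \<theta> where W: "\<And>m. W m \<in> words (n m)" "\<And>m. 1 \<le> n m" "\<And>m. a m \<noteq> 0"
    "\<And>m x. W m *v x = complex_of_real (a m) *s (R m *v x)" and R: "R \<longlonglongrightarrow> Rl"
    "\<And>x. Rl *v x = \<theta> x *s u" "\<theta> e \<noteq> 0" "norm u = 1"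
    and \<theta>: "\<And>x y. \<theta> (x + y) = \<theta> x + \<theta> y" "\<And>c x. \<theta> (c *s x) = c * \<theta> x"
    by (rule rank_one_limit[OF assms(1) e(1)]) (rule that; assumption)
  have unz: "u \<noteq> 0" using R(4) by auto
  have off: "\<exists>n. \<exists>V\<in>words n. \<theta> (V *v x) \<noteq> 0" if "x \<noteq> 0" for x
    by (rule word_off_hyperplane[where e = e and \<theta> = \<theta>, OF _ \<theta> R(3) that]) (rule e(2); blast)
  obtain l V where V: "V \<in> words l" "\<theta> (V *v u) \<noteq> 0"
    using off[OF unz] by blast
  \<comment> \<open>The form of the rank-one limit may vanish at \<open>u\<close> itself; applying
    \<open>V\<close> first replaces \<theta> by \<theta> composed with \<open>V\<close>, which does
    not.\<close>
  define A where "A m = R m ** V" for m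
  obtain r M where r: "r > 0"
    "\<And>m x. m \<ge> M \<Longrightarrow> norm x = 1 \<Longrightarrow> dist (proj_class x) (proj_class u) \<le> r \<Longrightarrow>
      A m *v x \<noteq> 0 \<and> dist (proj_class (A m *v x)) (proj_class u) \<le> r"
    "\<And>m x y. m \<ge> M \<Longrightarrow> norm x = 1 \<Longrightarrow> dist (proj_class x) (proj_class u) \<le> r \<Longrightarrow>
      norm y = 1 \<Longrightarrow> dist (proj_class y) (proj_class u) \<le> r \<Longrightarrow>
      dist (proj_class (A m *v x)) (proj_class (A m *v y)) \<le> 1 / 2 * dist (proj_class x) (proj_class y)"
  proof (rule attracting_ball[where B = "Rl ** V" and \<eta> = "\<lambda>x. \<theta> (V *v x)" and u = u and A = A])
    show "(Rl ** V) *v x = \<theta> (V *v x) *s u" for x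
      by (simp add: R(2) flip: matrix_vector_mul_assoc)
    show "A \<longlonglongrightarrow> Rl ** V"
      unfolding A_def by (intro bounded_bilinear.tendsto[OF bounded_bilinear_matrix_mult] R(1)) simp
  qed (use R(4) V(2) \<theta> in \<open>simp_all add: matrix_vector_right_distrib matrix_vector_smult\<close>, blast)
  let ?U = "W M ** V" and ?c = "proj_class u"
  define B where "B = cball ?c r"
  have U: "?U *v x = complex_of_real (a M) *s (A M *v x)" for x
    unfolding A_def by (simp add: W(4) flip: matrix_vector_mul_assoc)
  have U_nz: "?U *v unit_rep p \<noteq> 0" and U_act: "proj_act ?U p = proj_class (A M *v unit_rep p)" if "p \<in> B" for p
  proof -
    have "dist (proj_class (unit_rep p)) ?c \<le> r" using that by (simp add: B_def dist_commute)
    then have *: "A M *v unit_rep p \<noteq> 0" using r(2)[of M "unit_rep p"] by simp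
    then show "?U *v unit_rep p \<noteq> 0" using W(3) by (simp add: U)
    show "proj_act ?U p = proj_class (A M *v unit_rep p)"
      unfolding proj_act_def U using * W(3) by (intro proj_class_smult) auto
  qed
  have U_in: "proj_act ?U p \<in> B" if "p \<in> B" for p
    using r(2)[of M "unit_rep p"] that by (simp add: U_act[OF that]) (simp add: B_def dist_commute)
  have U_half: "dist (proj_act ?U p) (proj_act ?U p') \<le> 1 / 2 * dist p p'" if "p \<in> B" "p' \<in> B" for p p'
    using r(3)[of M "unit_rep p" "unit_rep p'"] that by (simp add: U_act) (simp add: B_def dist_commute)
  have "complete B"
    using compact_Int_closed[OF compact_UNIV_cproj closed_cball, of ?c r]
    by (simp add: B_def compact_imp_complete)
  then have "\<exists>!p\<in>B. proj_act ?U p = p"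
  proof (rule Banach_fix[where c = "1 / 2"])
    show "B \<noteq> {}" using r(1) by (auto simp: B_def)
    show "proj_act ?U ` B \<subseteq> B" using U_in by blast
    show "dist (proj_act ?U p) (proj_act ?U p') \<le> 1 / 2 * dist p p'" if "p \<in> B" "p' \<in> B" for p p'
      using U_half that by blast
  qed auto
  then obtain p0 where p0: "p0 \<in> B" "proj_act ?U p0 = p0" by blast
  have reach: "\<exists>l. \<exists>V\<in>words l. V *v x \<noteq> 0 \<and> proj_class (V *v x) \<in> ball ?c r" if x: "x \<noteq> 0" for x
  proof -
    obtain l V where V: "V \<in> words l" "\<theta> (V *v x) \<noteq> 0"
      using off[OF x] by blast
    have nz: "Rl *v (V *v x) \<noteq> 0" using V(2) unz by (simp add: R(2))
    have "open (- {0} \<inter> proj_class -` ball ?c r)"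
      by (rule continuous_open_preimage[OF continuous_on_proj_class]) auto
    moreover have "proj_class (Rl *v (V *v x)) = ?c"
      using V(2) unz by (simp add: R(2) proj_class_smult)
    then have "Rl *v (V *v x) \<in> - {0} \<inter> proj_class -` ball ?c r"
      using nz r(1) by simp
    moreover have "(\<lambda>m. R m *v (V *v x)) \<longlonglongrightarrow> Rl *v (V *v x)"
      by (intro tendsto_intros R(1))
    ultimately have "\<forall>\<^sub>F m in sequentially. R m *v (V *v x) \<in> - {0} \<inter> proj_class -` ball ?c r"
      using topological_tendstoD by blast
    then obtain m where m: "R m *v (V *v x) \<in> - {0} \<inter> proj_class -` ball ?c r"
      unfolding eventually_sequentially by blast
    have eq: "(W m ** V) *v x = complex_of_real (a m) *s (R m *v (V *v x))"
      by (simp add: W(4) flip: matrix_vector_mul_assoc)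
    have "W m ** V \<in> words (n m + l)" by (intro words_mult W V)
    moreover have "(W m ** V) *v x \<noteq> 0 \<and> proj_class ((W m ** V) *v x) \<in> ball ?c r"
      using m W(3)[of m] unfolding eq by (simp add: proj_class_smult)
    ultimately show ?thesis by blast
  qed
  \<comment> \<open>The vectors which some word of length \<open>l\<close> moves into the open ball.
    These sets are open and cover the sphere; a finite subcover bounds the lengths needed.\<close>
  define O' where "O' l = (\<Union>V\<in>words l. (\<lambda>x. V *v x) -` (- {0} \<inter> proj_class -` ball ?c r))" for l
  have open_O: "open (O' l)" for l
    unfolding O'_def
  proof (intro open_UN ballI open_vimage)
    show "open (- {0} \<inter> proj_class -` ball ?c r)"
      by (rule continuous_open_preimage[OF continuous_on_proj_class]) auto
    show "continuous_on UNIV (\<lambda>x. V *v x)" for V :: "complex ^ 'n ^ 'n"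
      by (intro continuous_intros)
  qed
  have cover: "sphere 0 1 \<subseteq> (\<Union>l\<in>UNIV. O' l)"
  proof
    fix x :: "complex ^ 'n" assume "x \<in> sphere 0 1"
    then have "x \<noteq> 0" by auto
    then show "x \<in> (\<Union>l\<in>UNIV. O' l)" using reach[of x] by (auto simp: O'_def)
  qed
  obtain C where "C \<subseteq> UNIV" and C: "finite C" "sphere 0 1 \<subseteq> (\<Union>l\<in>C. O' l)"
    by (rule compactE_image[OF compact_sphere open_O cover])
  have returns: "\<exists>l\<le>Max C. \<exists>V\<in>words l. V *v unit_rep p \<noteq> 0 \<and> proj_act V p \<in> B" for p
  proof -
    have "unit_rep p \<in> sphere 0 1" by simp
    then obtain l where l: "l \<in> C" "unit_rep p \<in> O' l" using C(2) by blast
    then have "l \<le> Max C" using C(1) by simp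
    then show ?thesis using l(2) unfolding O'_def B_def proj_act_def by force
  qed
  have len: "1 \<le> n M + l" using W(2)[of M] by linarith
  have ball: "?U *v unit_rep p \<noteq> 0 \<and> proj_act ?U p \<in> B \<and> dist (proj_act ?U p) p0 \<le> 1 / 2 * dist p p0"
    if "p \<in> B" for p
    using U_nz[OF that] U_in[OF that] U_half[OF that p0(1)] p0(2) by simp
  show ?thesis
    by (rule that[OF len words_mult[OF W(1) V(1)] p0 ball returns])
qed

text \<open>After \<open>l\<close> letters the ball is entered, where the distance to
  \<open>p0\<close> is at most 1; each of the \<open>s\<close> further copies of \<open>U\<close>
  halves it. The residue of \<open>l\<close> modulo \<open>q\<close> is not controlled, only its
  size.\<close>

lemma attracting_point:
  assumes "Pur \<mu>" "Erg \<mu>"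
  obtains q L p0 where "1 \<le> q"
    "\<And>s p. \<exists>l\<le>L. \<exists>W\<in>words (l + q * s). W *v unit_rep p \<noteq> 0 \<and> dist (proj_act W p) p0 \<le> (1 / 2) ^ s"
    "\<And>t. \<exists>W\<in>words (q * t). W *v unit_rep p0 \<noteq> 0 \<and> proj_act W p0 = p0"
proof -
  obtain q U p0 B L where U: "1 \<le> q" "U \<in> words q" "p0 \<in> B" "proj_act U p0 = p0"
    "\<And>p. p \<in> B \<Longrightarrow> U *v unit_rep p \<noteq> 0 \<and> proj_act U p \<in> B \<and> dist (proj_act U p) p0 \<le> 1 / 2 * dist p p0"
    "\<And>p. \<exists>l\<le>L. \<exists>V\<in>words l. V *v unit_rep p \<noteq> 0 \<and> proj_act V p \<in> B"
    by (rule proximal_word[OF assms]) (rule that; assumption)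
  have power: "\<exists>W\<in>words (l + q * s). W *v unit_rep p \<noteq> 0 \<and> proj_act W p \<in> B \<and> dist (proj_act W p) p0 \<le> (1 / 2) ^ s"
    if V: "V \<in> words l" "V *v unit_rep p \<noteq> 0" "proj_act V p \<in> B" for V l p s
  proof (induction s)
    case 0
    then show ?case using V by (auto intro!: bexI[of _ V] dist_cproj_le_1)
  next
    case (Suc s)
    then obtain W where W: "W \<in> words (l + q * s)" "W *v unit_rep p \<noteq> 0" "proj_act W p \<in> B"
      "dist (proj_act W p) p0 \<le> (1 / 2) ^ s" by blast
    have "U ** W \<in> words (q + (l + q * s))" by (intro words_mult U W)
    moreover have "q + (l + q * s) = l + q * Suc s" by simp
    ultimately have "U ** W \<in> words (l + q * Suc s)" by metis
    moreover have "(U ** W) *v unit_rep p \<noteq> 0" "proj_act (U ** W) p \<in> B"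
      using U(5)[OF W(3)] by (simp_all add: proj_act_mult[OF W(2)])
    moreover have "dist (proj_act (U ** W) p) p0 \<le> (1 / 2) ^ Suc s"
    proof -
      have "dist (proj_act (U ** W) p) p0 \<le> 1 / 2 * dist (proj_act W p) p0"
        using U(5)[OF W(3)] by (simp add: proj_act_mult(2)[OF W(2)])
      with W(4) show ?thesis by simp
    qed
    ultimately show ?case by blast
  qed
  have "\<exists>l\<le>L. \<exists>W\<in>words (l + q * s). W *v unit_rep p \<noteq> 0 \<and> dist (proj_act W p) p0 \<le> (1 / 2) ^ s" for s p
    using U(6)[of p] power by blast
  moreover have "\<exists>W\<in>words (q * t). W *v unit_rep p0 \<noteq> 0 \<and> proj_act W p0 = p0" for t
  proof (induction t)
    case 0
    show ?case by (simp add: proj_act_def)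
  next
    case (Suc t)
    then obtain W where W: "W \<in> words (q * t)" "W *v unit_rep p0 \<noteq> 0" "proj_act W p0 = p0" by blast
    have "U ** W \<in> words (q * Suc t)" using words_mult[OF U(2) W(1)] by simp
    moreover have "(U ** W) *v unit_rep p0 \<noteq> 0" "proj_act (U ** W) p0 = p0"
      using U(5)[OF U(3)] U(4) W(3) by (simp_all add: proj_act_mult[OF W(2)])
    ultimately show ?case by blast
  qed
  ultimately show ?thesis using that U(1) by blast
qed

end

section \<open>Asymptotic periodicity\<close>

definition sup_norm :: "('n::finite cproj \<Rightarrow> complex) \<Rightarrow> real" where
  "sup_norm f = (SUP p. cmod (f p))"

lemma sup_norm_attained:
  assumes "continuous_on UNIV f"
  obtains p where "cmod (f p) = sup_norm f" "\<And>p. cmod (f p) \<le> sup_norm f"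
proof -
  have "continuous_on UNIV (\<lambda>p. cmod (f p))" by (intro continuous_intros assms)
  then obtain p where p: "\<And>q. cmod (f q) \<le> cmod (f p)"
    using continuous_attains_sup[OF compact_UNIV_cproj, of "\<lambda>p. cmod (f p)"] by auto
  then have "sup_norm f = cmod (f p)"
    unfolding sup_norm_def by (intro cSup_eq_maximum) auto
  then show ?thesis using that p by simp
qed

lemma cmod_le_sup_norm: "continuous_on UNIV f \<Longrightarrow> cmod (f p) \<le> sup_norm f"
  using sup_norm_attained by metis

lemma sup_norm_leI: "(\<And>p. cmod (f p) \<le> s) \<Longrightarrow> sup_norm f \<le> s"
  unfolding sup_norm_def by (rule cSUP_least) auto

lemma sup_norm_nonneg: "continuous_on UNIV f \<Longrightarrow> 0 \<le> sup_norm f"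
  using cmod_le_sup_norm norm_ge_zero order_trans by blast

lemma sup_norm_diff_le:
  assumes "continuous_on UNIV f" "continuous_on UNIV g" "\<And>p. cmod (f p - g p) \<le> e"
  shows "\<bar>sup_norm f - sup_norm g\<bar> \<le> e"
proof -
  have "cmod (f p) \<le> sup_norm g + e" for p
    using cmod_le_sup_norm[OF assms(2), of p] assms(3)[of p] norm_triangle_ineq2[of "f p" "g p"] by linarith
  moreover have "cmod (g p) \<le> sup_norm f + e" for p
    using cmod_le_sup_norm[OF assms(1), of p] assms(3)[of p] norm_triangle_ineq2[of "g p" "f p"]
    by (simp add: norm_minus_commute)
  ultimately have "sup_norm f \<le> sup_norm g + e" "sup_norm g \<le> sup_norm f + e"
    by (auto intro: sup_norm_leI)
  then show ?thesis by linarith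
qed

text \<open>The conditions on \<open>p0\<close> record all that the sequel needs from (Erg): it is
  approached from everywhere with a bounded excess \<open>l\<close>, and it is fixed by some word of
  every length divisible by \<open>q\<close>.\<close>

locale proximal_markov = markov_measure \<mu> for \<mu> :: "(complex ^ 'n::finite ^ 'n) measure" +
  fixes q L :: nat and p0 :: "'n cproj"
  assumes Pur: "Pur \<mu>" and q_pos: "1 \<le> q"
    and returns: "\<exists>l\<le>L. \<exists>W\<in>words (l + q * s). W *v unit_rep p \<noteq> 0 \<and> dist (proj_act W p) p0 \<le> (1 / 2) ^ s"
    and fixed: "\<exists>W\<in>words (q * t). W *v unit_rep p0 \<noteq> 0 \<and> proj_act W p0 = p0"
begin

text \<open>Otherwise all the functions T^j f with j \<le> L stay below \<open>c\<close> in modulus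
  on one neighbourhood of \<open>p0\<close>. A long word leads from a maximiser of a late iterate
  into this neighbourhood and, being deterministic, transports the value of modulus \<open>c\<close>
  there.\<close>

lemma peak_at_p0:
  assumes f: "f \<in> holder \<alpha>" and \<alpha>: "0 < \<alpha>" "\<alpha> \<le> 1" and norm: "\<And>n. sup_norm ((T ^^ n) f) = c"
  shows "\<exists>j\<le>L. cmod ((T ^^ j) f p0) = c"
proof (rule ccontr)
  note cont = holder_continuous[OF markov_power_holder[OF f \<alpha>] \<alpha>(1)]
  assume no: "\<not> ?thesis"
  have "\<forall>j\<in>{..L}. \<forall>\<^sub>F p in nhds p0. cmod ((T ^^ j) f p) < c"
  proof
    fix j assume "j \<in> {..L}"
    then have lt: "cmod ((T ^^ j) f p0) < c"
      using no cmod_le_sup_norm[OF cont[of j], of p0] norm[of j] by (auto simp: order_less_le)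
    have "isCont (\<lambda>p. cmod ((T ^^ j) f p)) p0"
      using cont[of j] by (intro continuous_intros) (simp add: continuous_on_eq_continuous_at)
    then have "((\<lambda>p. cmod ((T ^^ j) f p)) \<longlongrightarrow> cmod ((T ^^ j) f p0)) (nhds p0)"
      using tendsto_at_iff_tendsto_nhds isContD by blast
    then show "\<forall>\<^sub>F p in nhds p0. cmod ((T ^^ j) f p) < c"
      by (rule order_tendstoD) (rule lt)
  qed
  then have "\<forall>\<^sub>F p in nhds p0. \<forall>j\<in>{..L}. cmod ((T ^^ j) f p) < c"
    by (intro eventually_ball_finite) auto
  then obtain d where d: "d > 0" "\<And>p j. dist p p0 < d \<Longrightarrow> j \<le> L \<Longrightarrow> cmod ((T ^^ j) f p) < c"
    unfolding eventually_nhds_metric by auto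
  obtain s where s: "(1 / 2 :: real) ^ s < d"
    using real_arch_pow_inv[OF d(1), of "1 / 2"] by auto
  obtain p where p: "cmod ((T ^^ (L + q * s)) f p) = c"
    using sup_norm_attained[OF cont[of "L + q * s"]] norm by metis
  obtain l W where W: "l \<le> L" "W \<in> words (l + q * s)" "W *v unit_rep p \<noteq> 0"
    "dist (proj_act W p) p0 \<le> (1 / 2) ^ s"
    using returns[of s p] by blast
  \<comment> \<open>The unknown excess \<open>l\<close> is absorbed by splitting the time L + q s as
    (l + q s) + (L - l), which leaves an iterate of order at most L.\<close>
  let ?g = "(T ^^ (L - l)) f"
  have pow: "(T ^^ (l + q * s)) ?g = (T ^^ (L + q * s)) f"
  proof -
    have "(l + q * s) + (L - l) = L + q * s" using W(1) by simp
    then show ?thesis by (metis comp_apply funpow_add)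
  qed
  have "?g (proj_act W p) = (T ^^ (l + q * s)) ?g p"
    using p W cmod_le_sup_norm[OF cont[of "L - l"]] norm[of "L - l"]
    by (intro deterministic_word[where c = c, OF markov_power_holder[OF f \<alpha>] \<alpha>]) (auto simp: pow)
  then have "cmod (?g (proj_act W p)) = c" using p pow by simp
  moreover have "cmod (?g (proj_act W p)) < c"
    using W(4) s by (intro d(2)) auto
  ultimately show False by simp
qed

text \<open>A function \<open>h - T\<^sup>q h\<close> whose powers keep their norm \<open>c\<close> would be constant of modulus \<open>c\<close>
  along arbitrarily long pieces of the backward orbit of the fixed point, but its sums telescope.\<close>

lemma coboundary_norm_eq_0:
  assumes h: "h \<in> holder \<alpha>" and \<alpha>: "0 < \<alpha>" "\<alpha> \<le> 1"
    and g: "g = (\<lambda>p. h p - (T ^^ q) h p)" and norm: "\<And>n. sup_norm ((T ^^ n) g) = c"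
  shows "c = 0"
proof -
  have gh: "g \<in> holder \<alpha>" unfolding g by (intro holder_diff h markov_power_holder \<alpha>)
  note cont = holder_continuous[OF markov_power_holder[OF gh \<alpha>] \<alpha>(1)]
  obtain s where s: "\<And>p. cmod (h p) \<le> s" "0 \<le> s"
    using holder_normE[OF h \<alpha>(1)] by metis
  have c0: "0 \<le> c" using sup_norm_nonneg[OF cont[of 0]] norm[of 0] by simp
  have bound: "c * real t \<le> 2 * s" for t
  proof -
    have "\<exists>j\<le>L. cmod ((T ^^ j) ((T ^^ (q * t)) g) p0) = c"
    proof (rule peak_at_p0[OF markov_power_holder[OF gh \<alpha>] \<alpha>])
      show "sup_norm ((T ^^ n) ((T ^^ (q * t)) g)) = c" for n
        using norm[of "n + q * t"] by (simp add: funpow_add)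
    qed
    then obtain j where j: "cmod ((T ^^ (j + q * t)) g p0) = c" by (auto simp: funpow_add)
    define n where "n = j + q * t"
    \<comment> \<open>Only word lengths divisible by \<open>q\<close> are known to fix
      \<open>p0\<close>, so the backward orbit is followed inside the residue class of
      \<open>n\<close>; its number of steps \<open>m\<close> is at least \<open>t\<close>.\<close>
    define m r where "m = n div q" and "r = n mod q"
    have n: "n = r + q * m" by (simp add: m_def r_def)
    have "q * t div q \<le> m" unfolding m_def n_def by (intro div_le_mono) simp
    then have m: "t \<le> m" using q_pos by simp
    have const: "(T ^^ (r + q * i)) g p0 = (T ^^ n) g p0" if "i \<le> m" for i
    proof -
      let ?g = "(T ^^ (r + q * i)) g"
      have "q * (m - i) + (r + q * i) = n" using that by (simp add: n algebra_simps flip: distrib_left)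
      then have pow: "(T ^^ (q * (m - i))) ?g = (T ^^ n) g"
        by (metis funpow_add comp_apply)
      obtain W where W: "W \<in> words (q * (m - i))" "W *v unit_rep p0 \<noteq> 0" "proj_act W p0 = p0"
        using fixed by blast
      have "?g (proj_act W p0) = (T ^^ (q * (m - i))) ?g p0"
        using W j cmod_le_sup_norm[OF cont[of "r + q * i"]] norm[of "r + q * i"]
        by (intro deterministic_word[where c = c, OF markov_power_holder[OF gh \<alpha>] \<alpha>]) (auto simp: pow n_def)
      then show ?thesis using W(3) pow by simp
    qed
    have step: "(T ^^ k) g p0 = (T ^^ k) h p0 - (T ^^ (k + q)) h p0" for k
      unfolding g markov_power_diff[OF h markov_power_holder[OF h \<alpha>] \<alpha>] by (simp add: funpow_add)
    \<comment> \<open>All summands equal the same number of modulus \<open>c\<close>, so the sum has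
      modulus m c; telescoping bounds it by 2 s independently of \<open>t\<close>.\<close>
    have "(\<Sum>i<m. (T ^^ (r + q * i)) g p0) = (\<Sum>i<m. (T ^^ (r + q * i)) h p0 - (T ^^ (r + q * Suc i)) h p0)"
      by (intro sum.cong refl) (simp add: step add_ac)
    also have "\<dots> = (T ^^ (r + q * 0)) h p0 - (T ^^ (r + q * m)) h p0"
      by (rule sum_lessThan_telescope')
    also have "\<dots> = (T ^^ r) h p0 - (T ^^ n) h p0"
      by (simp add: n)
    also have "(\<Sum>i<m. (T ^^ (r + q * i)) g p0) = (\<Sum>i<m. (T ^^ n) g p0)"
      by (intro sum.cong refl const) simp
    finally have "of_nat m * (T ^^ n) g p0 = (T ^^ r) h p0 - (T ^^ n) h p0"
      by simp
    then have "real m * c = cmod ((T ^^ r) h p0 - (T ^^ n) h p0)"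
      using j by (metis n_def norm_mult norm_of_nat)
    also have "\<dots> \<le> s + s"
      by (intro order_trans[OF norm_triangle_ineq4] add_mono cmod_markov_power_le[OF h \<alpha>] s)
    finally have "c * real m \<le> 2 * s" by (simp add: mult.commute)
    moreover have "c * real t \<le> c * real m" using m c0 by (intro mult_left_mono) auto
    ultimately show ?thesis by linarith
  qed
  show ?thesis
  proof (rule ccontr)
    assume "c \<noteq> 0"
    then have c: "c > 0" using c0 by simp
    obtain t where "2 * s / c < real t" using reals_Archimedean2 by blast
    then show False using bound[of t] c by (simp add: field_simps)
  qed
qed

definition vanishing :: "('n cproj \<Rightarrow> complex) \<Rightarrow> bool" where
  "vanishing f \<longleftrightarrow> (\<forall>e>0. \<exists>N. \<forall>n\<ge>N. \<forall>p. cmod ((T ^^ n) f p) \<le> e)"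

text \<open>One time at which the iterate is small suffices, because the supremum norm never
  increases afterwards.\<close>

lemma vanishingI:
  assumes "f \<in> holder \<alpha>" "0 < \<alpha>" "\<alpha> \<le> 1" "\<And>e. 0 < e \<Longrightarrow> \<exists>n. \<forall>p. cmod ((T ^^ n) f p) \<le> e"
  shows "vanishing f"
  unfolding vanishing_def
proof (intro allI impI)
  fix e :: real assume "e > 0"
  then obtain N where N: "\<And>p. cmod ((T ^^ N) f p) \<le> e" using assms(4) by blast
  show "\<exists>N. \<forall>n\<ge>N. \<forall>p. cmod ((T ^^ n) f p) \<le> e"
  proof (intro exI[of _ N] allI impI)
    fix n p assume "N \<le> n"
    then have "(T ^^ n) f = (T ^^ (n - N)) ((T ^^ N) f)"
      by (metis comp_apply funpow_add le_add_diff_inverse2)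
    then show "cmod ((T ^^ n) f p) \<le> e"
      using cmod_markov_power_le[OF markov_power_holder[OF assms(1-3)] assms(2,3) N] by simp
  qed
qed

text \<open>Exponent 1 makes the space independent of \<alpha>. Nothing is lost, since the limit
  points constructed below are Lipschitz.\<close>

definition periodic :: "('n cproj \<Rightarrow> complex) set" where
  "periodic = {f \<in> holder 1. (T ^^ q) f = f}"

lemma funpow_fixed:
  assumes "(T ^^ k) f = f"
  shows "(T ^^ (k * n)) f = f"
  by (induction n) (simp_all add: assms funpow_add)

text \<open>A limit point \<open>l\<close> of T^(q i) f is taken by compactness. The coboundary of
  \<open>l\<close> has iterates of constant norm, so it vanishes and \<open>l\<close> is periodic; a
  single time at which the orbit is close to \<open>l\<close> then controls all later times.\<close>

lemma asymptotically_periodic: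
  assumes f: "f \<in> holder \<alpha>" and \<alpha>: "0 < \<alpha>" "\<alpha> \<le> 1"
  obtains l where "l \<in> periodic" "vanishing (\<lambda>p. f p - l p)"
proof -
  obtain s m where sm: "holder_const \<alpha> m f" "\<And>p. cmod (f p) \<le> s" "0 \<le> s" "0 \<le> m"
    using holder_normE[OF f \<alpha>(1)] by metis
  define F where "F i = (T ^^ (q * i)) f" for i
  obtain l r where r: "strict_mono (r :: nat \<Rightarrow> nat)" "uniform_limit UNIV (\<lambda>i. F (r i)) l sequentially"
    "holder_const \<alpha> (2 * m + s * (2 * sqrt 2)) l" "\<And>p. cmod (l p) \<le> s"
  proof (rule holder_compactness[of \<alpha> "2 * m + s * (2 * sqrt 2)" F s])
    show "holder_const \<alpha> (2 * m + s * (2 * sqrt 2)) (F n)" for n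
      unfolding F_def by (rule markov_power_holder_const[OF sm(1,2) \<alpha>])
    show "cmod (F n p) \<le> s" for n p
      unfolding F_def by (rule cmod_markov_power_le[OF f \<alpha> sm(2)])
  qed (use \<alpha> in auto)
  have close: "\<exists>N. \<forall>i\<ge>N. \<forall>p. cmod (F (r i) p - l p) < e" if "e > 0" for e
    using r(2) that unfolding uniform_limit_iff eventually_sequentially dist_norm by blast
  have lim: "(\<lambda>i. F (r i) p) \<longlonglongrightarrow> l p" for p
    by (rule tendsto_uniform_limitI[OF r(2)]) simp
  have large: "\<exists>i\<ge>M. K \<le> q * r i" for K M :: nat
  proof (intro exI[of _ "max K M"] conjI)
    have "K \<le> max K M" by simp
    also have "\<dots> \<le> r (max K M)" by (rule seq_suble[OF r(1)])
    also have "\<dots> \<le> q * r (max K M)" using q_pos by simp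
    finally show "K \<le> q * r (max K M)" .
  qed simp
  have lh: "l \<in> holder \<alpha>" using r(3) mem_holder_iff by blast
  \<comment> \<open>In the Lasota-Yorke inequality the Hoelder term carries an arbitrarily small
    factor for late iterates; in the limit only the term linear in the distance survives.\<close>
  have "holder_const 1 (s * (2 * sqrt 2)) l"
    unfolding holder_const_def
  proof (intro conjI allI)
    show "0 \<le> s * (2 * sqrt 2)" using sm by simp
    fix p p' :: "'n cproj"
    let ?d = "dist p p'"
    have "cmod (l p - l p') \<le> s * (2 * sqrt 2) * ?d + e" if e: "e > 0" for e
    proof -
      \<comment> \<open>Makes the Hoelder term at most \<open>e\<close>; the added 1 keeps the
        denominator positive.\<close>
      define \<epsilon> where "\<epsilon> = e / (m * ?d powr \<alpha> + 1)"
      have pos: "m * ?d powr \<alpha> + 1 > 0" using sm(4) by (simp add: add_nonneg_pos)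
      then have \<epsilon>: "\<epsilon> > 0" using e by (simp add: \<epsilon>_def)
      have "\<epsilon> * (m * ?d powr \<alpha>) \<le> \<epsilon> * (m * ?d powr \<alpha> + 1)" using \<epsilon> by (intro mult_left_mono) auto
      also have "\<dots> = e" using pos by (simp add: \<epsilon>_def)
      finally have le_e: "\<epsilon> * (m * ?d powr \<alpha>) \<le> e" .
      obtain N where N: "\<And>n. n \<ge> N \<Longrightarrow> cmod ((T ^^ n) f p - (T ^^ n) f p') \<le> \<epsilon> * m * ?d powr \<alpha> + s * (2 * sqrt 2 * ?d)"
        using Lasota_Yorke[OF Pur \<alpha> \<epsilon>] sm(1,2) by blast
      have ev: "cmod (F (r i) p - F (r i) p') \<le> s * (2 * sqrt 2) * ?d + e" if "i \<ge> N" for i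
      proof -
        have "N \<le> q * r i" using that seq_suble[OF r(1), of i] q_pos
          by (metis le_trans mult_le_mono1 nat_mult_1)
        from N[OF this] le_e show ?thesis by (simp add: F_def mult.assoc)
      qed
      show ?thesis
        by (rule LIMSEQ_le_const2[OF tendsto_norm[OF tendsto_diff[OF lim lim]]]) (use ev in blast)
    qed
    then show "cmod (l p - l p') \<le> s * (2 * sqrt 2) * dist p p' powr 1"
      by simp (rule field_le_epsilon)
  qed
  then have l1: "l \<in> holder 1" using mem_holder_iff by blast
  define h where "h = (\<lambda>p. f p - (T ^^ q) f p)"
  define g where "g = (\<lambda>p. l p - (T ^^ q) l p)"
  have hh: "h \<in> holder \<alpha>" and gh: "g \<in> holder \<alpha>"
    unfolding h_def g_def by (intro holder_diff f lh markov_power_holder \<alpha>)+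
  note cont = holder_continuous[OF markov_power_holder[OF _ \<alpha>] \<alpha>(1)]
  let ?a = "\<lambda>n. sup_norm ((T ^^ n) h)"
  have "?a (Suc n) \<le> ?a n" for n
    using cmod_markov_le[OF cont[OF hh] cmod_le_sup_norm[OF cont[OF hh]]] by (auto intro: sup_norm_leI)
  then have "decseq ?a" by (rule decseq_SucI)
  moreover have "0 \<le> ?a n" for n by (rule sup_norm_nonneg[OF cont[OF hh]])
  ultimately obtain c where c: "?a \<longlonglongrightarrow> c"
    using decseq_convergent[of ?a 0] by metis
  \<comment> \<open>T^n g is a uniform limit of the functions T^(n + q r_i) h, whose norms form a
    subsequence of a decreasing sequence with limit \<open>c\<close>. The limit is thus the same for
    every \<open>n\<close>.\<close>
  have norm_g: "sup_norm ((T ^^ n) g) = c" for n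
  proof -
    have "\<exists>N. \<forall>i\<ge>N. \<bar>?a (n + q * r i) - sup_norm ((T ^^ n) g)\<bar> \<le> e" if e: "e > 0" for e
    proof -
      obtain N where N: "\<And>i p. i \<ge> N \<Longrightarrow> cmod (F (r i) p - l p) \<le> e / 2"
        using close[of "e / 2"] e by (metis half_gt_zero less_imp_le)
      have "\<bar>?a (n + q * r i) - sup_norm ((T ^^ n) g)\<bar> \<le> e" if "i \<ge> N" for i
      proof (rule sup_norm_diff_le[OF cont[OF hh] cont[OF gh]])
        fix p
        define w where "w = (\<lambda>p. F (r i) p - l p)"
        have Fh: "F (r i) \<in> holder \<alpha>" unfolding F_def by (rule markov_power_holder[OF f \<alpha>])
        have wh: "w \<in> holder \<alpha>" unfolding w_def by (intro holder_diff Fh lh)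
        have w: "cmod ((T ^^ k) w p) \<le> e / 2" for k p
          by (rule cmod_markov_power_le[OF wh \<alpha>]) (use N[OF that] in \<open>simp add: w_def\<close>)
        have "(T ^^ (n + q * r i)) h p = (T ^^ n) (F (r i)) p - (T ^^ (n + q)) (F (r i)) p"
          unfolding h_def markov_power_diff[OF f markov_power_holder[OF f \<alpha>] \<alpha>] F_def
          by (simp flip: funpow_add[THEN fun_cong, unfolded comp_def] add: add_ac)
        moreover have "(T ^^ n) g p = (T ^^ n) l p - (T ^^ (n + q)) l p"
          unfolding g_def markov_power_diff[OF lh markov_power_holder[OF lh \<alpha>] \<alpha>] by (simp add: funpow_add)
        ultimately have "(T ^^ (n + q * r i)) h p - (T ^^ n) g p = (T ^^ n) w p - (T ^^ (n + q)) w p"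
          unfolding w_def markov_power_diff[OF Fh lh \<alpha>] by simp
        then have "cmod ((T ^^ (n + q * r i)) h p - (T ^^ n) g p) \<le> cmod ((T ^^ n) w p) + cmod ((T ^^ (n + q)) w p)"
          by (simp only: norm_triangle_ineq4)
        then show "cmod ((T ^^ (n + q * r i)) h p - (T ^^ n) g p) \<le> e"
          using w[of n p] w[of "n + q" p] by linarith
      qed
      then show ?thesis by blast
    qed
    then have "(\<lambda>i. ?a (n + q * r i)) \<longlonglongrightarrow> sup_norm ((T ^^ n) g)"
      unfolding lim_sequentially dist_real_def by (meson dense le_less_trans)
    moreover have "strict_mono (\<lambda>i. n + q * r i)"
      using r(1) q_pos by (auto simp: strict_mono_def)
    then have "(\<lambda>i. ?a (n + q * r i)) \<longlonglongrightarrow> c"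
      using LIMSEQ_subseq_LIMSEQ[OF c] by (simp add: o_def)
    ultimately show ?thesis by (rule LIMSEQ_unique)
  qed
  have "c = 0" by (rule coboundary_norm_eq_0[OF lh \<alpha> g_def norm_g])
  then have "cmod (g p) \<le> 0" for p
    using cmod_le_sup_norm[OF cont[OF gh, of 0], of p] norm_g[of 0] by simp
  then have per: "(T ^^ q) l = l" by (auto simp: g_def fun_eq_iff)
  have "vanishing (\<lambda>p. f p - l p)"
  proof (rule vanishingI[OF holder_diff[OF f lh] \<alpha>])
    fix e :: real assume "e > 0"
    then obtain N where "\<forall>i\<ge>N. \<forall>p. cmod (F (r i) p - l p) < e" using close by blast
    then have "cmod ((T ^^ (q * r N)) (\<lambda>p. f p - l p) p) \<le> e" for p
      by (simp add: markov_power_diff[OF f lh \<alpha>] funpow_fixed[OF per] F_def less_imp_le)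
    then show "\<exists>n. \<forall>p. cmod ((T ^^ n) (\<lambda>p. f p - l p) p) \<le> e" by blast
  qed
  moreover have "l \<in> periodic" using l1 per by (simp add: periodic_def)
  ultimately show ?thesis using that by blast
qed

section \<open>Peripheral eigenfunctions\<close>

lemma periodic_holder_1: "f \<in> periodic \<Longrightarrow> f \<in> holder 1"
  by (simp add: periodic_def)

lemma periodic_power: "f \<in> periodic \<Longrightarrow> (T ^^ q) f = f"
  by (simp add: periodic_def)

lemma periodic_continuous: "f \<in> periodic \<Longrightarrow> continuous_on UNIV f"
  using holder_continuous[OF periodic_holder_1] by simp

lemma periodic_markov_power: "f \<in> periodic \<Longrightarrow> (T ^^ n) f \<in> periodic"
  unfolding periodic_def using markov_power_holder[of f 1 n]
  by (auto simp: funpow_swap1[symmetric]) (metis add.commute comp_apply funpow_add)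

lemma periodic_linear_combination:
  assumes "finite I" "\<And>i. i \<in> I \<Longrightarrow> f i \<in> periodic"
  shows "(\<lambda>p. \<Sum>i\<in>I. c i * f i p) \<in> periodic"
proof -
  have h: "f i \<in> holder 1" "(T ^^ q) (f i) = f i" if "i \<in> I" for i
    using assms(2)[OF that] by (auto simp: periodic_def)
  have "(\<lambda>p. \<Sum>i\<in>I. c i * (T ^^ q) (f i) p) = (\<lambda>p. \<Sum>i\<in>I. c i * f i p)"
    by (intro ext sum.cong refl) (simp add: h)
  then show ?thesis
    using markov_power_sum[OF assms(1) h(1), where c = c and n = q] by (simp add: periodic_def)
qed

text \<open>The norm cannot increase under iteration, and a further iterate returns to
  \<open>f\<close>.\<close>

lemma sup_norm_markov_power_periodic:
  assumes f: "f \<in> periodic"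
  shows "sup_norm ((T ^^ n) f) = sup_norm f"
proof (rule antisym)
  have le: "sup_norm ((T ^^ n) g) \<le> sup_norm g" if "g \<in> periodic" for g n
    using cmod_markov_power_le[OF periodic_holder_1[OF that] _ _ cmod_le_sup_norm[OF periodic_continuous[OF that]]]
    by (intro sup_norm_leI) auto
  show "sup_norm ((T ^^ n) f) \<le> sup_norm f" by (rule le[OF f])
  have "n + (q * n - n) = q * n" using q_pos by simp
  then have "(T ^^ (q * n - n)) ((T ^^ n) f) = f"
    using funpow_fixed[OF periodic_power[OF f], of n] by (metis add.commute comp_apply funpow_add)
  then show "sup_norm f \<le> sup_norm ((T ^^ n) f)"
    using le[OF periodic_markov_power[OF f, of n], of "q * n - n"] by simp
qed

lemma eigenfunction_power:
  assumes "T f = (\<lambda>p. z * f p)"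
  shows "(T ^^ n) f = (\<lambda>p. z ^ n * f p)"
proof (induction n)
  case (Suc n)
  have "(T ^^ Suc n) f = T (\<lambda>p. z ^ n * f p)" using Suc by simp
  also have "\<dots> = (\<lambda>p. z ^ n * (z * f p))" by (subst markov_cmult) (simp only: assms)
  finally show ?case by (simp add: mult_ac)
qed simp

lemma eigenvalue_root_of_unity:
  assumes "f \<in> periodic" "f \<noteq> (\<lambda>p. 0)" "T f = (\<lambda>p. z * f p)"
  shows "z ^ q = 1"
proof -
  obtain p where "f p \<noteq> 0" using assms(2) by auto
  moreover have "z ^ q * f p = f p"
    using eigenfunction_power[OF assms(3), of q] periodic_power[OF assms(1)] by (metis (full_types))
  ultimately show ?thesis by simp
qed

lemma cmod_root_of_unity: "z ^ q = 1 \<Longrightarrow> cmod z = 1"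
  using q_pos by (metis norm_one norm_power norm_ge_zero power_eq_1_iff not_one_le_zero)

text \<open>The eigenvalue has modulus one, so |T^j f| = |f| and the index j at which the peak
  occurs is irrelevant.\<close>

lemma eigenfunction_peak:
  assumes "f \<in> periodic" "T f = (\<lambda>p. z * f p)"
  shows "cmod (f p0) = sup_norm f"
proof (cases "f = (\<lambda>p. 0)")
  case True
  then show ?thesis by (simp add: sup_norm_def)
next
  case False
  then have z: "cmod z = 1"
    using eigenvalue_root_of_unity[OF assms(1) _ assms(2)] cmod_root_of_unity by blast
  have "\<exists>j\<le>L. cmod ((T ^^ j) f p0) = sup_norm f"
    by (rule peak_at_p0[OF periodic_holder_1[OF assms(1)]])
      (simp_all add: sup_norm_markov_power_periodic[OF assms(1)])
  then show ?thesis
    using z by (auto simp: eigenfunction_power[OF assms(2)] norm_mult norm_power)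
qed

text \<open>The difference of the two sides is an eigenfunction vanishing at \<open>p0\<close>,
  where it attains its norm.\<close>

lemma eigenfunction_unique:
  assumes "f \<in> periodic" "T f = (\<lambda>p. z * f p)" "g \<in> periodic" "T g = (\<lambda>p. z * g p)" "f p0 = 1"
  shows "g = (\<lambda>p. g p0 * f p)"
proof -
  define h where "h = (\<lambda>p. 1 * g p + (- g p0) * f p)"
  have "(\<lambda>p. \<Sum>b\<in>(UNIV :: bool set). (if b then 1 else - g p0) * (if b then g else f) p) \<in> periodic"
    using assms by (intro periodic_linear_combination) auto
  then have h: "h \<in> periodic" by (simp add: h_def UNIV_bool add.commute)
  have eigen: "T h = (\<lambda>p. z * h p)"
    unfolding h_def markov_linear[OF periodic_continuous[OF assms(3)] periodic_continuous[OF assms(1)]]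
    by (simp add: assms algebra_simps)
  have "h p0 = 0" by (simp add: h_def assms(5))
  then have "sup_norm h = 0"
    using eigenfunction_peak[OF h eigen] by simp
  then have zero: "h p = 0" for p
    using cmod_le_sup_norm[OF periodic_continuous[OF h], of p] by simp
  have "g p = g p0 * f p" for p
    using zero[of p] by (simp add: h_def)
  then show ?thesis by (rule ext)
qed

section \<open>Fourier decomposition and the group of eigenvalues\<close>

definition eigenvalues :: "complex set" where
  "eigenvalues = {z. \<exists>f\<in>periodic. f \<noteq> (\<lambda>p. 0) \<and> T f = (\<lambda>p. z * f p)}"

lemma eigenvaluesE:
  assumes "z \<in> eigenvalues"
  obtains f where "f \<in> periodic" "f p0 = 1" "T f = (\<lambda>p. z * f p)"
proof -
  obtain g where g: "g \<in> periodic" "g \<noteq> (\<lambda>p. 0)" "T g = (\<lambda>p. z * g p)"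
    using assms by (auto simp: eigenvalues_def)
  have "g p0 \<noteq> 0"
  proof
    assume "g p0 = 0"
    then have "sup_norm g = 0" using eigenfunction_peak[OF g(1,3)] by simp
    then have "g p = 0" for p using cmod_le_sup_norm[OF periodic_continuous[OF g(1)], of p] by simp
    then show False using g(2) by auto
  qed
  moreover have "(\<lambda>p. \<Sum>b\<in>{True}. inverse (g p0) * g p) \<in> periodic"
    using g by (intro periodic_linear_combination) auto
  ultimately show ?thesis
    using g by (intro that[of "\<lambda>p. inverse (g p0) * g p"]) (simp_all add: markov_cmult mult.left_commute)
qed

text \<open>For z^q = 1 this is the projection onto the eigenspace of \<open>z\<close> for the
  cyclic group of order q that the powers of the operator represent on periodic functions.\<close>

definition fourier_component :: "complex \<Rightarrow> ('n cproj \<Rightarrow> complex) \<Rightarrow> 'n cproj \<Rightarrow> complex" where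
  "fourier_component z f = (\<lambda>p. \<Sum>j<q. (inverse z ^ j / of_nat q) * (T ^^ j) f p)"

lemma fourier_component_periodic: "f \<in> periodic \<Longrightarrow> fourier_component z f \<in> periodic"
  unfolding fourier_component_def by (intro periodic_linear_combination periodic_markov_power) auto

lemma markov_fourier_component:
  assumes "f \<in> periodic" "z ^ q = 1"
  shows "T (fourier_component z f) = (\<lambda>p. z * fourier_component z f p)"
proof
  fix p
  have z: "z \<noteq> 0" using assms(2) q_pos by (auto simp: power_0_left)
  let ?a = "\<lambda>j. (inverse z ^ j / of_nat q) * (T ^^ j) f p"
  have "T (fourier_component z f) = (\<lambda>p. \<Sum>j<q. (inverse z ^ j / of_nat q) * (T ^^ 1) ((T ^^ j) f) p)"
    unfolding fourier_component_def
    using markov_power_sum[of "{..<q}" "\<lambda>j. (T ^^ j) f" 1, where c = "\<lambda>j. inverse z ^ j / of_nat q" and n = 1]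
      periodic_holder_1[OF periodic_markov_power[OF assms(1)]] by simp
  then have "T (fourier_component z f) p = (\<Sum>j<q. z * ?a (Suc j))"
    using z by (auto simp: field_simps intro!: sum.cong)
  also have "\<dots> = z * (\<Sum>j<q. ?a (Suc j))" by (simp only: sum_distrib_left)
  also have "(\<Sum>j<q. ?a (Suc j)) = (\<Sum>j<Suc q. ?a j) - ?a 0"
    by (simp only: sum.lessThan_Suc_shift) simp
  \<comment> \<open>The new last term equals the removed first one, since T^q f = f and z^q =
    1.\<close>
  also have "\<dots> = (\<Sum>j<q. ?a j)"
    using periodic_power[OF assms(1)] assms(2) by (simp add: power_inverse)
  finally show "T (fourier_component z f) p = z * fourier_component z f p" by (simp add: fourier_component_def)
qed

lemma fourier_component_eigenvalue:
  assumes "f \<in> periodic" "z ^ q = 1" "fourier_component z f \<noteq> (\<lambda>p. 0)"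
  shows "z \<in> eigenvalues"
  using assms fourier_component_periodic markov_fourier_component unfolding eigenvalues_def by blast

lemma finite_eigenvalues: "finite eigenvalues"
proof (rule finite_subset)
  show "eigenvalues \<subseteq> {z. z ^ q = 1}"
    using eigenvalue_root_of_unity by (auto simp: eigenvalues_def)
  show "finite {z :: complex. z ^ q = 1}" using q_pos by (intro finite_roots_unity) auto
qed

text \<open>Orthogonality of characters: a geometric sum whose ratio is a q-th root of unity
  different from 1.\<close>

lemma sum_roots_of_unity_power:
  assumes "0 < j" "j < q"
  shows "(\<Sum>z | z ^ q = 1. inverse z ^ j) = (0 :: complex)"
proof -
  let ?w = "cis (2 * pi * real j / real q)"
  have "(\<Sum>z | z ^ q = 1. inverse z ^ j) = (\<Sum>k<q. inverse (cis (2 * pi * real k / real q)) ^ j)"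
    by (rule sum.reindex_bij_betw[OF Complex.bij_betw_roots_unity, symmetric]) (use q_pos in simp)
  also have "\<dots> = (\<Sum>k<q. inverse ?w ^ k)"
    by (intro sum.cong refl) (simp add: Complex.DeMoivre power_inverse mult_ac)
  also have "\<dots> = (1 - inverse ?w ^ q) / (1 - inverse ?w)"
  proof -
    have "?w \<noteq> 1"
    proof
      assume "?w = 1"
      then have "cis (2 * pi * real j / real q) = cis (2 * pi * real 0 / real q)" by simp
      moreover have "inj_on (\<lambda>k. cis (2 * pi * real k / real q)) {..<q}"
        using Complex.bij_betw_roots_unity[of q] q_pos by (auto simp: bij_betw_def)
      ultimately have "j = 0" using assms inj_onD[of "\<lambda>k. cis (2 * pi * real k / real q)" "{..<q}" j 0] q_pos by simp
      then show False using assms by simp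
    qed
    then have "inverse ?w \<noteq> 1" by (metis inverse_1 inverse_inverse_eq)
    then show ?thesis by (simp add: sum_gp_strict)
  qed
  also have "?w ^ q = cis (2 * pi * real j)" using q_pos by (simp add: Complex.DeMoivre)
  then have "?w ^ q = 1" by (metis cis_multiple_2pi Ints_of_nat of_nat_mult mult.assoc mult.commute)
  then have "inverse ?w ^ q = 1" by (simp only: power_inverse inverse_1)
  finally show ?thesis by simp
qed

text \<open>Fourier inversion over all q-th roots of unity; components at roots that are not
  eigenvalues are zero.\<close>

lemma periodic_eq_sum_fourier_components:
  assumes "f \<in> periodic"
  shows "f = (\<lambda>p. \<Sum>z\<in>eigenvalues. fourier_component z f p)"
proof
  fix p
  let ?R = "{z :: complex. z ^ q = 1}"
  have fin: "finite ?R" using q_pos by (intro finite_roots_unity) auto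
  have "(\<Sum>z\<in>eigenvalues. fourier_component z f p) = (\<Sum>z\<in>?R. fourier_component z f p)"
  proof (rule sum.mono_neutral_left[OF fin])
    show "eigenvalues \<subseteq> ?R"
      using eigenvalue_root_of_unity by (auto simp: eigenvalues_def)
    show "\<forall>z\<in>?R - eigenvalues. fourier_component z f p = 0"
      using fourier_component_eigenvalue[OF assms] by (auto simp: fun_eq_iff)
  qed
  also have "\<dots> = (\<Sum>j<q. \<Sum>z\<in>?R. (inverse z ^ j / of_nat q) * (T ^^ j) f p)"
    unfolding fourier_component_def by (rule sum.swap)
  also have "\<dots> = (\<Sum>j<q. (\<Sum>z\<in>?R. inverse z ^ j) * ((T ^^ j) f p / of_nat q))"
    by (simp add: sum_distrib_right sum_distrib_left sum_divide_distrib mult_ac)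
  also have "\<dots> = (\<Sum>j<q. if j = 0 then f p else 0)"
    using q_pos sum_roots_of_unity_power card_roots_unity_eq[of q] by (intro sum.cong refl) auto
  also have "\<dots> = f p" using q_pos by (simp add: sum.delta')
  finally show "f p = (\<Sum>z\<in>eigenvalues. fourier_component z f p)" by simp
qed

lemma one_eigenvalue: "1 \<in> eigenvalues"
proof -
  have "holder_const 1 0 (\<lambda>p :: 'n cproj. 1)" by (simp add: holder_const_def)
  then have "(\<lambda>p. 1) \<in> periodic"
    using eigenfunction_power[of "\<lambda>p. 1" 1 q] unfolding periodic_def mem_holder_iff by (auto simp: markov_one)
  then show ?thesis
    unfolding eigenvalues_def by (auto intro!: bexI[of _ "\<lambda>p. 1"] simp: markov_one fun_eq_iff)
qed

text \<open>A product of two eigenfunctions is only known to behave like an eigenfunction where both have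
  maximal modulus; this set is invariant and contains \<open>p0\<close>.\<close>

lemma eigenvalues_mult:
  assumes "z \<in> eigenvalues" "w \<in> eigenvalues"
  shows "z * w \<in> eigenvalues"
proof -
  obtain f where f: "f \<in> periodic" "f p0 = 1" "T f = (\<lambda>p. z * f p)" using eigenvaluesE[OF assms(1)] .
  obtain g where g: "g \<in> periodic" "g p0 = 1" "T g = (\<lambda>p. w * g p)" using eigenvaluesE[OF assms(2)] .
  have f1: "cmod (f p) \<le> 1" for p
    using cmod_le_sup_norm[OF periodic_continuous[OF f(1)], of p] eigenfunction_peak[OF f(1,3)] f(2) by simp
  have g1: "cmod (g p) \<le> 1" for p
    using cmod_le_sup_norm[OF periodic_continuous[OF g(1)], of p] eigenfunction_peak[OF g(1,3)] g(2) by simp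
  have "f \<noteq> (\<lambda>p. 0)" "g \<noteq> (\<lambda>p. 0)" using f(2) g(2) by auto
  then have zw: "z ^ q = 1" "w ^ q = 1"
    using eigenvalue_root_of_unity[OF f(1) _ f(3)] eigenvalue_root_of_unity[OF g(1) _ g(3)] by blast+
  then have unit: "cmod z = 1" "cmod w = 1" by (simp_all add: cmod_root_of_unity)
  define h where "h = (\<lambda>p. f p * g p)"
  have h: "h \<in> holder 1"
  proof -
    obtain m m' where "holder_const 1 m f" "holder_const 1 m' g"
      using f(1) g(1) by (auto simp: periodic_def mem_holder_iff)
    from holder_const_mult[OF this f1 g1] show ?thesis
      unfolding h_def mem_holder_iff by blast
  qed
  define M where "M = {p. cmod (f p) = 1 \<and> cmod (g p) = 1}"
  have step: "f (proj_act v p) = z * f p" "g (proj_act v p) = w * g p" "proj_act v p \<in> M"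
    if "p \<in> M" "v \<in> S" "v *v unit_rep p \<noteq> 0" for v p
  proof -
    have "cmod (T f p) = 1" "cmod (T g p) = 1" using that(1) unit by (simp_all add: M_def f(3) g(3) norm_mult)
    then have "f (proj_act v p) = T f p" "g (proj_act v p) = T g p"
      using deterministic_step[OF periodic_continuous[OF f(1)] f1 _ that(2,3)]
        deterministic_step[OF periodic_continuous[OF g(1)] g1 _ that(2,3)] by blast+
    then show "f (proj_act v p) = z * f p" "g (proj_act v p) = w * g p" "proj_act v p \<in> M"
      using that(1) unit by (simp_all add: f(3) g(3) M_def norm_mult)
  qed
  have pow: "(T ^^ n) h p = (z * w) ^ n * h p" if "p \<in> M" for n p
    using that
  proof (induction n arbitrary: p)
    case (Suc n)
    have "(T ^^ Suc n) h p = (\<integral>v. lift ((T ^^ n) h) (v *v unit_rep p) \<partial>\<mu>)"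
      by (simp add: markov_op_eq_lift)
    also have "\<dots> = (\<integral>v. (z * w) ^ Suc n * h p * complex_of_real ((norm (v *v unit_rep p))\<^sup>2) \<partial>\<mu>)"
    proof (rule integral_cong_AE)
      have hc: "continuous_on UNIV ((T ^^ n) h)"
        using holder_continuous[OF markov_power_holder[OF h]] by simp
      show "(\<lambda>v. lift ((T ^^ n) h) (v *v unit_rep p)) \<in> borel_measurable \<mu>"
        by (rule borel_measurable_integrable[OF integrable_lift[OF hc]])
      show "(\<lambda>v. (z * w) ^ Suc n * h p * complex_of_real ((norm (v *v unit_rep p))\<^sup>2)) \<in> borel_measurable \<mu>"
        by (intro measurable_cont continuous_intros)
      show "AE v in \<mu>. lift ((T ^^ n) h) (v *v unit_rep p) = (z * w) ^ Suc n * h p * complex_of_real ((norm (v *v unit_rep p))\<^sup>2)"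
        using AE_S
      proof eventually_elim
        case (elim v)
        show ?case
        proof (cases "v *v unit_rep p = 0")
          case False
          note st = step[OF Suc.prems elim False]
          have "(T ^^ n) h (proj_act v p) = (z * w) ^ Suc n * h p"
            using Suc.IH[OF st(3)] st(1,2) by (simp add: h_def mult_ac)
          then show ?thesis using False by (simp add: lift_def proj_act_def)
        qed simp
      qed
    qed
    also have "\<dots> = (z * w) ^ Suc n * h p * complex_of_real (\<integral>v. (norm (v *v unit_rep p))\<^sup>2 \<partial>\<mu>)"
      by (simp only: integral_mult_right_zero integral_complex_of_real)
    finally show ?case by (simp add: integral_norm_apply)
  qed simp
  have p0: "p0 \<in> M" "h p0 = 1" by (simp_all add: M_def f g h_def)
  obtain l where l: "l \<in> periodic" "vanishing (\<lambda>p. h p - l p)"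
    using asymptotically_periodic[OF h] by auto
  \<comment> \<open>The iterates of \<open>h\<close> and \<open>l\<close> merge, T^n h equals (z
    w)^n at \<open>p0\<close>, and both (z w)^n and T^n l have period q in n; so they agree at every
    time, not only in the limit.\<close>
  have coeff: "(T ^^ j) l p0 = (z * w) ^ j" for j
  proof -
    have "cmod ((z * w) ^ j - (T ^^ j) l p0) \<le> e" if e: "e > 0" for e
    proof -
      obtain N where N: "\<And>n p. n \<ge> N \<Longrightarrow> cmod ((T ^^ n) (\<lambda>p. h p - l p) p) \<le> e"
        using l(2) e unfolding vanishing_def by blast
      let ?n = "j + q * N"
      have "N \<le> ?n" using q_pos by (simp add: trans_le_add2)
      from N[OF this, of p0] have "cmod ((z * w) ^ ?n - (T ^^ ?n) l p0) \<le> e"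
        using markov_power_diff[OF h periodic_holder_1[OF l(1)], of ?n] pow[OF p0(1), of ?n] p0(2) by simp
      moreover have "(T ^^ ?n) l = (T ^^ j) l"
        using funpow_fixed[OF periodic_power[OF l(1)], of N] by (simp add: funpow_add)
      moreover have "(z * w) ^ ?n = (z * w) ^ j"
        by (simp add: power_add power_mult power_mult_distrib zw)
      ultimately show ?thesis by simp
    qed
    then have "cmod ((z * w) ^ j - (T ^^ j) l p0) \<le> 0" by (rule field_le_epsilon[of _ 0, simplified])
    then show ?thesis by simp
  qed
  \<comment> \<open>The factors (z w)^j are cancelled exactly, so the component at \<open>p0\<close>
    is an average of ones and in particular nonzero.\<close>
  have "fourier_component (z * w) l p0 = (\<Sum>j<q. 1 / of_nat q)"
    unfolding fourier_component_def
  proof (intro sum.cong refl)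
    fix j
    have "z * w \<noteq> 0" using unit by auto
    then have "inverse (z * w) ^ j * (z * w) ^ j = 1"
      by (simp only: power_mult_distrib[symmetric] left_inverse power_one simp_thms)
    then show "inverse (z * w) ^ j / of_nat q * (T ^^ j) l p0 = 1 / of_nat q"
      unfolding coeff by (simp only: times_divide_eq_left)
  qed
  then have "fourier_component (z * w) l p0 = 1" using q_pos by simp
  then have "fourier_component (z * w) l \<noteq> (\<lambda>p. 0)" by auto
  then show ?thesis
    using fourier_component_eigenvalue[OF l(1), of "z * w"] by (simp add: power_mult_distrib zw)
qed

text \<open>Multiplication by an eigenvalue z permutes the finite set; comparing the product of all
  elements before and after gives z^k = 1. There are only k such roots, so the inclusion is an
  equality.\<close>

lemma eigenvalues_roots_of_unity:
  "eigenvalues = {z. z ^ card eigenvalues = 1}" and card_eigenvalues_pos: "0 < card eigenvalues"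
proof -
  let ?k = "card eigenvalues"
  show pos: "0 < ?k" using one_eigenvalue finite_eigenvalues by (auto simp: card_gt_0_iff)
  have nz: "z \<noteq> 0" if "z \<in> eigenvalues" for z
    using that eigenvalue_root_of_unity q_pos unfolding eigenvalues_def by (force simp: power_0_left)
  have sub: "eigenvalues \<subseteq> {z. z ^ ?k = 1}"
  proof
    fix z assume z: "z \<in> eigenvalues"
    have inj: "inj_on ((*) z) eigenvalues" using nz[OF z] by (auto intro!: inj_onI)
    have "(*) z ` eigenvalues = eigenvalues"
      using eigenvalues_mult[OF z] finite_eigenvalues inj
      by (intro card_subset_eq) (auto simp: card_image)
    then have "(\<Prod>w\<in>eigenvalues. w) = (\<Prod>w\<in>eigenvalues. z * w)"
      using prod.reindex[OF inj, of "\<lambda>w. w"] by simp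
    also have "\<dots> = z ^ ?k * (\<Prod>w\<in>eigenvalues. w)" by (simp add: prod.distrib)
    finally show "z \<in> {z. z ^ ?k = 1}" using nz finite_eigenvalues by simp
  qed
  show "eigenvalues = {z. z ^ ?k = 1}"
    using sub pos card_roots_unity_eq[of ?k] by (intro card_subset_eq finite_roots_unity) auto
qed

end

section \<open>Spectra\<close>

lemma pointwise_sum: "(\<lambda>p. \<Sum>i\<in>I. f i p) = (\<Sum>i\<in>I. f i)"
  for f :: "'i \<Rightarrow> 'a \<Rightarrow> complex"
  by (induction I rule: infinite_finite_induct) (auto simp: fun_eq_iff)

lemma cfun_subspace_sum:
  assumes "cfun.subspace V" "\<And>i. i \<in> I \<Longrightarrow> f i \<in> V"
  shows "(\<lambda>p. \<Sum>i\<in>I. c i * f i p) \<in> V"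
  unfolding pointwise_sum[of "\<lambda>i p. c i * f i p"]
  by (intro cfun.subspace_sum[OF assms(1)] cfun.subspace_scale[OF assms(1)] assms(2))

lemma cfun_subspaceI:
  assumes "(\<lambda>p. 0) \<in> V" "\<And>f g. f \<in> V \<Longrightarrow> g \<in> V \<Longrightarrow> (\<lambda>p. f p + g p) \<in> V"
    "\<And>c f. f \<in> V \<Longrightarrow> (\<lambda>p. c * f p) \<in> V"
  shows "cfun.subspace V"
  using assms by (intro cfun.subspaceI) (auto simp: plus_fun_def zero_fun_def)

lemma cfun_subspace_diff: "cfun.subspace V \<Longrightarrow> f \<in> V \<Longrightarrow> g \<in> V \<Longrightarrow> (\<lambda>p. f p - g p) \<in> V"
  using cfun.subspace_diff[of V f g] by (simp add: fun_diff_def)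

lemma cfun_subspace_holder: "cfun.subspace (holder \<alpha>)"
  by (intro cfun_subspaceI holder_zero holder_add holder_cmult)

lemma holder_norm_sum_le:
  assumes "finite I" "\<And>i. i \<in> I \<Longrightarrow> f i \<in> holder \<alpha>" "0 < \<alpha>"
  shows "holder_norm \<alpha> (\<lambda>p. \<Sum>i\<in>I. c i * f i p) \<le> (\<Sum>i\<in>I. cmod (c i) * holder_norm \<alpha> (f i))"
  using assms(1,2)
proof (induction I)
  case empty
  have "holder_const \<alpha> 0 (\<lambda>p :: 'b cproj. 0)" by (simp add: holder_const_def)
  from holder_norm_le[OF this, of 0] show ?case by simp
next
  case (insert i I)
  have h: "(\<lambda>p. c i * f i p) \<in> holder \<alpha>" "(\<lambda>p. \<Sum>i\<in>I. c i * f i p) \<in> holder \<alpha>"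
    using insert by (auto intro: holder_cmult cfun_subspace_sum[OF cfun_subspace_holder])
  have "holder_norm \<alpha> (\<lambda>p. \<Sum>j\<in>insert i I. c j * f j p)
      \<le> holder_norm \<alpha> (\<lambda>p. c i * f i p) + holder_norm \<alpha> (\<lambda>p. \<Sum>j\<in>I. c j * f j p)"
    using holder_norm_add_le[OF h assms(3)] insert by simp
  also have "\<dots> \<le> cmod (c i) * holder_norm \<alpha> (f i) + (\<Sum>i\<in>I. cmod (c i) * holder_norm \<alpha> (f i))"
    using insert by (intro add_mono holder_norm_cmult_le assms(3)) auto
  finally show ?case using insert by simp
qed

text \<open>Completeness in the form of geometric series. Sup parts and Hoelder parts are summed
  separately, so the tails are small in the full norm and closedness of \<open>V\<close> applies;
  the conclusion retains only the uniform bound.\<close>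

lemma holder_series:
  fixes a :: "nat \<Rightarrow> 'n::finite cproj \<Rightarrow> complex"
  assumes V: "cfun.subspace V" "V \<subseteq> holder \<alpha>" "holder_closed \<alpha> V" and \<alpha>: "0 < \<alpha>"
    and a: "\<And>k. a k \<in> V" "\<And>k. holder_norm \<alpha> (a k) \<le> c * \<theta> ^ k" and \<theta>: "0 \<le> \<theta>" "\<theta> < 1"
  obtains g where "g \<in> V" "\<And>n p. cmod (g p - (\<Sum>k<n. a k p)) \<le> c / (1 - \<theta>) * \<theta> ^ n"
proof -
  have ah: "a k \<in> holder \<alpha>" for k using a(1) V(2) by blast
  have "\<forall>k. \<exists>s m. holder_norm \<alpha> (a k) = s + m \<and> holder_const \<alpha> m (a k) \<and> (\<forall>p. cmod (a k p) \<le> s) \<and> 0 \<le> s \<and> 0 \<le> m"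
    using holder_normE[OF ah \<alpha>] by metis
  then obtain s m where sm: "\<And>k. holder_norm \<alpha> (a k) = s k + m k" "\<And>k. holder_const \<alpha> (m k) (a k)"
    "\<And>k p. cmod (a k p) \<le> s k" "\<And>k. 0 \<le> s k" "\<And>k. 0 \<le> m k" by metis
  have geo: "summable (\<lambda>k. c * \<theta> ^ (k + n))" "(\<Sum>k. c * \<theta> ^ (k + n)) = c / (1 - \<theta>) * \<theta> ^ n" for n
  proof -
    have "(\<lambda>k. (c * \<theta> ^ n) * \<theta> ^ k) sums ((c * \<theta> ^ n) * (1 / (1 - \<theta>)))"
      using \<theta> by (intro sums_mult geometric_sums) auto
    then have "(\<lambda>k. c * \<theta> ^ (k + n)) sums (c / (1 - \<theta>) * \<theta> ^ n)"
      by (simp add: power_add mult_ac)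
    then show "summable (\<lambda>k. c * \<theta> ^ (k + n))" "(\<Sum>k. c * \<theta> ^ (k + n)) = c / (1 - \<theta>) * \<theta> ^ n"
      by (auto simp: sums_iff)
  qed
  have le: "s k + m k \<le> c * \<theta> ^ k" for k using a(2)[of k] sm(1)[of k] by simp
  have le_s: "s k \<le> c * \<theta> ^ k" and le_m: "m k \<le> c * \<theta> ^ k" for k
    using le[of k] sm(4,5)[of k] by linarith+
  have sum_s: "summable (\<lambda>k. s (k + n))" and sum_m: "summable (\<lambda>k. m (k + n))" for n
    using sm(4,5) le_s le_m
    by (auto simp: summable_iff_shift intro!: summable_comparison_test'[OF geo(1)[of 0], of 0])
  have sum_a: "summable (\<lambda>k. a (k + n) p)" for n p
    using sm(3) by (auto intro!: summable_comparison_test'[OF sum_s[of n], of 0])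
  define g where "g p = (\<Sum>k. a k p)" for p
  have tail: "g p - (\<Sum>k<n. a k p) = (\<Sum>k. a (k + n) p)" for n p
    using suminf_minus_initial_segment[of "\<lambda>k. a k p" n] sum_a[of 0 p] by (simp add: g_def)
  have const: "holder_const \<alpha> (\<Sum>k. m (k + n)) (\<lambda>p. g p - (\<Sum>k<n. a k p))" for n
    unfolding holder_const_def
  proof (intro conjI allI)
    show "0 \<le> (\<Sum>k. m (k + n))" by (intro suminf_nonneg sum_m sm)
    fix p p'
    have "cmod ((\<Sum>k. a (k + n) p) - (\<Sum>k. a (k + n) p')) = cmod (\<Sum>k. a (k + n) p - a (k + n) p')"
      by (simp add: suminf_diff sum_a)
    also have "\<dots> \<le> (\<Sum>k. m (k + n) * dist p p' powr \<alpha>)"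
    proof (rule norm_suminf_le)
      show "cmod (a (k + n) p - a (k + n) p') \<le> m (k + n) * dist p p' powr \<alpha>" for k
        by (rule holder_constD[OF sm(2)])
    qed (rule summable_mult2[OF sum_m])
    also have "\<dots> = (\<Sum>k. m (k + n)) * dist p p' powr \<alpha>"
      by (rule suminf_mult2[OF sum_m, symmetric])
    finally show "cmod (g p - (\<Sum>k<n. a k p) - (g p' - (\<Sum>k<n. a k p'))) \<le> (\<Sum>k. m (k + n)) * dist p p' powr \<alpha>"
      by (simp only: tail)
  qed
  have sup: "cmod (g p - (\<Sum>k<n. a k p)) \<le> (\<Sum>k. s (k + n))" for n p
    unfolding tail by (rule norm_suminf_le[OF sm(3) sum_s])
  have total: "(\<Sum>k. s (k + n)) + (\<Sum>k. m (k + n)) \<le> c / (1 - \<theta>) * \<theta> ^ n" for n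
  proof -
    have "(\<Sum>k. s (k + n)) + (\<Sum>k. m (k + n)) = (\<Sum>k. s (k + n) + m (k + n))"
      by (rule suminf_add[OF sum_s sum_m])
    also have "\<dots> \<le> (\<Sum>k. c * \<theta> ^ (k + n))"
      by (intro suminf_le le summable_add sum_s sum_m geo)
    finally show ?thesis by (simp only: geo(2))
  qed
  have norm: "holder_norm \<alpha> (\<lambda>p. g p - (\<Sum>k<n. a k p)) \<le> c / (1 - \<theta>) * \<theta> ^ n" for n
    using holder_norm_le[OF const sup, of n] total[of n] by linarith
  have "g \<in> holder \<alpha>" using const[of 0] by (auto simp: mem_holder_iff)
  moreover have "\<exists>h\<in>V. holder_norm \<alpha> (g - h) < \<epsilon>" if "\<epsilon> > 0" for \<epsilon>
  proof -
    have "(\<lambda>n. c / (1 - \<theta>) * \<theta> ^ n) \<longlonglongrightarrow> c / (1 - \<theta>) * 0"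
      using \<theta> by (intro tendsto_intros LIMSEQ_power_zero) auto
    then have "\<forall>\<^sub>F n in sequentially. c / (1 - \<theta>) * \<theta> ^ n < \<epsilon>"
      by (rule order_tendstoD) (use that in simp)
    then obtain n where n: "c / (1 - \<theta>) * \<theta> ^ n < \<epsilon>"
      unfolding eventually_sequentially by blast
    have "(\<lambda>p. \<Sum>k<n. 1 * a k p) \<in> V" by (rule cfun_subspace_sum[OF V(1) a(1)])
    then show ?thesis
      using norm[of n] n by (intro bexI[of _ "\<lambda>p. \<Sum>k<n. a k p"]) (simp_all add: fun_diff_def)
  qed
  ultimately have "g \<in> V" using V(3) by (auto simp: holder_closed_def)
  moreover have "cmod (g p - (\<Sum>k<n. a k p)) \<le> c / (1 - \<theta>) * \<theta> ^ n" for n p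
  proof -
    have "0 \<le> (\<Sum>k. m (k + n))" by (intro suminf_nonneg sum_m sm)
    then show ?thesis using sup[of p n] total[of n] by linarith
  qed
  ultimately show ?thesis by (rule that)
qed

section \<open>Cofactors, Neumann series and spectra\<close>

context markov_measure
begin

abbreviation shifted :: "complex \<Rightarrow> ('n cproj \<Rightarrow> complex) \<Rightarrow> 'n cproj \<Rightarrow> complex" where
  "shifted z \<equiv> (\<lambda>f x. T f x - z * f x)"

text \<open>The factor complementary to T - z in T^N - z^N.\<close>

definition cofactor :: "nat \<Rightarrow> complex \<Rightarrow> ('n cproj \<Rightarrow> complex) \<Rightarrow> 'n cproj \<Rightarrow> complex" where
  "cofactor N z f = (\<lambda>x. \<Sum>j<N. z ^ (N - 1 - j) * (T ^^ j) f x)"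

lemma telescope_powers:
  "(\<Sum>j<N. z ^ (N - 1 - j) * (b (Suc j) - z * b j)) = b N - z ^ N * (b 0 :: complex)"
proof -
  have "(\<Sum>j<N. z ^ (N - 1 - j) * (b (Suc j) - z * b j)) = (\<Sum>j<N. z ^ (N - Suc j) * b (Suc j) - z ^ (N - j) * b j)"
  proof (intro sum.cong refl)
    fix j assume "j \<in> {..<N}"
    then have "z ^ (N - j) = z * z ^ (N - Suc j)" by (simp add: Suc_diff_Suc flip: power_Suc)
    then show "z ^ (N - 1 - j) * (b (Suc j) - z * b j) = z ^ (N - Suc j) * b (Suc j) - z ^ (N - j) * b j"
      by (simp add: algebra_simps)
  qed
  also have "\<dots> = z ^ (N - N) * b N - z ^ (N - 0) * b 0"
    by (rule sum_lessThan_telescope)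
  finally show ?thesis by simp
qed

lemma cofactor_shifted:
  assumes "f \<in> holder \<alpha>" "0 < \<alpha>" "\<alpha> \<le> 1"
  shows "cofactor N z (shifted z f) = (\<lambda>x. (T ^^ N) f x - z ^ N * f x)"
proof
  fix x
  have "(T ^^ j) (shifted z f) x = (T ^^ Suc j) f x - z * (T ^^ j) f x" for j
    using markov_power_linear[OF markov_holder[OF assms] assms, of j 1 "- z"]
    by (simp add: funpow_swap1)
  then show "cofactor N z (shifted z f) x = (T ^^ N) f x - z ^ N * f x"
    using telescope_powers[where N = N and z = z and b = "\<lambda>j. (T ^^ j) f x"] by (simp add: cofactor_def)
qed

lemma shifted_cofactor:
  assumes "f \<in> holder \<alpha>" "0 < \<alpha>" "\<alpha> \<le> 1"
  shows "shifted z (cofactor N z f) = (\<lambda>x. (T ^^ N) f x - z ^ N * f x)"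
proof
  fix x
  have "T (cofactor N z f) = (\<lambda>x. \<Sum>j<N. z ^ (N - 1 - j) * (T ^^ 1) ((T ^^ j) f) x)"
    unfolding cofactor_def
    using markov_power_sum[of "{..<N}" "\<lambda>j. (T ^^ j) f" \<alpha>, where c = "\<lambda>j. z ^ (N - 1 - j)" and n = 1]
      markov_power_holder[OF assms] assms by simp
  then have "shifted z (cofactor N z f) x = (\<Sum>j<N. z ^ (N - 1 - j) * ((T ^^ Suc j) f x - z * (T ^^ j) f x))"
    by (simp add: cofactor_def sum_distrib_left sum_subtractf right_diff_distrib mult.left_commute)
  also have "\<dots> = (T ^^ N) f x - z ^ N * f x"
    using telescope_powers[where N = N and z = z and b = "\<lambda>j. (T ^^ j) f x"] by simp
  finally show "shifted z (cofactor N z f) x = (T ^^ N) f x - z ^ N * f x" .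
qed

lemma markov_power_invariant: "T ` V \<subseteq> V \<Longrightarrow> f \<in> V \<Longrightarrow> (T ^^ n) f \<in> V"
  by (induction n) auto

lemma cofactor_in:
  assumes "cfun.subspace V" "T ` V \<subseteq> V" "f \<in> V"
  shows "cofactor N z f \<in> V"
  unfolding cofactor_def by (intro cfun_subspace_sum assms(1) markov_power_invariant assms)

lemma holder_norm_cofactor_le:
  assumes "f \<in> holder \<alpha>" "0 < \<alpha>" "\<alpha> \<le> 1"
  shows "holder_norm \<alpha> (cofactor N z f) \<le> (\<Sum>j<N. cmod z ^ (N - 1 - j) * 5) * holder_norm \<alpha> f"
proof -
  have "holder_norm \<alpha> (cofactor N z f) \<le> (\<Sum>j<N. cmod (z ^ (N - 1 - j)) * holder_norm \<alpha> ((T ^^ j) f))"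
    unfolding cofactor_def by (intro holder_norm_sum_le markov_power_holder assms) auto
  also have "\<dots> \<le> (\<Sum>j<N. cmod (z ^ (N - 1 - j)) * (5 * holder_norm \<alpha> f))"
    by (intro sum_mono mult_left_mono holder_norm_markov_power_le assms) auto
  finally show ?thesis by (simp add: norm_power sum_distrib_right mult.assoc)
qed

text \<open>The cofactor reduces invertibility of \<open>T - z\<close> on \<open>V\<close> to that of \<open>T\<^sup>N - z\<^sup>N\<close>.\<close>

lemma not_in_spectrum_on:
  assumes V: "cfun.subspace V" "V \<subseteq> holder \<alpha>" "T ` V \<subseteq> V" and \<alpha>: "0 < \<alpha>" "\<alpha> \<le> 1"
    and below: "\<And>f. f \<in> V \<Longrightarrow> \<delta> * holder_norm \<alpha> f \<le> holder_norm \<alpha> (\<lambda>x. (T ^^ N) f x - z ^ N * f x)"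
    and \<delta>: "0 < \<delta>"
    and onto: "\<And>f. f \<in> V \<Longrightarrow> \<exists>g\<in>V. (\<lambda>x. (T ^^ N) g x - z ^ N * g x) = f"
  shows "z \<notin> spectrum_on \<alpha> V T"
proof -
  let ?C = "\<Sum>j<N. cmod z ^ (N - 1 - j) * 5"
  have sh: "shifted z f \<in> V" if "f \<in> V" for f
    using V(3) that cfun_subspace_diff[OF V(1), of "T f" "\<lambda>x. z * f x"] cfun.subspace_scale[OF V(1) that] by blast
  have bound: "holder_norm \<alpha> f \<le> ?C / \<delta> * holder_norm \<alpha> (shifted z f)" if f: "f \<in> V" for f
  proof -
    have fh: "f \<in> holder \<alpha>" "shifted z f \<in> holder \<alpha>" using f sh[OF f] V(2) by auto
    have "\<delta> * holder_norm \<alpha> f \<le> holder_norm \<alpha> (cofactor N z (shifted z f))"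
      using below[OF f] by (simp add: cofactor_shifted[OF fh(1) \<alpha>])
    also have "\<dots> \<le> ?C * holder_norm \<alpha> (shifted z f)"
      by (rule holder_norm_cofactor_le[OF fh(2) \<alpha>])
    finally show ?thesis using \<delta> by (simp add: field_simps)
  qed
  have "inj_on (shifted z) V"
  proof (rule inj_onI)
    fix f g assume fg: "f \<in> V" "g \<in> V" "shifted z f = shifted z g"
    have fgV: "(\<lambda>p. f p - g p) \<in> V" by (rule cfun_subspace_diff[OF V(1) fg(1,2)])
    have c: "continuous_on UNIV f" "continuous_on UNIV g"
      using fg V(2) \<alpha> by (auto intro: holder_continuous)
    have T_diff: "T (\<lambda>p. f p - g p) = (\<lambda>p. T f p - T g p)"
      using markov_linear[OF c, of 1 "-1"] by simp
    have zero: "shifted z (\<lambda>p. f p - g p) = (\<lambda>p. 0)"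
    proof
      fix x show "shifted z (\<lambda>p. f p - g p) x = 0"
        using fun_cong[OF fg(3), of x] by (simp add: T_diff algebra_simps)
    qed
    have "holder_norm \<alpha> (\<lambda>p :: 'n cproj. 0) \<le> 0"
      using holder_norm_le[of \<alpha> 0 "\<lambda>p. 0" 0] by (simp add: holder_const_def)
    moreover have "0 \<le> ?C / \<delta>" using \<delta> by (intro divide_nonneg_pos sum_nonneg) auto
    ultimately have "holder_norm \<alpha> (\<lambda>p. f p - g p) \<le> 0"
      using bound[OF fgV] unfolding zero by (meson mult_nonneg_nonpos order_trans)
    then have "cmod (f p - g p) \<le> 0" for p
      using cmod_le_holder_norm[OF subsetD[OF V(2) fgV] \<alpha>(1), of p] by linarith
    then show "f = g" by auto
  qed
  moreover have "shifted z ` V = V"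
  proof
    show "shifted z ` V \<subseteq> V" using sh by blast
    show "V \<subseteq> shifted z ` V"
    proof
      fix f assume "f \<in> V"
      then obtain g where g: "g \<in> V" "(\<lambda>x. (T ^^ N) g x - z ^ N * g x) = f" using onto by blast
      have "shifted z (cofactor N z g) = f"
        using shifted_cofactor[OF subsetD[OF V(2) g(1)] \<alpha>, where z = z and N = N] g(2) by simp
      then show "f \<in> shifted z ` V" using cofactor_in[OF V(1,3) g(1)] by blast
    qed
  qed
  ultimately show ?thesis using bound unfolding spectrum_on_def bij_betw_def by blast
qed

text \<open>T^N is smaller than its shift y = z^N: the triangle inequality gives the lower bound
  with constant |y| - \<kappa>, and a Neumann series gives surjectivity.\<close>

lemma contraction_not_in_spectrum_on:
  assumes V: "cfun.subspace V" "V \<subseteq> holder \<alpha>" "T ` V \<subseteq> V" "holder_closed \<alpha> V" and \<alpha>: "0 < \<alpha>" "\<alpha> \<le> 1"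
    and \<kappa>: "\<And>f. f \<in> V \<Longrightarrow> holder_norm \<alpha> ((T ^^ N) f) \<le> \<kappa> * holder_norm \<alpha> f" "0 \<le> \<kappa>" "\<kappa> < cmod z ^ N"
  shows "z \<notin> spectrum_on \<alpha> V T"
proof (rule not_in_spectrum_on[OF V(1-3) \<alpha>, where \<delta> = "cmod z ^ N - \<kappa>" and N = N])
  define y where "y = z ^ N"
  let ?A = "T ^^ N"
  have "0 < cmod y" using \<kappa>(2,3) by (simp add: y_def norm_power)
  then have y: "y \<noteq> 0" unfolding zero_less_norm_iff .
  have y': "\<kappa> < cmod y" using \<kappa>(3) by (simp add: y_def norm_power)
  show "0 < cmod z ^ N - \<kappa>" using \<kappa>(3) by simp
  fix f assume f: "f \<in> V"
  have h: "f \<in> holder \<alpha>" "?A f \<in> holder \<alpha>" using f V(2) by (auto intro: markov_power_holder \<alpha>)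
  have sh: "(\<lambda>x. ?A f x - y * f x) \<in> holder \<alpha>" by (intro holder_diff holder_cmult h)
  show "(cmod z ^ N - \<kappa>) * holder_norm \<alpha> f \<le> holder_norm \<alpha> (\<lambda>x. ?A f x - z ^ N * f x)"
  proof -
    have "f = (\<lambda>x. inverse y * (?A f x + (- 1) * (?A f x - y * f x)))"
      using y by (simp add: fun_eq_iff field_simps)
    then have "holder_norm \<alpha> f = holder_norm \<alpha> (\<lambda>x. inverse y * (?A f x + (- 1) * (?A f x - y * f x)))"
      by simp
    also have "\<dots> \<le> cmod (inverse y) * holder_norm \<alpha> (\<lambda>x. ?A f x + (- 1) * (?A f x - y * f x))"
      by (intro holder_norm_cmult_le holder_add holder_cmult h sh \<alpha>)
    also have "\<dots> \<le> cmod (inverse y) * (holder_norm \<alpha> (?A f) + cmod (- 1) * holder_norm \<alpha> (\<lambda>x. ?A f x - y * f x))"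
      by (intro mult_left_mono order_trans[OF holder_norm_add_le] add_mono holder_norm_cmult_le holder_cmult h sh \<alpha> order_refl)
        simp
    finally have "holder_norm \<alpha> f \<le> (holder_norm \<alpha> (?A f) + holder_norm \<alpha> (\<lambda>x. ?A f x - y * f x)) / cmod y"
      by (simp add: norm_inverse divide_inverse mult.commute)
    then have "cmod y * holder_norm \<alpha> f \<le> holder_norm \<alpha> (?A f) + holder_norm \<alpha> (\<lambda>x. ?A f x - y * f x)"
      using y by (simp add: pos_le_divide_eq mult.commute)
    then show ?thesis using \<kappa>(1)[OF f] by (simp add: y_def norm_power algebra_simps)
  qed
  define \<theta> where "\<theta> = \<kappa> / cmod y"
  have \<theta>: "0 \<le> \<theta>" "\<theta> < 1" using \<kappa>(2) y y' by (simp_all add: \<theta>_def)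
  \<comment> \<open>The terms of the Neumann series for the inverse of T^N - y, applied to
    \<open>f\<close>.\<close>
  define a where "a k = (\<lambda>x. - (inverse y ^ Suc k) * (T ^^ (N * k)) f x)" for k
  have powV: "(T ^^ (N * k)) f \<in> V" for k by (rule markov_power_invariant[OF V(3) f])
  have aV: "a k \<in> V" for k
    unfolding a_def by (rule cfun.subspace_scale[OF V(1) powV])
  have pow: "holder_norm \<alpha> ((T ^^ (N * k)) f) \<le> \<kappa> ^ k * holder_norm \<alpha> f" for k
  proof (induction k)
    case (Suc k)
    have "(T ^^ (N * Suc k)) f = ?A ((T ^^ (N * k)) f)" by (simp add: funpow_add)
    then have "holder_norm \<alpha> ((T ^^ (N * Suc k)) f) \<le> \<kappa> * holder_norm \<alpha> ((T ^^ (N * k)) f)"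
      using \<kappa>(1)[OF powV] by simp
    also have "\<dots> \<le> \<kappa> * (\<kappa> ^ k * holder_norm \<alpha> f)" using \<kappa>(2) Suc by (rule mult_left_mono[rotated])
    finally show ?case by (simp add: mult.assoc)
  qed simp
  have a_le: "holder_norm \<alpha> (a k) \<le> (holder_norm \<alpha> f / cmod y) * \<theta> ^ k" for k
  proof -
    have "holder_norm \<alpha> (a k) \<le> cmod (- (inverse y ^ Suc k)) * holder_norm \<alpha> ((T ^^ (N * k)) f)"
      unfolding a_def using powV V(2) by (intro holder_norm_cmult_le \<alpha>) auto
    also have "\<dots> \<le> cmod (- (inverse y ^ Suc k)) * (\<kappa> ^ k * holder_norm \<alpha> f)"
      by (intro mult_left_mono pow) simp
    also have "cmod (- (inverse y ^ Suc k)) = inverse (cmod y) ^ Suc k"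
      by (simp only: norm_minus_cancel norm_power norm_inverse)
    also have "inverse (cmod y) ^ Suc k * (\<kappa> ^ k * holder_norm \<alpha> f) = (holder_norm \<alpha> f / cmod y) * \<theta> ^ k"
      by (simp add: \<theta>_def divide_inverse power_mult_distrib mult_ac)
    finally show ?thesis .
  qed
  obtain g where g: "g \<in> V"
    "\<And>n p. cmod (g p - (\<Sum>k<n. a k p)) \<le> (holder_norm \<alpha> f / cmod y) / (1 - \<theta>) * \<theta> ^ n"
    using holder_series[OF V(1,2,4) \<alpha>(1) aV a_le \<theta>] by blast
  have gh: "g \<in> holder \<alpha>" using g(1) V(2) by blast
  define G where "G n = (\<lambda>p. \<Sum>k<n. 1 * a k p)" for n
  have Gh: "G n \<in> holder \<alpha>" for n
    unfolding G_def by (rule subsetD[OF V(2) cfun_subspace_sum[OF V(1) aV]])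
  let ?e = "\<lambda>n. (holder_norm \<alpha> f / cmod y) / (1 - \<theta>) * \<theta> ^ n"
  have "?e \<longlonglongrightarrow> (holder_norm \<alpha> f / cmod y) / (1 - \<theta>) * 0"
    using \<theta> by (intro tendsto_intros LIMSEQ_power_zero) auto
  then have e: "?e \<longlonglongrightarrow> 0" by simp
  have Ga: "(\<lambda>n. G n p) \<longlonglongrightarrow> g p" for p
  proof -
    have "(\<lambda>n. g p - G n p) \<longlonglongrightarrow> 0"
      using g(2) by (intro Lim_null_comparison[OF _ e] always_eventually) (simp add: G_def)
    from tendsto_diff[OF tendsto_const[of "g p"] this] show ?thesis by simp
  qed
  \<comment> \<open>Pointwise convergence is enough for the equation, so the uniform error bound and
    the sup-norm contraction of the powers suffice here.\<close>
  have AG: "(\<lambda>n. ?A (G n) p) \<longlonglongrightarrow> ?A g p" for p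
  proof -
    have "cmod (?A g p - ?A (G n) p) \<le> ?e n" for n
    proof -
      have "?A g p - ?A (G n) p = ?A (\<lambda>p. g p - G n p) p"
        by (simp add: markov_power_diff[OF gh Gh \<alpha>])
      then show ?thesis
        using g(2) by (simp only:) (intro cmod_markov_power_le[OF holder_diff[OF gh Gh] \<alpha>], simp add: G_def)
    qed
    then have "(\<lambda>n. ?A g p - ?A (G n) p) \<longlonglongrightarrow> 0"
      by (intro Lim_null_comparison[OF _ e] always_eventually) simp
    from tendsto_diff[OF tendsto_const[of "?A g p"] this] show ?thesis by simp
  qed
  have an: "(\<lambda>n. a n p) \<longlonglongrightarrow> 0" for p
  proof (rule Lim_null_comparison)
    show "\<forall>\<^sub>F n in sequentially. cmod (a n p) \<le> (holder_norm \<alpha> f / cmod y) * \<theta> ^ n"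
      using order_trans[OF cmod_le_holder_norm a_le] aV V(2) \<alpha>(1) by (intro always_eventually) blast
    have "(\<lambda>n. (holder_norm \<alpha> f / cmod y) * \<theta> ^ n) \<longlonglongrightarrow> (holder_norm \<alpha> f / cmod y) * 0"
      using \<theta> by (intro tendsto_intros LIMSEQ_power_zero) auto
    then show "(\<lambda>n. (holder_norm \<alpha> f / cmod y) * \<theta> ^ n) \<longlonglongrightarrow> 0" by simp
  qed
  have shift: "?A (a k) = (\<lambda>p. y * a (Suc k) p)" for k
  proof -
    have "?A (a k) = (\<lambda>x. - (inverse y ^ Suc k) * (T ^^ (N * Suc k)) f x)"
      unfolding a_def markov_power_cmult by (simp add: funpow_add)
    then show ?thesis using y by (simp add: a_def fun_eq_iff)
  qed
  \<comment> \<open>The partial sums solve the equation up to the boundary term y a_n, which tends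
    to 0.\<close>
  have eq: "?A (G n) p - y * G n p = y * a n p + f p" for n p
  proof -
    have "?A (G n) p = (\<Sum>k<n. y * a (Suc k) p)"
      unfolding G_def using markov_power_sum[of "{..<n}" a \<alpha>, where c = "\<lambda>_. 1" and n = N] aV V(2) \<alpha>
      by (simp add: shift subset_iff)
    then have "?A (G n) p - y * G n p = y * (\<Sum>k<n. a (Suc k) p - a k p)"
      by (simp add: G_def sum_distrib_left sum_subtractf right_diff_distrib)
    also have "(\<Sum>k<n. a (Suc k) p - a k p) = a n p - a 0 p" by (rule sum_lessThan_telescope)
    also have "a 0 p = - inverse y * f p" by (simp add: a_def)
    finally show ?thesis using y by (simp add: algebra_simps)
  qed
  have "?A g p - y * g p = f p" for p
  proof (rule LIMSEQ_unique)
    show "(\<lambda>n. ?A (G n) p - y * G n p) \<longlonglongrightarrow> ?A g p - y * g p"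
      by (intro tendsto_intros AG Ga)
    have "(\<lambda>n. y * a n p + f p) \<longlonglongrightarrow> y * 0 + f p" by (intro tendsto_intros an)
    then show "(\<lambda>n. ?A (G n) p - y * G n p) \<longlonglongrightarrow> f p" by (simp add: eq)
  qed
  then show "\<exists>g\<in>V. (\<lambda>x. ?A g x - z ^ N * g x) = f"
    using g(1) unfolding y_def by blast
qed

lemma eigenfunction_in_spectrum_on:
  assumes "f \<in> V" "(\<lambda>p. 0) \<in> V" "f \<noteq> (\<lambda>p. 0)" "T f = (\<lambda>p. z * f p)"
  shows "z \<in> spectrum_on \<alpha> V T"
proof -
  have "T (\<lambda>p. 0) = (\<lambda>p. 0)"
    using markov_cmult[of 0 "\<lambda>p. 0"] by simp
  then have eq: "shifted z f = shifted z (\<lambda>p. 0)" by (simp add: assms(4))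
  have "\<not> inj_on (shifted z) V"
    using inj_onD[OF _ eq assms(1,2)] assms(3) by blast
  then show ?thesis by (auto simp: spectrum_on_def bij_betw_def)
qed

lemma spectral_radius_holder:
  assumes "0 < \<alpha>" "\<alpha> \<le> 1"
  shows "spectral_radius_on \<alpha> (holder \<alpha>) T = 1"
  unfolding spectral_radius_on_def
proof (rule antisym)
  show "(SUP z\<in>spectrum_on \<alpha> (holder \<alpha>) T. ennreal (cmod z)) \<le> 1"
  proof (rule SUP_least)
    fix z assume z: "z \<in> spectrum_on \<alpha> (holder \<alpha>) T"
    have "cmod z \<le> 1"
    proof (rule ccontr)
      assume "\<not> cmod z \<le> 1"
      \<comment> \<open>The bound 5 holds for all powers, so a high power of any |z| > 1 exceeds
        it.\<close>
      then obtain N where "5 < cmod z ^ N" using real_arch_pow[of "cmod z" 5] by auto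
      then have "z \<notin> spectrum_on \<alpha> (holder \<alpha>) T"
        using assms by (intro contraction_not_in_spectrum_on[where \<kappa> = 5 and N = N] cfun_subspace_holder
            holder_norm_markov_power_le) (auto intro: markov_holder simp: holder_closed_def)
      with z show False by simp
    qed
    then show "ennreal (cmod z) \<le> 1" by simp
  qed
  have "holder_const \<alpha> 0 (\<lambda>p :: 'n cproj. 1)" by (simp add: holder_const_def)
  then have "(\<lambda>p :: 'n cproj. 1) \<in> holder \<alpha>" unfolding mem_holder_iff by (rule exI)
  then have "1 \<in> spectrum_on \<alpha> (holder \<alpha>) T"
    by (rule eigenfunction_in_spectrum_on[OF _ holder_zero]) (auto simp: markov_one fun_eq_iff)
  from SUP_upper[OF this, of "\<lambda>z. ennreal (cmod z)"]
  show "1 \<le> (SUP z\<in>spectrum_on \<alpha> (holder \<alpha>) T. ennreal (cmod z))" by simp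
qed

end

section \<open>The spectral decomposition\<close>

context proximal_markov
begin

definition vanishing_holder :: "real \<Rightarrow> ('n cproj \<Rightarrow> complex) set" where
  "vanishing_holder \<alpha> = {f \<in> holder \<alpha>. vanishing f}"

text \<open>Closedness under uniform approximation, since iteration does not increase the
  approximation error. It is used for closedness in the Hoelder norm and for the compactness
  argument.\<close>

lemma vanishing_holderI:
  assumes "f \<in> holder \<alpha>" "0 < \<alpha>" "\<alpha> \<le> 1"
    and "\<And>e. 0 < e \<Longrightarrow> \<exists>g. vanishing g \<and> g \<in> holder \<alpha> \<and> (\<forall>p. cmod (f p - g p) \<le> e)"
  shows "f \<in> vanishing_holder \<alpha>"
proof -
  have "vanishing f"
  proof (rule vanishingI[OF assms(1-3)])
    fix e :: real assume e: "0 < e"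
    then obtain g where g: "vanishing g" "g \<in> holder \<alpha>" "\<And>p. cmod (f p - g p) \<le> e / 2"
      using assms(4)[of "e / 2"] by auto
    then obtain n where n: "\<And>p. cmod ((T ^^ n) g p) \<le> e / 2"
      using e unfolding vanishing_def by (meson half_gt_zero order_refl)
    have "cmod ((T ^^ n) f p) \<le> e" for p
    proof -
      have "cmod ((T ^^ n) (\<lambda>p. f p - g p) p) \<le> e / 2"
        by (rule cmod_markov_power_le[OF holder_diff[OF assms(1) g(2)] assms(2,3) g(3)])
      then have "cmod ((T ^^ n) f p - (T ^^ n) g p) \<le> e / 2"
        by (simp add: markov_power_diff[OF assms(1) g(2) assms(2,3)])
      then show ?thesis
        using n[of p] norm_triangle_ineq2[of "(T ^^ n) f p" "(T ^^ n) g p"] by linarith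
    qed
    then show "\<exists>n. \<forall>p. cmod ((T ^^ n) f p) \<le> e" by blast
  qed
  with assms(1) show ?thesis by (simp add: vanishing_holder_def)
qed

lemma subspace_vanishing_holder:
  assumes \<alpha>: "0 < \<alpha>" "\<alpha> \<le> 1"
  shows "cfun.subspace (vanishing_holder \<alpha>)"
proof (rule cfun_subspaceI)
  have "(T ^^ n) (\<lambda>p. 0) = (\<lambda>p. 0)" for n
    using markov_power_cmult[of n 0 "\<lambda>p. 0"] by simp
  then show "(\<lambda>p. 0) \<in> vanishing_holder \<alpha>"
    by (auto simp: vanishing_holder_def vanishing_def holder_zero intro: exI[of _ 0])
next
  fix f g assume fg: "f \<in> vanishing_holder \<alpha>" "g \<in> vanishing_holder \<alpha>"
  then have h: "f \<in> holder \<alpha>" "g \<in> holder \<alpha>" by (auto simp: vanishing_holder_def)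
  have "vanishing (\<lambda>p. f p + g p)"
  proof (rule vanishingI[OF holder_add[OF h] \<alpha>])
    fix e :: real assume "0 < e"
    then have e: "0 < e / 2" by simp
    obtain N where N: "\<And>n p. N \<le> n \<Longrightarrow> cmod ((T ^^ n) f p) \<le> e / 2"
      using fg(1) e unfolding vanishing_holder_def vanishing_def by blast
    obtain M where M: "\<And>n p. M \<le> n \<Longrightarrow> cmod ((T ^^ n) g p) \<le> e / 2"
      using fg(2) e unfolding vanishing_holder_def vanishing_def by blast
    have "cmod ((T ^^ (max N M)) (\<lambda>p. f p + g p) p) \<le> e" for p
    proof -
      have "(T ^^ (max N M)) (\<lambda>p. f p + g p) p = (T ^^ (max N M)) f p + (T ^^ (max N M)) g p"
        using markov_power_linear[OF h \<alpha>, of "max N M" 1 1] by simp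
      then show ?thesis
        using N[of "max N M" p] M[of "max N M" p]
          norm_triangle_ineq[of "(T ^^ (max N M)) f p" "(T ^^ (max N M)) g p"] by simp
    qed
    then show "\<exists>n. \<forall>p. cmod ((T ^^ n) (\<lambda>p. f p + g p) p) \<le> e" by blast
  qed
  then show "(\<lambda>p. f p + g p) \<in> vanishing_holder \<alpha>"
    using holder_add[OF h] by (simp add: vanishing_holder_def)
next
  fix c f assume f: "f \<in> vanishing_holder \<alpha>"
  then have h: "f \<in> holder \<alpha>" by (auto simp: vanishing_holder_def)
  have "vanishing (\<lambda>p. c * f p)"
  proof (rule vanishingI[OF holder_cmult[OF h] \<alpha>])
    fix e :: real assume "0 < e"
    then have "0 < e / (cmod c + 1)" by (intro divide_pos_pos) (simp_all add: add_nonneg_pos)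
    then obtain N where N: "\<And>p. cmod ((T ^^ N) f p) \<le> e / (cmod c + 1)"
      using f unfolding vanishing_holder_def vanishing_def by blast
    have "cmod ((T ^^ N) (\<lambda>p. c * f p) p) \<le> e" for p
    proof -
      have "cmod ((T ^^ N) (\<lambda>p. c * f p) p) = cmod c * cmod ((T ^^ N) f p)"
        by (simp add: markov_power_cmult norm_mult)
      also have "\<dots> \<le> (cmod c + 1) * (e / (cmod c + 1))"
        using N[of p] by (intro mult_mono) auto
      also have "\<dots> = e"
        using norm_ge_zero[of c] by (simp add: add_nonneg_eq_0_iff)
      finally show ?thesis .
    qed
    then show "\<exists>n. \<forall>p. cmod ((T ^^ n) (\<lambda>p. c * f p) p) \<le> e" by blast
  qed
  then show "(\<lambda>p. c * f p) \<in> vanishing_holder \<alpha>"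
    using holder_cmult[OF h] by (simp add: vanishing_holder_def)
qed

lemma markov_vanishing_holder:
  assumes "0 < \<alpha>" "\<alpha> \<le> 1"
  shows "T ` vanishing_holder \<alpha> \<subseteq> vanishing_holder \<alpha>"
proof safe
  fix f assume f: "f \<in> vanishing_holder \<alpha>"
  have "vanishing (T f)"
    unfolding vanishing_def
  proof (intro allI impI)
    fix e :: real assume "e > 0"
    then obtain N where N: "\<And>n p. N \<le> n \<Longrightarrow> cmod ((T ^^ n) f p) \<le> e"
      using f unfolding vanishing_holder_def vanishing_def by blast
    have "cmod ((T ^^ n) (T f) p) \<le> e" if "N \<le> n" for n p
      using N[of "Suc n" p] that by (simp add: funpow_swap1)
    then show "\<exists>N. \<forall>n\<ge>N. \<forall>p. cmod ((T ^^ n) (T f) p) \<le> e" by blast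
  qed
  then show "T f \<in> vanishing_holder \<alpha>"
    using f assms by (auto simp: vanishing_holder_def intro: markov_holder)
qed

lemma holder_closed_vanishing_holder:
  assumes \<alpha>: "0 < \<alpha>" "\<alpha> \<le> 1"
  shows "holder_closed \<alpha> (vanishing_holder \<alpha>)"
  unfolding holder_closed_def
proof (intro ballI impI)
  fix f assume f: "f \<in> holder \<alpha>" "\<forall>\<epsilon>>0. \<exists>g\<in>vanishing_holder \<alpha>. holder_norm \<alpha> (f - g) < \<epsilon>"
  show "f \<in> vanishing_holder \<alpha>"
  proof (rule vanishing_holderI[OF f(1) \<alpha>])
    fix e :: real assume "0 < e"
    then obtain g where g: "g \<in> vanishing_holder \<alpha>" "holder_norm \<alpha> (f - g) < e" using f(2) by blast
    then have gh: "g \<in> holder \<alpha>" "vanishing g" by (auto simp: vanishing_holder_def)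
    have "cmod (f p - g p) \<le> e" for p
      using cmod_le_holder_norm[OF holder_diff[OF f(1) gh(1)] \<alpha>(1), of p] g(2) by (simp add: fun_diff_def)
    then show "\<exists>g. vanishing g \<and> g \<in> holder \<alpha> \<and> (\<forall>p. cmod (f p - g p) \<le> e)" using gh by blast
  qed
qed

text \<open>The unit ball is relatively compact for uniform convergence, so convergence is uniform on it.\<close>

lemma vanishing_uniform:
  assumes \<alpha>: "0 < \<alpha>" "\<alpha> \<le> 1" and \<epsilon>: "0 < \<epsilon>"
  shows "\<exists>n. \<forall>f\<in>vanishing_holder \<alpha>. holder_norm \<alpha> f \<le> 1 \<longrightarrow> (\<forall>p. cmod ((T ^^ n) f p) \<le> \<epsilon>)"
proof (rule ccontr)
  assume "\<not> ?thesis"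
  then have "\<forall>n. \<exists>f p. f \<in> vanishing_holder \<alpha> \<and> holder_norm \<alpha> f \<le> 1 \<and> \<epsilon> < cmod ((T ^^ n) f p)"
    by (meson not_le)
  then obtain f p where f: "\<And>n. f n \<in> vanishing_holder \<alpha>" "\<And>n. holder_norm \<alpha> (f n) \<le> 1"
    "\<And>n. \<epsilon> < cmod ((T ^^ n) (f n) (p n))" by metis
  have fh: "f n \<in> holder \<alpha>" "vanishing (f n)" for n using f(1) by (auto simp: vanishing_holder_def)
  have "holder_const \<alpha> 1 (f n)" for n
  proof -
    obtain s m where sm: "holder_norm \<alpha> (f n) = s + m" "holder_const \<alpha> m (f n)" "0 \<le> s"
      using holder_normE[OF fh(1) \<alpha>(1)] by metis
    then show ?thesis using f(2)[of n] by (intro holder_const_mono[OF sm(2)]) simp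
  qed
  moreover have "cmod (f n p) \<le> 1" for n p
    using cmod_le_holder_norm[OF fh(1) \<alpha>(1)] f(2) order_trans by blast
  ultimately obtain g r where r: "strict_mono (r :: nat \<Rightarrow> nat)"
    "uniform_limit UNIV (\<lambda>n. f (r n)) g sequentially" "holder_const \<alpha> 1 g"
    using holder_compactness[of \<alpha> 1 f 1] \<alpha>(1) by metis
  have close: "\<exists>N. \<forall>i\<ge>N. \<forall>p. cmod (f (r i) p - g p) < e" if "e > 0" for e
    using r(2) that unfolding uniform_limit_iff eventually_sequentially dist_norm by blast
  have gh: "g \<in> holder \<alpha>" using r(3) unfolding mem_holder_iff by blast
  have "g \<in> vanishing_holder \<alpha>"
  proof (rule vanishing_holderI[OF gh \<alpha>])
    fix e :: real assume "0 < e"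
    then obtain N where "\<And>p. cmod (f (r N) p - g p) < e" using close by blast
    then have "cmod (g p - f (r N) p) \<le> e" for p by (simp add: norm_minus_commute less_imp_le)
    then show "\<exists>h. vanishing h \<and> h \<in> holder \<alpha> \<and> (\<forall>p. cmod (g p - h p) \<le> e)" using fh by blast
  qed
  then obtain M where M: "\<And>n p. M \<le> n \<Longrightarrow> cmod ((T ^^ n) g p) \<le> \<epsilon> / 2"
    using half_gt_zero[OF \<epsilon>] unfolding vanishing_holder_def vanishing_def by blast
  obtain N where N: "\<And>i p. i \<ge> N \<Longrightarrow> cmod (f (r i) p - g p) < \<epsilon> / 2"
    using close[of "\<epsilon> / 2"] \<epsilon> by auto
  let ?i = "max M N" and ?n = "r (max M N)"
  have "M \<le> ?n" using seq_suble[OF r(1), of ?i] by simp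
  then have 1: "cmod ((T ^^ ?n) g (p ?n)) \<le> \<epsilon> / 2" by (rule M)
  have "cmod ((T ^^ ?n) (\<lambda>p. f ?n p - g p) (p ?n)) \<le> \<epsilon> / 2"
    by (rule cmod_markov_power_le[OF holder_diff[OF fh(1) gh] \<alpha>]) (use N[of ?i] less_imp_le in auto)
  then have "cmod ((T ^^ ?n) (f ?n) (p ?n) - (T ^^ ?n) g (p ?n)) \<le> \<epsilon> / 2"
    by (simp add: markov_power_diff[OF fh(1) gh \<alpha>])
  then have "cmod ((T ^^ ?n) (f ?n) (p ?n)) \<le> \<epsilon>"
    using 1 norm_triangle_ineq2[of "(T ^^ ?n) (f ?n) (p ?n)" "(T ^^ ?n) g (p ?n)"] by linarith
  then show False using f(3)[of ?n] by simp
qed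

lemma contraction_on_vanishing:
  assumes \<alpha>: "0 < \<alpha>" "\<alpha> \<le> 1"
  obtains N where "1 \<le> N" "\<And>f. f \<in> vanishing_holder \<alpha> \<Longrightarrow> holder_norm \<alpha> ((T ^^ N) f) \<le> 1 / 2 * holder_norm \<alpha> f"
proof -
  \<comment> \<open>With 1/20 here and in the Lasota-Yorke inequality, the final norm is at most (1
    + 5 + 4)/20 = 1/2: the sup part, the power bound 5, and 4 as a bound for 2 sqrt 2.\<close>
  obtain n where n: "\<And>f p. f \<in> vanishing_holder \<alpha> \<Longrightarrow> holder_norm \<alpha> f \<le> 1 \<Longrightarrow> cmod ((T ^^ n) f p) \<le> 1 / 20"
    using vanishing_uniform[OF \<alpha>, of "1 / 20"] by auto
  have sup: "cmod ((T ^^ n) f p) \<le> 1 / 20 * holder_norm \<alpha> f" if f: "f \<in> vanishing_holder \<alpha>" for f p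
  proof (cases "holder_norm \<alpha> f = 0")
    case True
    have fh: "f \<in> holder \<alpha>" using f by (simp add: vanishing_holder_def)
    have "cmod ((T ^^ n) f p) \<le> 0"
      by (rule cmod_markov_power_le[OF fh \<alpha>]) (use cmod_le_holder_norm[OF fh \<alpha>(1)] True in simp)
    then show ?thesis using True by simp
  next
    case False
    let ?t = "holder_norm \<alpha> f"
    have fh: "f \<in> holder \<alpha>" using f by (simp add: vanishing_holder_def)
    have t: "?t > 0" using False holder_norm_nonneg[OF fh \<alpha>(1)] by simp
    have "(\<lambda>p. complex_of_real (inverse ?t) * f p) \<in> vanishing_holder \<alpha>"
      by (rule cfun.subspace_scale[OF subspace_vanishing_holder[OF \<alpha>] f])
    moreover have "holder_norm \<alpha> (\<lambda>p. complex_of_real (inverse ?t) * f p) \<le> 1"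
      using holder_norm_cmult_le[OF fh \<alpha>(1), of "complex_of_real (inverse ?t)"] t by (simp add: norm_inverse)
    ultimately have "cmod ((T ^^ n) (\<lambda>p. complex_of_real (inverse ?t) * f p) p) \<le> 1 / 20" by (rule n)
    then have "inverse ?t * cmod ((T ^^ n) f p) \<le> 1 / 20"
      using t by (simp add: markov_power_cmult norm_mult norm_inverse)
    then show ?thesis using t by (simp add: field_simps)
  qed
  obtain K where K: "\<And>k f m s p q. K \<le> k \<Longrightarrow> holder_const \<alpha> m f \<Longrightarrow> (\<And>p. cmod (f p) \<le> s) \<Longrightarrow>
      cmod ((T ^^ k) f p - (T ^^ k) f q) \<le> 1 / 20 * m * dist p q powr \<alpha> + s * (2 * sqrt 2 * dist p q)"
    using Lasota_Yorke[OF Pur \<alpha>, of "1 / 20"] by (metis zero_less_divide_1_iff zero_less_numeral)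
  \<comment> \<open>Keeps the total exponent positive, so that an N-th root can be taken of the
    contraction factor.\<close>
  let ?k = "max K 1"
  have "holder_norm \<alpha> ((T ^^ (?k + n)) f) \<le> 1 / 2 * holder_norm \<alpha> f" if f: "f \<in> vanishing_holder \<alpha>" for f
  proof -
    let ?t = "holder_norm \<alpha> f" and ?g = "(T ^^ n) f"
    have fh: "f \<in> holder \<alpha>" using f by (simp add: vanishing_holder_def)
    have t: "0 \<le> ?t" by (rule holder_norm_nonneg[OF fh \<alpha>(1)])
    have gh: "?g \<in> holder \<alpha>" by (rule markov_power_holder[OF fh \<alpha>])
    obtain s m where sm: "holder_norm \<alpha> ?g = s + m" "holder_const \<alpha> m ?g" "0 \<le> s" "0 \<le> m"
      using holder_normE[OF gh \<alpha>(1)] by metis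
    have m: "m \<le> 5 * ?t" using holder_norm_markov_power_le[OF fh \<alpha>, of n] sm by simp
    have "holder_const \<alpha> (1 / 20 * (5 * ?t) + 1 / 20 * ?t * 4) ((T ^^ ?k) ?g)"
      unfolding holder_const_def
    proof (intro conjI allI)
      show "0 \<le> 1 / 20 * (5 * ?t) + 1 / 20 * ?t * 4" using t by simp
      fix p q :: "'n cproj"
      have "sqrt 2 \<le> 2" by (rule real_le_lsqrt) auto
      then have "2 * sqrt 2 * dist p q \<le> 4 * dist p q powr \<alpha>"
        using dist_le_powr[OF \<alpha>, of p q] by (intro mult_mono) auto
      then have "1 / 20 * ?t * (2 * sqrt 2 * dist p q) \<le> 1 / 20 * ?t * (4 * dist p q powr \<alpha>)"
        using t by (intro mult_left_mono) auto
      moreover have "1 / 20 * m * dist p q powr \<alpha> \<le> 1 / 20 * (5 * ?t) * dist p q powr \<alpha>"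
        using m by (intro mult_right_mono) auto
      moreover have "cmod ((T ^^ ?k) ?g p - (T ^^ ?k) ?g q)
          \<le> 1 / 20 * m * dist p q powr \<alpha> + 1 / 20 * ?t * (2 * sqrt 2 * dist p q)"
        by (rule K[OF _ sm(2) sup[OF f]]) simp
      ultimately show "cmod ((T ^^ ?k) ?g p - (T ^^ ?k) ?g q) \<le> (1 / 20 * (5 * ?t) + 1 / 20 * ?t * 4) * dist p q powr \<alpha>"
        by (simp add: algebra_simps)
    qed
    then have "holder_norm \<alpha> ((T ^^ ?k) ?g) \<le> 1 / 20 * ?t + (1 / 20 * (5 * ?t) + 1 / 20 * ?t * 4)"
      by (rule holder_norm_le) (rule cmod_markov_power_le[OF gh \<alpha> sup[OF f]])
    then show ?thesis by (simp add: funpow_add)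
  qed
  then show ?thesis using that[of "?k + n"] by simp
qed

lemma spectral_radius_vanishing_holder:
  assumes \<alpha>: "0 < \<alpha>" "\<alpha> \<le> 1"
  shows "spectral_radius_on \<alpha> (vanishing_holder \<alpha>) T < 1"
proof -
  obtain N where N: "1 \<le> N"
    "\<And>f. f \<in> vanishing_holder \<alpha> \<Longrightarrow> holder_norm \<alpha> ((T ^^ N) f) \<le> 1 / 2 * holder_norm \<alpha> f"
    using contraction_on_vanishing[OF \<alpha>] by metis
  define \<rho> where "\<rho> = root N (1 / 2)"
  have \<rho>: "0 \<le> \<rho>" "\<rho> < 1" "\<rho> ^ N = 1 / 2"
    using N(1) by (auto simp: \<rho>_def)
  have "spectral_radius_on \<alpha> (vanishing_holder \<alpha>) T \<le> ennreal \<rho>"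
    unfolding spectral_radius_on_def
  proof (intro SUP_least ennreal_leI)
    fix z assume z: "z \<in> spectrum_on \<alpha> (vanishing_holder \<alpha>) T"
    show "cmod z \<le> \<rho>"
    proof (rule ccontr)
      assume "\<not> cmod z \<le> \<rho>"
      then have "\<rho> ^ N < cmod z ^ N" using \<rho> N(1) by (intro power_strict_mono) auto
      then have "z \<notin> spectrum_on \<alpha> (vanishing_holder \<alpha>) T"
        using N(2) \<rho>(3)
        by (intro contraction_not_in_spectrum_on[OF subspace_vanishing_holder[OF \<alpha>] _
              markov_vanishing_holder[OF \<alpha>] holder_closed_vanishing_holder[OF \<alpha>] \<alpha>, where \<kappa> = "1 / 2" and N = N])
          (auto simp: vanishing_holder_def)
      with z show False by simp
    qed
  qed
  also have "ennreal \<rho> < 1" using \<rho> by (simp add: ennreal_less_one_iff)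
  finally show ?thesis .
qed

section \<open>The finite-dimensional part and its spectrum\<close>

lemma subspace_periodic: "cfun.subspace periodic"
proof (rule cfun_subspaceI)
  show "(\<lambda>p. 0) \<in> periodic"
    using periodic_linear_combination[of "{}"] by simp
  show "(\<lambda>p. f p + g p) \<in> periodic" if "f \<in> periodic" "g \<in> periodic" for f g
    using periodic_linear_combination[of "UNIV :: bool set" "\<lambda>b. if b then f else g" "\<lambda>_. 1"] that
    by (simp add: UNIV_bool add.commute)
  show "(\<lambda>p. c * f p) \<in> periodic" if "f \<in> periodic" for c f
    using periodic_linear_combination[of "{True}" "\<lambda>_. f" "\<lambda>_. c"] that by simp
qed

lemma markov_periodic: "T ` periodic \<subseteq> periodic"
  using periodic_markov_power[of _ 1] by auto

lemma periodic_subset_holder: "0 < \<alpha> \<Longrightarrow> \<alpha> \<le> 1 \<Longrightarrow> periodic \<subseteq> holder \<alpha>"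
  using holder_1_subset periodic_holder_1 by blast

text \<open>Passage from the word length \<open>q\<close> to the true period: every Fourier
  component that occurs belongs to a root of unity of order dividing the number of
  eigenvalues.\<close>

lemma periodic_power_card:
  assumes f: "f \<in> periodic"
  shows "(T ^^ card eigenvalues) f = f"
proof -
  let ?k = "card eigenvalues"
  have comp: "(T ^^ ?k) (fourier_component z f) = fourier_component z f" if "z \<in> eigenvalues" for z
  proof -
    have "z ^ q = 1"
      using that eigenvalue_root_of_unity unfolding eigenvalues_def by blast
    moreover have "z ^ ?k = 1" using that eigenvalues_roots_of_unity by blast
    ultimately show ?thesis using eigenfunction_power[OF markov_fourier_component[OF f], of z ?k] by simp
  qed
  have "(T ^^ ?k) (\<lambda>p. \<Sum>z\<in>eigenvalues. 1 * fourier_component z f p) = (\<lambda>p. \<Sum>z\<in>eigenvalues. 1 * (T ^^ ?k) (fourier_component z f) p)"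
    using markov_power_sum[OF finite_eigenvalues, of "\<lambda>z. fourier_component z f" 1, where c = "\<lambda>_. 1" and n = ?k]
      periodic_holder_1[OF fourier_component_periodic[OF f]] by simp
  also have "\<dots> = (\<lambda>p. \<Sum>z\<in>eigenvalues. 1 * fourier_component z f p)"
    by (intro ext sum.cong refl) (simp add: comp)
  finally show ?thesis
    using periodic_eq_sum_fourier_components[OF f] by simp
qed

text \<open>With k the number of eigenvalues, T^k is the identity here, so T^k - z^k is the scalar 1
  - z^k, which is invertible unless z is one of the k-th roots of unity.\<close>

lemma spectrum_periodic:
  assumes \<alpha>: "0 < \<alpha>" "\<alpha> \<le> 1"
  shows "spectrum_on \<alpha> periodic T = eigenvalues"
proof
  show "eigenvalues \<subseteq> spectrum_on \<alpha> periodic T"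
    using eigenfunction_in_spectrum_on[OF _ cfun.subspace_0[OF subspace_periodic, unfolded zero_fun_def]]
    unfolding eigenvalues_def by blast
  show "spectrum_on \<alpha> periodic T \<subseteq> eigenvalues"
  proof (rule ccontr)
    let ?k = "card eigenvalues"
    assume "\<not> ?thesis"
    then obtain z where z: "z \<in> spectrum_on \<alpha> periodic T" "z ^ ?k \<noteq> 1"
      using eigenvalues_roots_of_unity by blast
    have diff: "(\<lambda>x. (T ^^ ?k) f x - z ^ ?k * f x) = (\<lambda>x. (1 - z ^ ?k) * f x)" if "f \<in> periodic" for f
      by (simp add: periodic_power_card[OF that] algebra_simps)
    have "z \<notin> spectrum_on \<alpha> periodic T"
    proof (rule not_in_spectrum_on[OF subspace_periodic periodic_subset_holder[OF \<alpha>] markov_periodic \<alpha>,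
        where \<delta> = "cmod (1 - z ^ ?k)" and N = ?k])
      show "0 < cmod (1 - z ^ ?k)" using z(2) by simp
      fix f assume f: "f \<in> periodic"
      then have fh: "f \<in> holder \<alpha>" using periodic_subset_holder[OF \<alpha>] by blast
      let ?w = "1 - z ^ ?k"
      have w: "?w \<noteq> 0" using z(2) by simp
      have "holder_norm \<alpha> (\<lambda>x. inverse ?w * (?w * f x)) \<le> cmod (inverse ?w) * holder_norm \<alpha> (\<lambda>x. ?w * f x)"
        by (intro holder_norm_cmult_le holder_cmult fh \<alpha>)
      moreover have "(\<lambda>x. inverse ?w * (?w * f x)) = f" using w by (simp flip: mult.assoc)
      ultimately have "holder_norm \<alpha> f \<le> holder_norm \<alpha> (\<lambda>x. ?w * f x) / cmod ?w"
        by (simp add: norm_inverse divide_inverse mult.commute)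
      then show "cmod ?w * holder_norm \<alpha> f \<le> holder_norm \<alpha> (\<lambda>x. (T ^^ ?k) f x - z ^ ?k * f x)"
        unfolding diff[OF f] using w by (simp add: pos_le_divide_eq mult.commute)
      have "(\<lambda>x. inverse ?w * f x) \<in> periodic"
        by (rule cfun.subspace_scale[OF subspace_periodic f])
      moreover from diff[OF this]
      have "(\<lambda>x. (T ^^ ?k) (\<lambda>x. inverse ?w * f x) x - z ^ ?k * (inverse ?w * f x)) = f"
        using right_inverse[OF w] by (simp only: mult.assoc[symmetric] mult_1_left)
      ultimately show "\<exists>g\<in>periodic. (\<lambda>x. (T ^^ ?k) g x - z ^ ?k * g x) = f" by blast
    qed
    with z(1) show False by simp
  qed
qed

text \<open>One eigenfunction per eigenvalue, normalised at \<open>p0\<close>, is enough: each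
  Fourier component is a multiple of it.\<close>

lemma periodic_finite_span: "\<exists>B. finite B \<and> periodic = cfun.span B"
proof -
  have "\<forall>z\<in>eigenvalues. \<exists>f. f \<in> periodic \<and> f p0 = 1 \<and> T f = (\<lambda>p. z * f p)"
    using eigenvaluesE by metis
  then obtain e where e: "\<And>z. z \<in> eigenvalues \<Longrightarrow> e z \<in> periodic \<and> e z p0 = 1 \<and> T (e z) = (\<lambda>p. z * e z p)"
    by metis
  have "periodic = cfun.span (e ` eigenvalues)"
  proof
    show "cfun.span (e ` eigenvalues) \<subseteq> periodic"
      using e by (intro cfun.span_minimal subspace_periodic) auto
    show "periodic \<subseteq> cfun.span (e ` eigenvalues)"
    proof
      fix f assume f: "f \<in> periodic"
      have "fourier_component z f \<in> cfun.span (e ` eigenvalues)" if z: "z \<in> eigenvalues" for z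
      proof -
        have "z ^ q = 1"
          using z eigenvalue_root_of_unity unfolding eigenvalues_def by blast
        then have "fourier_component z f = (\<lambda>p. fourier_component z f p0 * e z p)"
          using eigenfunction_unique[of "e z" z "fourier_component z f"] e[OF z] fourier_component_periodic[OF f] markov_fourier_component[OF f]
          by blast
        moreover have "(\<lambda>p. fourier_component z f p0 * e z p) \<in> cfun.span (e ` eigenvalues)"
          by (intro cfun.span_scale cfun.span_base) (use z in auto)
        ultimately show ?thesis by simp
      qed
      then have "(\<lambda>p. \<Sum>z\<in>eigenvalues. 1 * fourier_component z f p) \<in> cfun.span (e ` eigenvalues)"
        by (intro cfun_subspace_sum cfun.subspace_span)
      then show "f \<in> cfun.span (e ` eigenvalues)"
        using periodic_eq_sum_fourier_components[OF f] by simp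
    qed
  qed
  then show ?thesis using finite_eigenvalues by blast
qed

text \<open>There are no Jordan blocks, because X^k - 1 annihilates T and has simple roots.
  Concretely, the cofactor kills (T - z) f, but multiplies an eigenfunction by k z^(k-1), which is
  not 0.\<close>

lemma shifted_power_zero:
  assumes "f \<in> periodic" "z \<in> eigenvalues" "(shifted z ^^ m) f = (\<lambda>p. 0)"
  shows "shifted z f = (\<lambda>p. 0)"
  using assms(1,3)
proof (induction m arbitrary: f)
  case 0
  then show ?case using markov_cmult[of 0 "\<lambda>p. 0"] by simp
next
  case (Suc m)
  let ?h = "shifted z f" and ?k = "card eigenvalues"
  have zk: "z ^ ?k = 1" using assms(2) eigenvalues_roots_of_unity by blast
  then have z: "z \<noteq> 0" using card_eigenvalues_pos by (auto simp: power_0_left)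
  have h: "?h \<in> periodic"
    using cfun_subspace_diff[OF subspace_periodic, of "T f" "\<lambda>p. z * f p"] markov_periodic Suc.prems(1)
      cfun.subspace_scale[OF subspace_periodic Suc.prems(1), of z] by blast
  have "(shifted z ^^ m) ?h = (\<lambda>p. 0)" by (rule Suc.prems(2)[unfolded funpow_Suc_right o_apply])
  then have "shifted z ?h = (\<lambda>p. 0)" by (rule Suc.IH[OF h])
  then have eigen: "T ?h = (\<lambda>p. z * ?h p)" by (simp add: fun_eq_iff)
  have "cofactor ?k z ?h = (\<lambda>p. 0)"
    using cofactor_shifted[OF periodic_holder_1[OF Suc.prems(1)]] zk periodic_power_card[OF Suc.prems(1)] by simp
  moreover have "cofactor ?k z ?h p = of_nat ?k * z ^ (?k - 1) * ?h p" for p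
  proof -
    have "cofactor ?k z ?h p = (\<Sum>j<?k. z ^ (?k - 1) * ?h p)"
      unfolding cofactor_def eigenfunction_power[OF eigen]
      by (intro sum.cong refl) (simp add: mult.assoc[symmetric] power_add[symmetric] del: mult.assoc)
    then show ?thesis by (simp add: mult.assoc)
  qed
  ultimately have "of_nat ?k * z ^ (?k - 1) * ?h p = 0" for p by metis
  then show ?case using z card_eigenvalues_pos by (simp add: fun_eq_iff)
qed

lemma alg_mult_periodic:
  assumes z: "z \<in> eigenvalues"
  shows "alg_mult_on periodic T z = 1"
proof -
  obtain e where e: "e \<in> periodic" "e p0 = 1" "T e = (\<lambda>p. z * e p)" using eigenvaluesE[OF z] .
  let ?V = "{f \<in> periodic. \<exists>m. (shifted z ^^ m) f = 0}"
  have "?V = cfun.span {e}"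
  proof
    show "?V \<subseteq> cfun.span {e}"
    proof
      fix f assume "f \<in> ?V"
      then obtain m where f: "f \<in> periodic" "(shifted z ^^ m) f = (\<lambda>p. 0)" by (auto simp: zero_fun_def)
      have "T f = (\<lambda>p. z * f p)"
        using shifted_power_zero[OF f(1) z f(2)] by (simp add: fun_eq_iff)
      then have "f = (\<lambda>p. f p0 * e p)"
        using eigenfunction_unique[OF e(1,3) f(1) _ e(2)] by blast
      moreover have "(\<lambda>p. f p0 * e p) \<in> cfun.span {e}"
        by (intro cfun.span_scale cfun.span_base) simp
      ultimately show "f \<in> cfun.span {e}" by simp
    qed
    show "cfun.span {e} \<subseteq> ?V"
    proof
      fix f assume "f \<in> cfun.span {e}"
      then obtain c where c: "f = (\<lambda>p. c * e p)" by (auto simp: cfun.span_singleton)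
      have "f \<in> periodic" unfolding c by (rule cfun.subspace_scale[OF subspace_periodic e(1)])
      moreover have "(shifted z ^^ 1) f = 0"
        by (simp add: c markov_cmult e(3) zero_fun_def)
      ultimately show "f \<in> ?V" by blast
    qed
  qed
  moreover have "e \<noteq> 0" using e(2) by auto
  then have "cfun.dim (cfun.span {e}) = 1"
    by (subst cfun.dim_span, subst cfun.dim_eq_card_independent) auto
  ultimately show ?thesis by (simp add: alg_mult_on_def)
qed

text \<open>Iteration preserves the norm of a periodic function and sends that of a vanishing one to
  0.\<close>

lemma periodic_Int_vanishing:
  assumes "0 < \<alpha>" "\<alpha> \<le> 1"
  shows "periodic \<inter> vanishing_holder \<alpha> = {0}"
proof
  show "{0} \<subseteq> periodic \<inter> vanishing_holder \<alpha>"
    using cfun.subspace_0[OF subspace_periodic] cfun.subspace_0[OF subspace_vanishing_holder[OF assms]] by simp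
  show "periodic \<inter> vanishing_holder \<alpha> \<subseteq> {0}"
  proof
    fix f assume "f \<in> periodic \<inter> vanishing_holder \<alpha>"
    then have f: "f \<in> periodic" "vanishing f" by (auto simp: vanishing_holder_def)
    have "sup_norm f \<le> 0 + e" if e: "e > 0" for e
    proof -
      obtain N where "\<And>p. cmod ((T ^^ N) f p) \<le> e"
        using f(2) e unfolding vanishing_def by blast
      then have "sup_norm ((T ^^ N) f) \<le> e" by (rule sup_norm_leI)
      then show ?thesis by (simp add: sup_norm_markov_power_periodic[OF f(1)])
    qed
    then have "sup_norm f \<le> 0" by (rule field_le_epsilon)
    then have "cmod (f p) \<le> 0" for p
      using cmod_le_sup_norm[OF periodic_continuous[OF f(1)], of p] by linarith
    then have "f p = 0" for p by simp
    then show "f \<in> {0}" by auto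
  qed
qed

lemma holder_eq_periodic_plus_vanishing:
  assumes "0 < \<alpha>" "\<alpha> \<le> 1"
  shows "holder \<alpha> = {f + g | f g. f \<in> periodic \<and> g \<in> vanishing_holder \<alpha>}"
proof
  show "holder \<alpha> \<subseteq> {f + g | f g. f \<in> periodic \<and> g \<in> vanishing_holder \<alpha>}"
  proof
    fix f :: "'n cproj \<Rightarrow> complex" assume f: "f \<in> holder \<alpha>"
    obtain l where l: "l \<in> periodic" "vanishing (\<lambda>p. f p - l p)"
      using asymptotically_periodic[OF f assms] by blast
    have "(\<lambda>p. f p - l p) \<in> vanishing_holder \<alpha>"
      using l f periodic_subset_holder[OF assms] by (auto simp: vanishing_holder_def intro: holder_diff)
    moreover have "f = l + (\<lambda>p. f p - l p)" by (simp add: fun_eq_iff)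
    ultimately show "f \<in> {f + g | f g. f \<in> periodic \<and> g \<in> vanishing_holder \<alpha>}" using l(1) by blast
  qed
  show "{f + g | f g. f \<in> periodic \<and> g \<in> vanishing_holder \<alpha>} \<subseteq> holder \<alpha>"
    using periodic_subset_holder[OF assms] by (auto simp: vanishing_holder_def plus_fun_def intro!: holder_add)
qed

lemma spectrum_periodic_cis:
  assumes "0 < \<alpha>" "\<alpha> \<le> 1"
  shows "\<exists>p::nat. p \<ge> 1 \<and> spectrum_on \<alpha> periodic T = {cis (real l / real p * (2 * pi)) | l. l < p}"
proof (intro exI conjI)
  let ?k = "card eigenvalues"
  show "?k \<ge> 1" using card_eigenvalues_pos by simp
  have "{z. z ^ ?k = 1} = (\<lambda>l. cis (2 * pi * real l / real ?k)) ` {..<?k}"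
    using Complex.bij_betw_roots_unity[OF card_eigenvalues_pos] by (simp add: bij_betw_def)
  also have "\<dots> = {cis (real l / real ?k * (2 * pi)) | l. l < ?k}"
    by (auto simp: image_def mult_ac)
  finally show "spectrum_on \<alpha> periodic T = {cis (real l / real ?k * (2 * pi)) | l. l < ?k}"
    using spectrum_periodic[OF assms] eigenvalues_roots_of_unity by simp
qed

end

theorem theorem3p2:
  fixes \<mu> :: "(complex ^ 'n::finite ^ 'n) measure"
  assumes "sets \<mu> = sets borel"
    and "integrable \<mu> (\<lambda>v. (norm v)\<^sup>2)"
    and "(\<integral>v. adj v ** v \<partial>\<mu>) = mat 1"
    and "Pur \<mu>"
    and "Erg \<mu>"
  shows "\<exists>\<F> :: ('n cproj \<Rightarrow> complex) set. \<forall>\<alpha>. 0 < \<alpha> \<and> \<alpha> \<le> 1 \<longrightarrow>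
    (\<exists>\<G>. cfun.subspace \<F> \<and> \<F> \<subseteq> holder \<alpha> \<and>
         cfun.subspace \<G> \<and> \<G> \<subseteq> holder \<alpha> \<and> holder_closed \<alpha> \<G> \<and>
         holder \<alpha> = {f + g | f g. f \<in> \<F> \<and> g \<in> \<G>} \<and> \<F> \<inter> \<G> = {0} \<and>
         markov_op \<mu> ` \<F> \<subseteq> \<F> \<and> markov_op \<mu> ` \<G> \<subseteq> \<G> \<and>
         spectral_radius_on \<alpha> \<G> (markov_op \<mu>) < spectral_radius_on \<alpha> (holder \<alpha>) (markov_op \<mu>) \<and>
         spectral_radius_on \<alpha> (holder \<alpha>) (markov_op \<mu>) = 1 \<and>
         (\<exists>B. finite B \<and> \<F> = cfun.span B) \<and>
         (\<exists>p::nat. p \<ge> 1 \<and>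
            spectrum_on \<alpha> \<F> (markov_op \<mu>) = {cis (real l / real p * (2 * pi)) | l. l < p}) \<and>
         (\<forall>z\<in>spectrum_on \<alpha> \<F> (markov_op \<mu>). alg_mult_on \<F> (markov_op \<mu>) z = 1))"
proof -
  interpret markov_measure \<mu>
    by unfold_locales (rule assms)+
  obtain q L p0 where "1 \<le> q"
    "\<And>s p. \<exists>l\<le>L. \<exists>W\<in>words (l + q * s). W *v unit_rep p \<noteq> 0 \<and> dist (proj_act W p) p0 \<le> (1 / 2) ^ s"
    "\<And>t. \<exists>W\<in>words (q * t). W *v unit_rep p0 \<noteq> 0 \<and> proj_act W p0 = p0"
    using attracting_point[OF assms(4,5)] by metis
  then interpret proximal_markov \<mu> q L p0
    by unfold_locales (rule assms)
  show ?thesis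
  \<comment> \<open>The first space is fixed before \<alpha>, as its independence of \<alpha>
    requires; the second is chosen afterwards.\<close>
  proof (rule exI[of _ periodic], intro allI impI, elim conjE)
    fix \<alpha> :: real assume \<alpha>: "0 < \<alpha>" "\<alpha> \<le> 1"
    show "\<exists>\<G>. cfun.subspace periodic \<and> periodic \<subseteq> holder \<alpha> \<and>
         cfun.subspace \<G> \<and> \<G> \<subseteq> holder \<alpha> \<and> holder_closed \<alpha> \<G> \<and>
         holder \<alpha> = {f + g | f g. f \<in> periodic \<and> g \<in> \<G>} \<and> periodic \<inter> \<G> = {0} \<and>
         T ` periodic \<subseteq> periodic \<and> T ` \<G> \<subseteq> \<G> \<and>
         spectral_radius_on \<alpha> \<G> T < spectral_radius_on \<alpha> (holder \<alpha>) T \<and>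
         spectral_radius_on \<alpha> (holder \<alpha>) T = 1 \<and>
         (\<exists>B. finite B \<and> periodic = cfun.span B) \<and>
         (\<exists>p::nat. p \<ge> 1 \<and> spectrum_on \<alpha> periodic T = {cis (real l / real p * (2 * pi)) | l. l < p}) \<and>
         (\<forall>z\<in>spectrum_on \<alpha> periodic T. alg_mult_on periodic T z = 1)"
    proof (rule exI[of _ "vanishing_holder \<alpha>"], intro conjI)
      show "vanishing_holder \<alpha> \<subseteq> holder \<alpha>" by (auto simp: vanishing_holder_def)
      show "spectral_radius_on \<alpha> (vanishing_holder \<alpha>) T < spectral_radius_on \<alpha> (holder \<alpha>) T"
        unfolding spectral_radius_holder[OF \<alpha>] by (rule spectral_radius_vanishing_holder[OF \<alpha>])
      show "\<forall>z\<in>spectrum_on \<alpha> periodic T. alg_mult_on periodic T z = 1"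
        unfolding spectrum_periodic[OF \<alpha>] using alg_mult_periodic by blast
    qed (fact subspace_periodic periodic_subset_holder[OF \<alpha>] subspace_vanishing_holder[OF \<alpha>]
        holder_closed_vanishing_holder[OF \<alpha>] holder_eq_periodic_plus_vanishing[OF \<alpha>]
        periodic_Int_vanishing[OF \<alpha>] markov_periodic markov_vanishing_holder[OF \<alpha>]
        spectral_radius_holder[OF \<alpha>] periodic_finite_span spectrum_periodic_cis[OF \<alpha>])+
  qed
qed

end
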